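(* Let $\mathcal{C}$ be a site and let $M$ be a sheaf of abelian groups on $\mathcal{C}$. Let $$1 \to M \otimes M \to \mathscr{U}M \to M \to 1$$ be the canonical central extension of sheaves of groups on $\mathcal{C}$ defined in the context. Then the connecting map $H^1(M) \to H^2(M \otimes M)$ of nonabelian cohomology induced by this extension sends each $x \in H^1(M)$ to the self cup product $x \cup x \in H^2(M\otimes M)$.
   Context: For a sheaf of abelian groups $M$ on $\mathcal{C}$, $H^i(M) := \operatorname{Ext}^i(\mathbb{Z},M)$, where $\mathbb{Z}$ is the constant sheaf, i.e. $H^i$ is the $i$-th right derived functor of $\operatorname{Hom}(\mathbb{Z},-)$ on sheaves of abelian groups on $\mathcal{C}$; $H^1(M)$ is identified with the set of isomorphism classes of $M$-torsors. For a sheaf of possibly nonabelian groups $G$, $H^1(G)$ is the pointed set of isomorphism classes of $G$-torsors. Construction of $\mathscr{U}M$: for an abelian group $M$, let $TM=\bigoplus_{i\ge 0} T^iM$ be the tensor algebra over $\mathbb{Z}$, let $T^{\ge n}M=\bigoplus_{i\ge n}T^iM$ and $T^{<n}M=TM/T^{\ge n}M$, and let $UM$ be the kernel of $(T^{<3}M)^\times \to (T^{<1}M)^\times=\{\pm1\}$. Elements of $UM$ are the expressions $1+m+t$ with $m\in M$, $t\in M\otimes M$, with multiplication $(1+m+t)(1+m'+t')=1+(m+m')+((m\otimes m')+t+t')$. The map $1+m+t\mapsto m$ is a surjective homomorphism $UM\to M$ with central kernel $M\otimes M$ (embedded by $t\mapsto 1+t$). For a sheaf of abelian groups $M$ on $\mathcal{C}$,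 $\mathscr{U}M$ is the sheaf analogue of this construction (with $M \otimes M$ the tensor product sheaf), giving the central extension $1\to M\otimes M\to\mathscr{U}M\to M\to 1$. For a central extension $1\to A\to B\to C\to 1$ of sheaves of groups, with $A$ abelian, the connecting map $H^1(C)\to H^2(A)$ is that of Giraud (Cohomologie non abélienne, IV.3.4.1). Convention: for a covering $S'\to S$ with $S''=S'\times_S S'$, $S'''=S'\times_SS'\times_SS'$ and projections $\pi_{12},\pi_{13},\pi_{23}\colon S'''\to S''$, if a class is represented by a 1-cocycle $c\in C(S'')$ (so $\pi_{13}^*c=\pi_{12}^*c\cdot\pi_{23}^*c$) that lifts to $b\in B(S'')$, then its image is represented by the 2-cocycle $\pi_{12}^*b\cdot\pi_{23}^*b\cdot(\pi_{13}^*b)^{-1}\in A(S''')$. The cup product of classes of 1-cocycles $m,m'$ is represented by $\pi_{12}^*m\otimes\pi_{23}^*m'$. *)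

theory Defs
  imports "HOL-Algebra.Free_Abelian_Groups" "HOL-Algebra.IntRing"
begin

section \<open>Sites\<close>

text \<open>A small category with a Grothendieck topology. \<open>Comp S f g\<close> is ``\<open>f\<close> after \<open>g\<close>'', meaningful
  when \<open>Dom S f = Cod S g\<close>; \<open>Cov S U\<close> is the set of covering sieves of \<open>U\<close>.\<close>

record ('o, 'a) site =
  Obj :: "'o set"
  Arr :: "'a set"
  Dom :: "'a \<Rightarrow> 'o"
  Cod :: "'a \<Rightarrow> 'o"
  Ident :: "'o \<Rightarrow> 'a"
  Comp :: "'a \<Rightarrow> 'a \<Rightarrow> 'a"
  Cov :: "'o \<Rightarrow> 'a set set"

definition is_category :: "('o, 'a) site \<Rightarrow> bool" where
  "is_category S \<longleftrightarrow>
     (\<forall>f\<in>Arr S. Dom S f \<in> Obj S \<and> Cod S f \<in> Obj S) \<and>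
     (\<forall>U\<in>Obj S. Ident S U \<in> Arr S \<and> Dom S (Ident S U) = U \<and> Cod S (Ident S U) = U) \<and>
     (\<forall>f\<in>Arr S. \<forall>g\<in>Arr S. Dom S f = Cod S g \<longrightarrow>
        Comp S f g \<in> Arr S \<and> Dom S (Comp S f g) = Dom S g \<and> Cod S (Comp S f g) = Cod S f) \<and>
     (\<forall>f\<in>Arr S. Comp S f (Ident S (Dom S f)) = f \<and> Comp S (Ident S (Cod S f)) f = f) \<and>
     (\<forall>f\<in>Arr S. \<forall>g\<in>Arr S. \<forall>h\<in>Arr S. Dom S f = Cod S g \<longrightarrow> Dom S g = Cod S h \<longrightarrow>
        Comp S (Comp S f g) h = Comp S f (Comp S g h))"

definition into :: "('o, 'a) site \<Rightarrow> 'o \<Rightarrow> 'a set" where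
  "into S U = {f \<in> Arr S. Cod S f = U}"

definition is_sieve :: "('o, 'a) site \<Rightarrow> 'o \<Rightarrow> 'a set \<Rightarrow> bool" where
  "is_sieve S U R \<longleftrightarrow> R \<subseteq> into S U \<and> (\<forall>f\<in>R. \<forall>g\<in>into S (Dom S f). Comp S f g \<in> R)"

definition pull_sieve :: "('o, 'a) site \<Rightarrow> 'a \<Rightarrow> 'a set \<Rightarrow> 'a set" where
  "pull_sieve S f R = {g \<in> into S (Dom S f). Comp S f g \<in> R}"

definition is_site :: "('o, 'a) site \<Rightarrow> bool" where
  "is_site S \<longleftrightarrow> is_category S \<and>
     (\<forall>U\<in>Obj S. \<forall>R\<in>Cov S U. is_sieve S U R) \<and>
     (\<forall>U\<in>Obj S. into S U \<in> Cov S U) \<and>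
     (\<forall>U\<in>Obj S. \<forall>R\<in>Cov S U. \<forall>f\<in>into S U. pull_sieve S f R \<in> Cov S (Dom S f)) \<and>
     (\<forall>U\<in>Obj S. \<forall>R\<in>Cov S U. \<forall>R'. is_sieve S U R' \<longrightarrow>
        (\<forall>f\<in>R. pull_sieve S f R' \<in> Cov S (Dom S f)) \<longrightarrow> R' \<in> Cov S U)"


section \<open>Sheaves of sets and of groups\<close>

record ('o, 'a, 's) presheaf =
  Sec :: "'o \<Rightarrow> 's set"
  Res :: "'a \<Rightarrow> 's \<Rightarrow> 's"

definition is_presheaf :: "('o, 'a) site \<Rightarrow> ('o, 'a, 's, 'z) presheaf_scheme \<Rightarrow> bool" where
  "is_presheaf S F \<longleftrightarrow>
     (\<forall>f\<in>Arr S. \<forall>s\<in>Sec F (Cod S f). Res F f s \<in> Sec F (Dom S f)) \<and>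
     (\<forall>U\<in>Obj S. \<forall>s\<in>Sec F U. Res F (Ident S U) s = s) \<and>
     (\<forall>f\<in>Arr S. \<forall>g\<in>into S (Dom S f). \<forall>s\<in>Sec F (Cod S f).
        Res F (Comp S f g) s = Res F g (Res F f s))"

definition is_sheaf :: "('o, 'a) site \<Rightarrow> ('o, 'a, 's, 'z) presheaf_scheme \<Rightarrow> bool" where
  "is_sheaf S F \<longleftrightarrow> is_presheaf S F \<and>
     (\<forall>U\<in>Obj S. \<forall>R\<in>Cov S U. \<forall>x.
        (\<forall>f\<in>R. x f \<in> Sec F (Dom S f)) \<longrightarrow>
        (\<forall>f\<in>R. \<forall>g\<in>into S (Dom S f). x (Comp S f g) = Res F g (x f)) \<longrightarrow>
        (\<exists>!s. s \<in> Sec F U \<and> (\<forall>f\<in>R. Res F f s = x f)))"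

definition presheaf_map ::
  "('o, 'a) site \<Rightarrow> ('o, 'a, 's, 'y) presheaf_scheme \<Rightarrow> ('o, 'a, 't, 'z) presheaf_scheme
     \<Rightarrow> ('o \<Rightarrow> 's \<Rightarrow> 't) \<Rightarrow> bool" where
  "presheaf_map S F G \<phi> \<longleftrightarrow>
     (\<forall>U\<in>Obj S. \<forall>s\<in>Sec F U. \<phi> U s \<in> Sec G U) \<and>
     (\<forall>f\<in>Arr S. \<forall>s\<in>Sec F (Cod S f). \<phi> (Dom S f) (Res F f s) = Res G f (\<phi> (Cod S f) s))"

record ('o, 'a, 'g) group_presheaf = "('o, 'a, 'g) presheaf" +
  Mul :: "'o \<Rightarrow> 'g \<Rightarrow> 'g \<Rightarrow> 'g"
  Unit :: "'o \<Rightarrow> 'g"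

text \<open>Groups, also the abelian ones, are written multiplicatively as in \<open>HOL-Algebra\<close>.\<close>

definition Grp :: "('o, 'a, 'g) group_presheaf \<Rightarrow> 'o \<Rightarrow> 'g monoid" where
  "Grp F U = \<lparr>carrier = Sec F U, monoid.mult = Mul F U, one = Unit F U\<rparr>"

definition mk_group_presheaf ::
  "('o \<Rightarrow> 'g monoid) \<Rightarrow> ('a \<Rightarrow> 'g \<Rightarrow> 'g) \<Rightarrow> ('o, 'a, 'g) group_presheaf" where
  "mk_group_presheaf G r =
     \<lparr>Sec = \<lambda>U. carrier (G U), Res = r, Mul = \<lambda>U. monoid.mult (G U), Unit = \<lambda>U. one (G U)\<rparr>"

definition is_group_sheaf :: "('o, 'a) site \<Rightarrow> ('o, 'a, 'g) group_presheaf \<Rightarrow> bool" where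
  "is_group_sheaf S F \<longleftrightarrow> is_sheaf S F \<and> (\<forall>U\<in>Obj S. group (Grp F U)) \<and>
     (\<forall>f\<in>Arr S. Res F f \<in> hom (Grp F (Cod S f)) (Grp F (Dom S f)))"

definition is_abelian_sheaf :: "('o, 'a) site \<Rightarrow> ('o, 'a, 'g) group_presheaf \<Rightarrow> bool" where
  "is_abelian_sheaf S F \<longleftrightarrow> is_group_sheaf S F \<and> (\<forall>U\<in>Obj S. comm_group (Grp F U))"

definition group_sheaf_hom ::
  "('o, 'a) site \<Rightarrow> ('o, 'a, 'g) group_presheaf \<Rightarrow> ('o, 'a, 'h) group_presheaf
     \<Rightarrow> ('o \<Rightarrow> 'g \<Rightarrow> 'h) \<Rightarrow> bool" where
  "group_sheaf_hom S F G \<phi> \<longleftrightarrow> presheaf_map S F G \<phi> \<and> (\<forall>U\<in>Obj S. \<phi> U \<in> hom (Grp F U) (Grp G U))"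

definition sheaf_mono :: "('o, 'a) site \<Rightarrow> ('o, 'a, 'g) group_presheaf \<Rightarrow> ('o \<Rightarrow> 'g \<Rightarrow> 'h) \<Rightarrow> bool" where
  "sheaf_mono S F \<phi> \<longleftrightarrow> (\<forall>U\<in>Obj S. inj_on (\<phi> U) (Sec F U))"

definition in_image_sheaf ::
  "('o, 'a) site \<Rightarrow> ('o, 'a, 'g) group_presheaf \<Rightarrow> ('o, 'a, 'h) group_presheaf
     \<Rightarrow> ('o \<Rightarrow> 'g \<Rightarrow> 'h) \<Rightarrow> 'o \<Rightarrow> 'h \<Rightarrow> bool" where
  "in_image_sheaf S F G \<phi> U y \<longleftrightarrow>
     {f \<in> into S U. \<exists>x\<in>Sec F (Dom S f). \<phi> (Dom S f) x = Res G f y} \<in> Cov S U"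

definition exact_at ::
  "('o, 'a) site \<Rightarrow> ('o, 'a, 'f) group_presheaf \<Rightarrow> ('o, 'a, 'g) group_presheaf
     \<Rightarrow> ('o, 'a, 'h) group_presheaf \<Rightarrow> ('o \<Rightarrow> 'f \<Rightarrow> 'g) \<Rightarrow> ('o \<Rightarrow> 'g \<Rightarrow> 'h) \<Rightarrow> bool" where
  "exact_at S F G H \<phi> \<psi> \<longleftrightarrow>
     (\<forall>U\<in>Obj S. \<forall>y\<in>Sec G U. \<psi> U y = Unit H U \<longleftrightarrow> in_image_sheaf S F G \<phi> U y)"


section \<open>The associated sheaf\<close>

definition agreement :: "('o, 'a) site \<Rightarrow> ('o, 'a, 's, 'z) presheaf_scheme \<Rightarrow> 'o \<Rightarrow> 's \<Rightarrow> 's \<Rightarrow> 'a set" where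
  "agreement S P U p q = {g \<in> into S U. Res P g p = Res P g q}"

text \<open>A section over \<open>U\<close> of the sheaf associated with a presheaf \<open>P\<close> is encoded by the collection of all
  its local representatives: \<open>\<sigma> f\<close>, for \<open>f : V \<rightarrow> U\<close>, is the set of those \<open>p \<in> P(V)\<close> whose image in the
  associated sheaf is the restriction of the section along \<open>f\<close>. Such a \<open>\<sigma>\<close> is stable under restriction,
  single valued up to local equality, saturated for the topology, and nonempty locally on \<open>U\<close>; conversely
  such a \<open>\<sigma>\<close> comes from a unique section.\<close>

definition assoc_sections :: "('o, 'a) site \<Rightarrow> ('o, 'a, 's, 'z) presheaf_scheme \<Rightarrow> 'o \<Rightarrow> ('a \<Rightarrow> 's set) set" where
  "assoc_sections S P U = {\<sigma>.
     (\<forall>f. f \<notin> into S U \<longrightarrow> \<sigma> f = {}) \<and>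
     (\<forall>f\<in>into S U. \<sigma> f \<subseteq> Sec P (Dom S f)) \<and>
     (\<forall>f\<in>into S U. \<forall>g\<in>into S (Dom S f). \<forall>p\<in>\<sigma> f. Res P g p \<in> \<sigma> (Comp S f g)) \<and>
     (\<forall>f\<in>into S U. \<forall>p\<in>\<sigma> f. \<forall>q\<in>\<sigma> f. agreement S P (Dom S f) p q \<in> Cov S (Dom S f)) \<and>
     (\<forall>f\<in>into S U. \<forall>p\<in>Sec P (Dom S f).
        {g \<in> into S (Dom S f). Res P g p \<in> \<sigma> (Comp S f g)} \<in> Cov S (Dom S f) \<longrightarrow> p \<in> \<sigma> f) \<and>
     {f \<in> into S U. \<sigma> f \<noteq> {}} \<in> Cov S U}"

definition assoc_res :: "('o, 'a) site \<Rightarrow> 'a \<Rightarrow> ('a \<Rightarrow> 's set) \<Rightarrow> ('a \<Rightarrow> 's set)" where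
  "assoc_res S h \<sigma> = (\<lambda>f. if f \<in> into S (Dom S h) then \<sigma> (Comp S h f) else {})"

definition assoc_unit :: "('o, 'a) site \<Rightarrow> ('o, 'a, 's, 'z) presheaf_scheme \<Rightarrow> 'o \<Rightarrow> 's \<Rightarrow> ('a \<Rightarrow> 's set)" where
  "assoc_unit S P U p = (\<lambda>f. if f \<in> into S U
     then {q \<in> Sec P (Dom S f). agreement S P (Dom S f) q (Res P f p) \<in> Cov S (Dom S f)} else {})"

definition assoc_mult :: "('o, 'a) site \<Rightarrow> ('o, 'a, 'g) group_presheaf \<Rightarrow> 'o
    \<Rightarrow> ('a \<Rightarrow> 'g set) \<Rightarrow> ('a \<Rightarrow> 'g set) \<Rightarrow> ('a \<Rightarrow> 'g set)" where
  "assoc_mult S P U \<sigma> \<tau> = (\<lambda>f. if f \<in> into S U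
     then {r \<in> Sec P (Dom S f).
       {g \<in> into S (Dom S f). \<exists>p\<in>\<sigma> (Comp S f g). \<exists>q\<in>\<tau> (Comp S f g). Res P g r = Mul P (Dom S g) p q}
         \<in> Cov S (Dom S f)} else {})"

definition assoc_sheaf :: "('o, 'a) site \<Rightarrow> ('o, 'a, 'g) group_presheaf \<Rightarrow> ('o, 'a, 'a \<Rightarrow> 'g set) group_presheaf" where
  "assoc_sheaf S P = \<lparr>Sec = assoc_sections S P, Res = assoc_res S, Mul = assoc_mult S P,
     Unit = \<lambda>U. assoc_unit S P U (Unit P U)\<rparr>"


section \<open>Cohomology: the derived functors of \<open>Hom(\<int>, -)\<close>\<close>

definition const_presheaf :: "'g monoid \<Rightarrow> ('o, 'a, 'g) group_presheaf" where
  "const_presheaf G = mk_group_presheaf (\<lambda>_. G) (\<lambda>_ s. s)"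

definition const_Z :: "('o, 'a) site \<Rightarrow> ('o, 'a, 'a \<Rightarrow> int set) group_presheaf" where
  "const_Z S = assoc_sheaf S (const_presheaf integer_group)"

definition one_Z :: "('o, 'a) site \<Rightarrow> 'o \<Rightarrow> 'a \<Rightarrow> int set" where
  "one_Z S U = assoc_unit S (const_presheaf integer_group :: ('o, 'a, int) group_presheaf) U 1"

definition Hom_group ::
  "('o, 'a) site \<Rightarrow> ('o, 'a, 'f) group_presheaf \<Rightarrow> ('o, 'a, 'g) group_presheaf \<Rightarrow> ('o \<Rightarrow> 'f \<Rightarrow> 'g) monoid" where
  "Hom_group S F G =
     \<lparr>carrier = {\<phi>. group_sheaf_hom S F G \<phi> \<and> \<phi> \<in> (\<Pi>\<^sub>E U\<in>Obj S. Sec F U \<rightarrow>\<^sub>E Sec G U)},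
      monoid.mult = (\<lambda>\<phi> \<psi>. \<lambda>U\<in>Obj S. \<lambda>s\<in>Sec F U. Mul G U (\<phi> U s) (\<psi> U s)),
      one = (\<lambda>U\<in>Obj S. \<lambda>s\<in>Sec F U. Unit G U)\<rparr>"

text \<open>In HOL the test sheaves \<open>F\<close>, \<open>G\<close> must have sections in a fixed type. The type chosen contains the
  sections of the sheaves \<open>\<int>[h\<^sub>U]\<close> associated with the free abelian presheaves on the representable
  presheaves \<open>h\<^sub>U\<close>, and those of all their subsheaves. As the \<open>\<int>[h\<^sub>U]\<close> generate the category of abelian
  sheaves, Baer's criterion shows that sheaves \<open>F\<close>, \<open>G\<close> with sections in any other type give no further
  condition.\<close>

definition injective_sheaf :: "('o, 'a) site \<Rightarrow> ('o, 'a, 'i) group_presheaf \<Rightarrow> bool" where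
  "injective_sheaf S I \<longleftrightarrow> is_abelian_sheaf S I \<and>
     (\<forall>(F :: ('o, 'a, 'a \<Rightarrow> ('a \<Rightarrow>\<^sub>0 int) set) group_presheaf)
       (G :: ('o, 'a, 'a \<Rightarrow> ('a \<Rightarrow>\<^sub>0 int) set) group_presheaf) \<phi> \<psi>.
        is_abelian_sheaf S F \<longrightarrow> is_abelian_sheaf S G \<longrightarrow>
        group_sheaf_hom S F G \<phi> \<longrightarrow> sheaf_mono S F \<phi> \<longrightarrow> group_sheaf_hom S F I \<psi> \<longrightarrow>
        (\<exists>\<chi>. group_sheaf_hom S G I \<chi> \<and> (\<forall>U\<in>Obj S. \<forall>s\<in>Sec F U. \<chi> U (\<phi> U s) = \<psi> U s)))"

record ('o, 'a, 'm, 'i) resolution =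
  Term :: "nat \<Rightarrow> ('o, 'a, 'i) group_presheaf"
  Diff :: "nat \<Rightarrow> 'o \<Rightarrow> 'i \<Rightarrow> 'i"
  Aug :: "'o \<Rightarrow> 'm \<Rightarrow> 'i"

definition injective_resolution ::
  "('o, 'a) site \<Rightarrow> ('o, 'a, 'm) group_presheaf \<Rightarrow> ('o, 'a, 'm, 'i) resolution \<Rightarrow> bool" where
  "injective_resolution S M I \<longleftrightarrow>
     (\<forall>n. injective_sheaf S (Term I n)) \<and>
     group_sheaf_hom S M (Term I 0) (Aug I) \<and>
     (\<forall>n. group_sheaf_hom S (Term I n) (Term I (Suc n)) (Diff I n)) \<and>
     sheaf_mono S M (Aug I) \<and>
     exact_at S M (Term I 0) (Term I 1) (Aug I) (Diff I 0) \<and>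
     (\<forall>n. exact_at S (Term I n) (Term I (Suc n)) (Term I (Suc (Suc n))) (Diff I n) (Diff I (Suc n)))"

definition Hom_Z_term :: "('o, 'a) site \<Rightarrow> ('o, 'a, 'm, 'i) resolution \<Rightarrow> nat \<Rightarrow> ('o \<Rightarrow> ('a \<Rightarrow> int set) \<Rightarrow> 'i) monoid" where
  "Hom_Z_term S I n = Hom_group S (const_Z S) (Term I n)"

definition Hom_Z_diff ::
  "('o, 'a) site \<Rightarrow> ('o, 'a, 'm, 'i) resolution \<Rightarrow> nat
     \<Rightarrow> ('o \<Rightarrow> ('a \<Rightarrow> int set) \<Rightarrow> 'i) \<Rightarrow> ('o \<Rightarrow> ('a \<Rightarrow> int set) \<Rightarrow> 'i)" where
  "Hom_Z_diff S I n \<phi> = (\<lambda>U\<in>Obj S. \<lambda>s\<in>Sec (const_Z S) U. Diff I n U (\<phi> U s))"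

text \<open>\<open>H\<^sup>n(M) = Ext\<^sup>n(\<int>, M)\<close>, computed with the injective resolution \<open>I\<close> of \<open>M\<close>.\<close>

definition cohomology ::
  "('o, 'a) site \<Rightarrow> ('o, 'a, 'm, 'i) resolution \<Rightarrow> nat \<Rightarrow> ('o \<Rightarrow> ('a \<Rightarrow> int set) \<Rightarrow> 'i) set monoid" where
  "cohomology S I n =
     (Hom_Z_term S I n)\<lparr>carrier := kernel (Hom_Z_term S I n) (Hom_Z_term S I (Suc n)) (Hom_Z_diff S I n)\<rparr>
     Mod (case n of 0 \<Rightarrow> {\<one>\<^bsub>Hom_Z_term S I 0\<^esub>}
          | Suc k \<Rightarrow> Hom_Z_diff S I k ` carrier (Hom_Z_term S I k))"


section \<open>Torsors and the pointed set \<open>H\<^sup>1\<close>\<close>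

record ('o, 'a, 'p, 'g) torsor = "('o, 'a, 'p) presheaf" +
  Act :: "'o \<Rightarrow> 'p \<Rightarrow> 'g \<Rightarrow> 'p"

text \<open>Right torsors.\<close>

definition is_torsor ::
  "('o, 'a) site \<Rightarrow> ('o, 'a, 'g) group_presheaf \<Rightarrow> ('o, 'a, 'p, 'g) torsor \<Rightarrow> bool" where
  "is_torsor S G P \<longleftrightarrow> is_sheaf S P \<and>
     (\<forall>U\<in>Obj S. \<forall>p\<in>Sec P U. \<forall>g\<in>Sec G U. Act P U p g \<in> Sec P U) \<and>
     (\<forall>f\<in>Arr S. \<forall>p\<in>Sec P (Cod S f). \<forall>g\<in>Sec G (Cod S f).
        Res P f (Act P (Cod S f) p g) = Act P (Dom S f) (Res P f p) (Res G f g)) \<and>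
     (\<forall>U\<in>Obj S. \<forall>p\<in>Sec P U. Act P U p (Unit G U) = p) \<and>
     (\<forall>U\<in>Obj S. \<forall>p\<in>Sec P U. \<forall>g\<in>Sec G U. \<forall>h\<in>Sec G U.
        Act P U (Act P U p g) h = Act P U p (Mul G U g h)) \<and>
     (\<forall>U\<in>Obj S. \<forall>p\<in>Sec P U. \<forall>q\<in>Sec P U. \<exists>!g. g \<in> Sec G U \<and> q = Act P U p g) \<and>
     (\<forall>U\<in>Obj S. {f \<in> into S U. Sec P (Dom S f) \<noteq> {}} \<in> Cov S U)"

definition torsor_iso ::
  "('o, 'a) site \<Rightarrow> ('o, 'a, 'g) group_presheaf
     \<Rightarrow> ('o, 'a, 'p, 'g) torsor \<Rightarrow> ('o, 'a, 'p, 'g) torsor \<Rightarrow> bool" where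
  "torsor_iso S G P Q \<longleftrightarrow> (\<exists>\<phi>. presheaf_map S P Q \<phi> \<and>
     (\<forall>U\<in>Obj S. bij_betw (\<phi> U) (Sec P U) (Sec Q U)) \<and>
     (\<forall>U\<in>Obj S. \<forall>p\<in>Sec P U. \<forall>g\<in>Sec G U. \<phi> U (Act P U p g) = Act Q U (\<phi> U p) g))"

definition H1 :: "('o, 'a) site \<Rightarrow> ('o, 'a, 'g) group_presheaf \<Rightarrow> ('o, 'a, 'p, 'g) torsor set set" where
  "H1 S G = {P. is_torsor S G P} // {(P, Q). is_torsor S G P \<and> is_torsor S G Q \<and> torsor_iso S G P Q}"


section \<open>Cocycles on coverings\<close>

text \<open>\<open>\<V>\<close> is a family of objects covering the final sheaf; \<open>cover_presheaf S \<V>\<close> is the coproduct of the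
  presheaves represented by its members, the \<open>S'\<close> of a covering \<open>S' \<rightarrow> S\<close> of the final object \<open>S\<close>. The
  products \<open>S''\<close>, \<open>S'''\<close> are taken objectwise, so no fibre products are needed in the category.\<close>

definition covers_final :: "('o, 'a) site \<Rightarrow> 'o set \<Rightarrow> bool" where
  "covers_final S \<V> \<longleftrightarrow> \<V> \<subseteq> Obj S \<and>
     (\<forall>U\<in>Obj S. {f \<in> into S U. \<exists>g\<in>Arr S. Dom S g = Dom S f \<and> Cod S g \<in> \<V>} \<in> Cov S U)"

definition cover_presheaf :: "('o, 'a) site \<Rightarrow> 'o set \<Rightarrow> ('o, 'a, 'a) presheaf" where
  "cover_presheaf S \<V> = \<lparr>Sec = \<lambda>U. {f \<in> Arr S. Dom S f = U \<and> Cod S f \<in> \<V>}, Res = \<lambda>g f. Comp S f g\<rparr>"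

text \<open>The 1-cocycle \<open>c \<in> G(S'')\<close> of a torsor \<open>P\<close> with a trivialization \<open>s \<in> P(S')\<close>: on \<open>S''\<close> one has
  \<open>\<pi>\<^sub>2\<^sup>* s = \<pi>\<^sub>1\<^sup>* s \<cdot> c\<close>, whence \<open>\<pi>\<^sub>1\<^sub>3\<^sup>* c = \<pi>\<^sub>1\<^sub>2\<^sup>* c \<cdot> \<pi>\<^sub>2\<^sub>3\<^sup>* c\<close>.\<close>

definition torsor_cocycle ::
  "('o, 'a, 'g) group_presheaf \<Rightarrow> ('o, 'a, 'p, 'g) torsor \<Rightarrow> ('o \<Rightarrow> 'a \<Rightarrow> 'p) \<Rightarrow> 'o \<Rightarrow> 'a \<Rightarrow> 'a \<Rightarrow> 'g" where
  "torsor_cocycle G P s U v w = (THE g. g \<in> Sec G U \<and> s U w = Act P U (s U v) g)"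

text \<open>Here \<open>K0\<close> covers the final object and \<open>K1\<close> covers \<open>K0 \<times> K0\<close> through \<open>(e0, e1)\<close>; the function \<open>a\<close> is
  a 2-cocycle with values in \<open>A\<close> on the hypercovering \<open>K\<close> generated by these data, whose sections in
  degree 2 are the triangles \<open>(k\<^sub>0\<^sub>1, k\<^sub>1\<^sub>2, k\<^sub>0\<^sub>2)\<close> of sections of \<open>K1\<close> (the Cech situation is
  \<open>K1 = K0 \<times> K0\<close>). Its class \<open>\<xi> \<in> H\<^sup>2(A)\<close> is obtained from the double complex \<open>I\<^sup>q(K\<^sub>p)\<close> with total
  differential \<open>\<delta> + (-1)\<^sup>p d\<close>, in which both \<open>A(K\<^sub>2)\<close> and the global sections of \<open>I\<^sup>2\<close> embed: \<open>a\<close> and a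
  global section \<open>z\<close> are cohomologous, \<open>a - z = D(\<alpha> + \<beta>)\<close>, iff \<open>a = \<delta>\<alpha>\<close>, \<open>d\<alpha> = \<delta>\<beta>\<close>, \<open>d\<beta> = -z\<close>. A
  homomorphism \<open>\<zeta> : \<int> \<rightarrow> I\<^sup>2\<close> corresponds to the global section \<open>\<zeta>(1)\<close>.\<close>

definition cocycle_has_class ::
  "('o, 'a) site \<Rightarrow> ('o, 'a, 'm, 'i) resolution
     \<Rightarrow> ('o, 'a, 'k) presheaf \<Rightarrow> ('o, 'a, 'l) presheaf \<Rightarrow> ('l \<Rightarrow> 'k) \<Rightarrow> ('l \<Rightarrow> 'k)
     \<Rightarrow> ('o \<Rightarrow> 'l \<Rightarrow> 'l \<Rightarrow> 'l \<Rightarrow> 'm) \<Rightarrow> ('o \<Rightarrow> ('a \<Rightarrow> int set) \<Rightarrow> 'i) set \<Rightarrow> bool" where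
  "cocycle_has_class S I K0 K1 e0 e1 a \<xi> \<longleftrightarrow>
     \<xi> \<in> carrier (cohomology S I 2) \<and>
     (\<exists>\<zeta>\<in>\<xi>. \<exists>\<alpha> \<beta>.
        presheaf_map S K1 (Term I 0) \<alpha> \<and> presheaf_map S K0 (Term I 1) \<beta> \<and>
        (\<forall>U\<in>Obj S. \<forall>k01\<in>Sec K1 U. \<forall>k12\<in>Sec K1 U. \<forall>k02\<in>Sec K1 U.
           e0 k01 = e0 k02 \<longrightarrow> e1 k01 = e0 k12 \<longrightarrow> e1 k12 = e1 k02 \<longrightarrow>
           Aug I U (a U k01 k12 k02) =
             \<alpha> U k01 \<otimes>\<^bsub>Grp (Term I 0) U\<^esub> \<alpha> U k12 \<otimes>\<^bsub>Grp (Term I 0) U\<^esub> inv\<^bsub>Grp (Term I 0) U\<^esub> (\<alpha> U k02)) \<and>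
        (\<forall>U\<in>Obj S. \<forall>k\<in>Sec K1 U.
           Diff I 0 U (\<alpha> U k) = \<beta> U (e1 k) \<otimes>\<^bsub>Grp (Term I 1) U\<^esub> inv\<^bsub>Grp (Term I 1) U\<^esub> (\<beta> U (e0 k))) \<and>
        (\<forall>U\<in>Obj S. \<forall>k\<in>Sec K0 U.
           Diff I 1 U (\<beta> U k) = inv\<^bsub>Grp (Term I 2) U\<^esub> (\<zeta> U (one_Z S U))))"


section \<open>The connecting map of a central extension\<close>

definition central_extension ::
  "('o, 'a) site \<Rightarrow> ('o, 'a, 'g) group_presheaf \<Rightarrow> ('o, 'a, 'h) group_presheaf \<Rightarrow> ('o, 'a, 'k) group_presheaf
     \<Rightarrow> ('o \<Rightarrow> 'g \<Rightarrow> 'h) \<Rightarrow> ('o \<Rightarrow> 'h \<Rightarrow> 'k) \<Rightarrow> bool" where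
  "central_extension S A B C \<iota> \<pi> \<longleftrightarrow>
     is_abelian_sheaf S A \<and> is_group_sheaf S B \<and> is_group_sheaf S C \<and>
     group_sheaf_hom S A B \<iota> \<and> group_sheaf_hom S B C \<pi> \<and>
     sheaf_mono S A \<iota> \<and> exact_at S A B C \<iota> \<pi> \<and>
     (\<forall>U\<in>Obj S. \<forall>y\<in>Sec C U. in_image_sheaf S B C \<pi> U y) \<and>
     (\<forall>U\<in>Obj S. \<forall>x\<in>Sec A U. \<forall>b\<in>Sec B U. Mul B U (\<iota> U x) b = Mul B U b (\<iota> U x))"

text \<open>A cocycle \<open>c \<in> C(S'')\<close> need not lift to \<open>B(S'')\<close>, but it lifts over the covering of \<open>S''\<close> obtained by
  pulling back \<open>B \<rightarrow> C\<close> along \<open>c\<close>, whose sections are the triples \<open>(v, w, b)\<close> with \<open>b\<close> a lift of \<open>c(v, w)\<close>.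
  Every other covering of \<open>S''\<close> with a lift of \<open>c\<close> (in particular \<open>S''\<close> itself with a lift in \<open>B(S'')\<close>, if
  there is one) maps to it.\<close>

definition lift_presheaf ::
  "('o, 'a, 'h) group_presheaf \<Rightarrow> ('o \<Rightarrow> 'h \<Rightarrow> 'c) \<Rightarrow> ('o, 'a, 'k) presheaf \<Rightarrow> ('o \<Rightarrow> 'k \<Rightarrow> 'k \<Rightarrow> 'c)
     \<Rightarrow> ('o, 'a, 'k \<times> 'k \<times> 'h) presheaf" where
  "lift_presheaf B \<pi> K c =
     \<lparr>Sec = \<lambda>U. {(v, w, b). v \<in> Sec K U \<and> w \<in> Sec K U \<and> b \<in> Sec B U \<and> \<pi> U b = c U v w},
      Res = \<lambda>f (v, w, b). (Res K f v, Res K f w, Res B f b)\<rparr>"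

text \<open>The 2-cocycle \<open>\<pi>\<^sub>1\<^sub>2\<^sup>* b \<cdot> \<pi>\<^sub>2\<^sub>3\<^sup>* b \<cdot> (\<pi>\<^sub>1\<^sub>3\<^sup>* b)\<^sup>-\<^sup>1\<close>.\<close>

definition obstruction_cocycle ::
  "('o, 'a, 'g) group_presheaf \<Rightarrow> ('o, 'a, 'h) group_presheaf \<Rightarrow> ('o \<Rightarrow> 'g \<Rightarrow> 'h)
     \<Rightarrow> 'o \<Rightarrow> 'k \<times> 'k \<times> 'h \<Rightarrow> 'k \<times> 'k \<times> 'h \<Rightarrow> 'k \<times> 'k \<times> 'h \<Rightarrow> 'g" where
  "obstruction_cocycle A B \<iota> U = (\<lambda>(_, _, b01) (_, _, b12) (_, _, b02).
     inv_into (Sec A U) (\<iota> U) (b01 \<otimes>\<^bsub>Grp B U\<^esub> b12 \<otimes>\<^bsub>Grp B U\<^esub> inv\<^bsub>Grp B U\<^esub> b02))"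

text \<open>For a central extension \<open>(A, B, C, \<iota>, \<pi>)\<close> and an injective resolution \<open>I\<close> of \<open>A\<close>: Giraud's map
  sends a \<open>C\<close>-torsor \<open>P\<close> to the class of the gerbe of its liftings to \<open>B\<close>. Over a trivializing covering
  \<open>S'\<close> this gerbe has an object, the isomorphisms between its two restrictions to \<open>S''\<close> are the lifts \<open>b\<close>
  of \<open>c\<close>, and its class is that of the resulting 2-cocycle. The class depends neither on \<open>P \<in> x\<close> nor on
  the covering and the trivialization.\<close>

definition connecting_map ::
  "('o, 'a) site \<Rightarrow> ('o, 'a, 'g) group_presheaf \<Rightarrow> ('o, 'a, 'h) group_presheaf \<Rightarrow> ('o, 'a, 'c) group_presheaf
     \<Rightarrow> ('o \<Rightarrow> 'g \<Rightarrow> 'h) \<Rightarrow> ('o \<Rightarrow> 'h \<Rightarrow> 'c) \<Rightarrow> ('o, 'a, 'g, 'i) resolution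
     \<Rightarrow> ('o, 'a, 'p, 'c) torsor set \<Rightarrow> ('o \<Rightarrow> ('a \<Rightarrow> int set) \<Rightarrow> 'i) set" where
  "connecting_map S A B C \<iota> \<pi> I x = (THE \<xi>. \<exists>P\<in>x. \<exists>\<V> s.
     covers_final S \<V> \<and> presheaf_map S (cover_presheaf S \<V>) P s \<and>
     cocycle_has_class S I (cover_presheaf S \<V>)
       (lift_presheaf B \<pi> (cover_presheaf S \<V>) (torsor_cocycle C P s))
       (\<lambda>(v, w, b). v) (\<lambda>(v, w, b). w) (obstruction_cocycle A B \<iota>) \<xi>)"


section \<open>Tensor products and the cup product\<close>

definition tensor_relations :: "('g, 'y) monoid_scheme \<Rightarrow> ('h, 'z) monoid_scheme \<Rightarrow> (('g \<times> 'h) \<Rightarrow>\<^sub>0 int) set" where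
  "tensor_relations G H =
     {frag_of (x \<otimes>\<^bsub>G\<^esub> x', y) - frag_of (x, y) - frag_of (x', y) | x x' y.
        x \<in> carrier G \<and> x' \<in> carrier G \<and> y \<in> carrier H} \<union>
     {frag_of (x, y \<otimes>\<^bsub>H\<^esub> y') - frag_of (x, y) - frag_of (x, y') | x y y'.
        x \<in> carrier G \<and> y \<in> carrier H \<and> y' \<in> carrier H}"

definition tensor_kernel :: "('g, 'y) monoid_scheme \<Rightarrow> ('h, 'z) monoid_scheme \<Rightarrow> (('g \<times> 'h) \<Rightarrow>\<^sub>0 int) set" where
  "tensor_kernel G H = generate (free_Abelian_group (carrier G \<times> carrier H)) (tensor_relations G H)"

definition tensor_group :: "('g, 'y) monoid_scheme \<Rightarrow> ('h, 'z) monoid_scheme \<Rightarrow> (('g \<times> 'h) \<Rightarrow>\<^sub>0 int) set monoid" where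
  "tensor_group G H = free_Abelian_group (carrier G \<times> carrier H) Mod tensor_kernel G H"

definition pure_tensor :: "('g, 'y) monoid_scheme \<Rightarrow> ('h, 'z) monoid_scheme \<Rightarrow> 'g \<Rightarrow> 'h \<Rightarrow> (('g \<times> 'h) \<Rightarrow>\<^sub>0 int) set" where
  "pure_tensor G H x y = tensor_kernel G H #>\<^bsub>free_Abelian_group (carrier G \<times> carrier H)\<^esub> frag_of (x, y)"

text \<open>The map \<open>f \<otimes> g\<close> into \<open>tensor_group G H\<close>, on cosets.\<close>

definition tensor_map :: "('k, 'y) monoid_scheme \<Rightarrow> ('l, 'z) monoid_scheme \<Rightarrow> ('g \<Rightarrow> 'k) \<Rightarrow> ('h \<Rightarrow> 'l)
    \<Rightarrow> (('g \<times> 'h) \<Rightarrow>\<^sub>0 int) set \<Rightarrow> (('k \<times> 'l) \<Rightarrow>\<^sub>0 int) set" where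
  "tensor_map G H f g X = tensor_kernel G H <#>\<^bsub>free_Abelian_group (carrier G \<times> carrier H)\<^esub>
     (frag_extend (\<lambda>(x, y). frag_of (f x, g y)) ` X)"

definition tensor_presheaf :: "('o, 'a) site \<Rightarrow> ('o, 'a, 'm) group_presheaf \<Rightarrow> ('o, 'a, 'n) group_presheaf
    \<Rightarrow> ('o, 'a, (('m \<times> 'n) \<Rightarrow>\<^sub>0 int) set) group_presheaf" where
  "tensor_presheaf S M N = mk_group_presheaf (\<lambda>U. tensor_group (Grp M U) (Grp N U))
     (\<lambda>f. tensor_map (Grp M (Dom S f)) (Grp N (Dom S f)) (Res M f) (Res N f))"

definition tensor_sheaf :: "('o, 'a) site \<Rightarrow> ('o, 'a, 'm) group_presheaf \<Rightarrow> ('o, 'a, 'n) group_presheaf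
    \<Rightarrow> ('o, 'a, 'a \<Rightarrow> (('m \<times> 'n) \<Rightarrow>\<^sub>0 int) set set) group_presheaf" where
  "tensor_sheaf S M N = assoc_sheaf S (tensor_presheaf S M N)"

definition tensor :: "('o, 'a) site \<Rightarrow> ('o, 'a, 'm) group_presheaf \<Rightarrow> ('o, 'a, 'n) group_presheaf
    \<Rightarrow> 'o \<Rightarrow> 'm \<Rightarrow> 'n \<Rightarrow> 'a \<Rightarrow> (('m \<times> 'n) \<Rightarrow>\<^sub>0 int) set set" where
  "tensor S M N U m n = assoc_unit S (tensor_presheaf S M N) U (pure_tensor (Grp M U) (Grp N U) m n)"

text \<open>The cup product \<open>H\<^sup>1(M) \<times> H\<^sup>1(N) \<rightarrow> H\<^sup>2(M \<otimes> N)\<close>, where \<open>I\<close> is an injective resolution of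
  \<open>M \<otimes> N\<close>: the class of the 2-cocycle \<open>\<pi>\<^sub>1\<^sub>2\<^sup>* m \<otimes> \<pi>\<^sub>2\<^sub>3\<^sup>* n\<close> on \<open>S'''\<close>.\<close>

definition cup_product ::
  "('o, 'a) site \<Rightarrow> ('o, 'a, 'm) group_presheaf \<Rightarrow> ('o, 'a, 'n) group_presheaf
     \<Rightarrow> ('o, 'a, 'a \<Rightarrow> (('m \<times> 'n) \<Rightarrow>\<^sub>0 int) set set, 'i) resolution
     \<Rightarrow> ('o, 'a, 'p, 'm) torsor set \<Rightarrow> ('o, 'a, 'q, 'n) torsor set
     \<Rightarrow> ('o \<Rightarrow> ('a \<Rightarrow> int set) \<Rightarrow> 'i) set" where
  "cup_product S M N I x y = (THE \<xi>. \<exists>P\<in>x. \<exists>Q\<in>y. \<exists>\<V> s t.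
     covers_final S \<V> \<and> presheaf_map S (cover_presheaf S \<V>) P s \<and> presheaf_map S (cover_presheaf S \<V>) Q t \<and>
     cocycle_has_class S I (cover_presheaf S \<V>)
       \<lparr>Sec = \<lambda>U. Sec (cover_presheaf S \<V>) U \<times> Sec (cover_presheaf S \<V>) U,
        Res = \<lambda>f (v, w). (Res (cover_presheaf S \<V>) f v, Res (cover_presheaf S \<V>) f w)\<rparr>
       fst snd
       (\<lambda>U (v0, v1) (v1', v2) _.
          tensor S M N U (torsor_cocycle M P s U v0 v1) (torsor_cocycle N Q t U v1' v2)) \<xi>)"


section \<open>The extension \<open>\<U>M\<close>\<close>

text \<open>The truncated tensor algebra \<open>T\<^sup><\<^sup>3 M = \<int> \<oplus> M \<oplus> (M \<otimes> M)\<close>, objectwise; \<open>(k, m, t)\<close> stands for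
  \<open>k + m + t\<close>. Using the constant presheaf \<open>\<int>\<close> in degree 0 does not affect the kernel \<open>\<U>M\<close> below, in which
  \<open>k = 1\<close>.\<close>

definition trunc_tensor_ring :: "('o, 'a) site \<Rightarrow> ('o, 'a, 'm) group_presheaf \<Rightarrow> 'o
    \<Rightarrow> (int \<times> 'm \<times> ('a \<Rightarrow> (('m \<times> 'm) \<Rightarrow>\<^sub>0 int) set set)) ring" where
  "trunc_tensor_ring S M U = (let A = Grp M U; T = Grp (tensor_sheaf S M M) U in
     \<lparr>carrier = UNIV \<times> carrier A \<times> carrier T,
      monoid.mult = (\<lambda>(k, m, t) (k', m', t').
        (k * k',
         (m' [^]\<^bsub>A\<^esub> k) \<otimes>\<^bsub>A\<^esub> (m [^]\<^bsub>A\<^esub> k'),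
         (t' [^]\<^bsub>T\<^esub> k) \<otimes>\<^bsub>T\<^esub> tensor S M M U m m' \<otimes>\<^bsub>T\<^esub> (t [^]\<^bsub>T\<^esub> k'))),
      one = (1, \<one>\<^bsub>A\<^esub>, \<one>\<^bsub>T\<^esub>),
      zero = (0, \<one>\<^bsub>A\<^esub>, \<one>\<^bsub>T\<^esub>),
      add = (\<lambda>(k, m, t) (k', m', t'). (k + k', m \<otimes>\<^bsub>A\<^esub> m', t \<otimes>\<^bsub>T\<^esub> t'))\<rparr>)"

text \<open>The kernel of \<open>(T\<^sup><\<^sup>3 M)\<^sup>\<times> \<rightarrow> (T\<^sup><\<^sup>1 M)\<^sup>\<times> = \<int>\<^sup>\<times>\<close>.\<close>

definition U_sheaf :: "('o, 'a) site \<Rightarrow> ('o, 'a, 'm) group_presheaf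
    \<Rightarrow> ('o, 'a, int \<times> 'm \<times> ('a \<Rightarrow> (('m \<times> 'm) \<Rightarrow>\<^sub>0 int) set set)) group_presheaf" where
  "U_sheaf S M = mk_group_presheaf
     (\<lambda>U. (units_of (trunc_tensor_ring S M U))
        \<lparr>carrier := kernel (units_of (trunc_tensor_ring S M U)) (units_of \<Z>) fst\<rparr>)
     (\<lambda>f (k, m, t). (k, Res M f m, Res (tensor_sheaf S M M) f t))"

definition U_incl :: "('o, 'a, 'm) group_presheaf \<Rightarrow> 'o \<Rightarrow> 't \<Rightarrow> int \<times> 'm \<times> 't" where
  "U_incl M U t = (1, Unit M U, t)"

definition U_proj :: "'o \<Rightarrow> int \<times> 'm \<times> 't \<Rightarrow> 'm" where
  "U_proj U = (\<lambda>(k, m, t). m)"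

end

(*
A 1-cocycle m of M lifts to the cochain 1 + m of UM, and (1 + m01)(1 + m12) = (1 + m02)(1 + m01 (x) m12),
so the obstruction cocycle of this lift is m01 (x) m12, the cocycle of the cup product; another lift 1 + m + t
changes it by the coboundary of t. In the cup product the two factors may be represented by different
torsors and trivializations; then n = m + dh for a 0-cochain h, and m u m - m u n = d(m u h). Hence a class
of H^2 satisfies the condition that characterizes the connecting map iff it satisfies the one that
characterizes the cup product, and the existence and uniqueness of such a class are not needed. That UM is a
central extension of sheaves is checked locally, where the sections of a tensor sheaf come from the
tensor presheaf.
*)
theory Submission
  imports Defs
begin

section \<open>Covering sieves\<close>

text \<open>The comparison is shaped by the different domains of the two cocycles. The obstruction
  cocycle lives on triples (v, w, b) with b a lift of c(v, w), the cup cocycle on pairs (v, w).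
  Since UM \<rightarrow> M has the set-theoretic section m \<mapsto> 1 + m, natural in the object,
  the projection from triples to pairs has a section that is a map of presheaves. So a witness
  \<alpha> moves both ways: it is pulled back along that section, or along the projection with a
  correction. The correction comes from M \<otimes> M, where the differential of the resolution
  vanishes; hence the covering, \<beta> and \<zeta> stay the same throughout and no refinement of
  coverings enters. The bulk of the work lies elsewhere. M \<otimes> M is a sheafification whose
  sections are families of sets of local representatives, and it has to be shown to be an abelian
  sheaf. One principle reduces this to presheaves: if p represents a section along f, then the
  restriction of the section along f is the image of p, and the arrows f with such a p form a
  covering sieve.\<close>

locale grothendieck_site =
  fixes S :: "('o, 'a) site"
  assumes site: "is_site S"
begin

lemma category: "is_category S"
  using site by (simp add: is_site_def)

lemma intoD:
  assumes "f \<in> into S U"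
  shows "f \<in> Arr S" "Cod S f = U" "Dom S f \<in> Obj S" "U \<in> Obj S"
  using assms category by (auto simp: into_def is_category_def)

lemma arr_into:
  assumes "f \<in> Arr S"
  shows "f \<in> into S (Cod S f)"
  using assms by (simp add: into_def)

lemma ident_into [simp]:
  assumes "U \<in> Obj S"
  shows "Ident S U \<in> into S U" "Dom S (Ident S U) = U"
  using assms category by (auto simp: into_def is_category_def)

lemma comp_into [simp]:
  assumes "f \<in> into S U" "g \<in> into S (Dom S f)"
  shows "Comp S f g \<in> into S U" "Dom S (Comp S f g) = Dom S g"
  using assms category by (auto simp: into_def is_category_def)

lemma comp_ident [simp]:
  assumes "f \<in> into S U"
  shows "Comp S f (Ident S (Dom S f)) = f" "Comp S (Ident S U) f = f"
  using assms category by (auto simp: into_def is_category_def)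

lemma comp_assoc:
  assumes "f \<in> into S U" "g \<in> into S (Dom S f)" "h \<in> into S (Dom S g)"
  shows "Comp S (Comp S f g) h = Comp S f (Comp S g h)"
  using assms category by (auto simp: into_def is_category_def)

lemma cov_sieve:
  assumes "R \<in> Cov S U" "U \<in> Obj S"
  shows "is_sieve S U R"
  using assms site by (simp add: is_site_def)

lemma cov_into:
  assumes "R \<in> Cov S U" "U \<in> Obj S" "f \<in> R"
  shows "f \<in> into S U"
  using cov_sieve[OF assms(1,2)] assms(3) by (auto simp: is_sieve_def)

lemma cov_comp:
  assumes "R \<in> Cov S U" "U \<in> Obj S" "f \<in> R" "g \<in> into S (Dom S f)"
  shows "Comp S f g \<in> R"
  using cov_sieve[OF assms(1,2)] assms(3,4) by (auto simp: is_sieve_def)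

lemma cov_top: "U \<in> Obj S \<Longrightarrow> into S U \<in> Cov S U"
  using site by (simp add: is_site_def)

lemma cov_pull:
  assumes "R \<in> Cov S U" "f \<in> into S U"
  shows "{g \<in> into S (Dom S f). Comp S f g \<in> R} \<in> Cov S (Dom S f)"
  using assms site intoD(4)[OF assms(2)] by (simp add: is_site_def pull_sieve_def)

section \<open>Properties of arrows that hold on a covering sieve\<close>

definition stable :: "'o \<Rightarrow> ('a \<Rightarrow> bool) \<Rightarrow> bool" where
  "stable U Q \<longleftrightarrow> (\<forall>f\<in>into S U. Q f \<longrightarrow> (\<forall>g\<in>into S (Dom S f). Q (Comp S f g)))"

definition locally :: "'o \<Rightarrow> ('a \<Rightarrow> bool) \<Rightarrow> bool" where
  "locally U Q \<longleftrightarrow> {f \<in> into S U. Q f} \<in> Cov S U"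

lemma locally_stable:
  assumes "locally U Q" "U \<in> Obj S"
  shows "stable U Q"
  using cov_comp[OF assms(1)[unfolded locally_def] assms(2)] by (auto simp: stable_def)

lemma stable_comp:
  assumes "stable U Q" "f \<in> into S U"
  shows "stable (Dom S f) (\<lambda>g. Q (Comp S f g))"
  unfolding stable_def
proof (intro ballI impI)
  fix g h
  assume *: "g \<in> into S (Dom S f)" "Q (Comp S f g)" "h \<in> into S (Dom S g)"
  have "Q (Comp S (Comp S f g) h)"
    using assms * unfolding stable_def by (metis comp_into)
  then show "Q (Comp S f (Comp S g h))"
    using assms(2) * by (simp add: comp_assoc)
qed

lemma stable_sieve: "stable U Q \<Longrightarrow> is_sieve S U {f \<in> into S U. Q f}"
  by (auto simp: stable_def is_sieve_def)

text \<open>This is the transitivity axiom of the topology. The axiom applies to sets already known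
  to be sieves, and for {f. Q f} this is what \<open>stable\<close> says; hence the stability
  hypotheses in the lemmas that follow.\<close>

lemma locally_trans:
  assumes "U \<in> Obj S" "R \<in> Cov S U" "stable U Q"
    and "\<And>f. f \<in> R \<Longrightarrow> f \<in> into S U \<Longrightarrow> locally (Dom S f) (\<lambda>g. Q (Comp S f g))"
  shows "locally U Q"
proof -
  have "pull_sieve S f {f \<in> into S U. Q f} \<in> Cov S (Dom S f)" if "f \<in> R" for f
  proof -
    have f: "f \<in> into S U"
      using cov_into assms that by blast
    have "pull_sieve S f {f \<in> into S U. Q f} = {g \<in> into S (Dom S f). Q (Comp S f g)}"
      using f by (auto simp: pull_sieve_def)
    then show ?thesis
      using assms(4)[OF that f] by (simp add: locally_def)
  qed
  then show ?thesis
    using assms(1,2) stable_sieve[OF assms(3)] site unfolding is_site_def locally_def by blast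
qed

lemma locally_all:
  assumes "U \<in> Obj S" "\<And>f. f \<in> into S U \<Longrightarrow> Q f"
  shows "locally U Q"
proof -
  have "{f \<in> into S U. Q f} = into S U"
    using assms by auto
  then show ?thesis
    using cov_top assms by (simp add: locally_def)
qed

lemma locally_cover:
  assumes "U \<in> Obj S" "R \<in> Cov S U" "stable U Q" "\<And>f. f \<in> R \<Longrightarrow> f \<in> into S U \<Longrightarrow> Q f"
  shows "locally U Q"
  using assms(1-3)
proof (rule locally_trans)
  fix f
  assume "f \<in> R" "f \<in> into S U"
  then show "locally (Dom S f) (\<lambda>g. Q (Comp S f g))"
    using assms(3,4) intoD by (intro locally_all) (auto simp: stable_def)
qed

text \<open>A set of arrows containing a covering sieve need not be a sieve, so the weaker property
  has to be stable by itself.\<close>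

lemma locally_mono:
  assumes "U \<in> Obj S" "locally U Q" "stable U Q'" "\<And>f. f \<in> into S U \<Longrightarrow> Q f \<Longrightarrow> Q' f"
  shows "locally U Q'"
  using assms(1) assms(2)[unfolded locally_def] assms(3) by (rule locally_cover) (use assms(4) in auto)

lemma locally_pull:
  assumes "locally U Q" "f \<in> into S U"
  shows "locally (Dom S f) (\<lambda>g. Q (Comp S f g))"
proof -
  have "{g \<in> into S (Dom S f). Comp S f g \<in> {f \<in> into S U. Q f}} = {g \<in> into S (Dom S f). Q (Comp S f g)}"
    using assms(2) by auto
  then show ?thesis
    using cov_pull[OF assms(1)[unfolded locally_def] assms(2)] by (simp add: locally_def)
qed

lemma stable_conj: "stable U Q \<Longrightarrow> stable U Q' \<Longrightarrow> stable U (\<lambda>f. Q f \<and> Q' f)"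
  by (auto simp: stable_def)

text \<open>Transitivity along the sieve of Q: on a member f of it Q persists, and the sieve of Q'
  pulled back along f still covers.\<close>

lemma locally_conj:
  assumes "U \<in> Obj S" "locally U Q" "locally U Q'"
  shows "locally U (\<lambda>f. Q f \<and> Q' f)"
  using assms(1) assms(2)[unfolded locally_def]
proof (rule locally_trans)
  show st: "stable U (\<lambda>f. Q f \<and> Q' f)"
    using assms by (simp add: stable_conj locally_stable)
  fix f
  assume f: "f \<in> {f \<in> into S U. Q f}" "f \<in> into S U"
  show "locally (Dom S f) (\<lambda>g. Q (Comp S f g) \<and> Q' (Comp S f g))"
  proof (rule locally_mono[OF _ locally_pull[OF assms(3) f(2)]])
    show "stable (Dom S f) (\<lambda>g. Q (Comp S f g) \<and> Q' (Comp S f g))"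
      using stable_comp[OF st f(2)] .
  qed (use f intoD locally_stable[OF assms(2,1)] in \<open>auto simp: stable_def\<close>)
qed

end

section \<open>The associated sheaf\<close>

locale presheaf_on = grothendieck_site S for S :: "('o, 'a) site" +
  fixes P :: "('o, 'a, 's, 'z) presheaf_scheme"
  assumes presheaf: "is_presheaf S P"
begin

section \<open>Presheaves and local agreement of their sections\<close>

lemma res_closed [simp]:
  assumes "f \<in> into S U" "p \<in> Sec P U"
  shows "Res P f p \<in> Sec P (Dom S f)"
  using assms presheaf by (auto simp: is_presheaf_def into_def)

lemma res_ident [simp]:
  assumes "U \<in> Obj S" "p \<in> Sec P U"
  shows "Res P (Ident S U) p = p"
  using assms presheaf by (auto simp: is_presheaf_def)

lemma res_comp:
  assumes "f \<in> into S U" "g \<in> into S (Dom S f)" "p \<in> Sec P U"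
  shows "Res P (Comp S f g) p = Res P g (Res P f p)"
  using assms presheaf by (auto simp: is_presheaf_def into_def)

text \<open>Two sections agree in this sense exactly when their images in the associated sheaf are
  equal. It is \<open>agreement\<close> in a form to which the lemmas on \<open>locally\<close>
  apply.\<close>

definition agree :: "'o \<Rightarrow> 's \<Rightarrow> 's \<Rightarrow> bool" where
  "agree U p q \<longleftrightarrow> locally U (\<lambda>g. Res P g p = Res P g q)"

lemma agreement_cov: "agreement S P U p q \<in> Cov S U \<longleftrightarrow> agree U p q"
  by (simp add: agree_def locally_def agreement_def)

lemma stable_agree: "p \<in> Sec P U \<Longrightarrow> q \<in> Sec P U \<Longrightarrow> stable U (\<lambda>g. Res P g p = Res P g q)"
  by (auto simp: stable_def res_comp)

lemma stable_mem:
  assumes "\<And>f g p. f \<in> into S U \<Longrightarrow> g \<in> into S (Dom S f) \<Longrightarrow> p \<in> \<sigma> f \<Longrightarrow> Res P g p \<in> \<sigma> (Comp S f g)"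
    and f: "f \<in> into S U" and p: "p \<in> Sec P (Dom S f)"
  shows "stable (Dom S f) (\<lambda>g. Res P g p \<in> \<sigma> (Comp S f g))"
  unfolding stable_def
proof (intro ballI impI)
  fix g h
  assume *: "g \<in> into S (Dom S f)" "Res P g p \<in> \<sigma> (Comp S f g)" "h \<in> into S (Dom S g)"
  have "Res P h (Res P g p) \<in> \<sigma> (Comp S (Comp S f g) h)"
    using * f by (intro assms(1)[of "Comp S f g"]) simp_all
  then show "Res P (Comp S g h) p \<in> \<sigma> (Comp S f (Comp S g h))"
    using * f p by (simp add: res_comp comp_assoc)
qed

lemma agree_refl: "U \<in> Obj S \<Longrightarrow> agree U p p"
  by (simp add: agree_def locally_all)

lemma agree_sym: "agree U p q \<Longrightarrow> agree U q p"
  by (simp add: agree_def eq_commute)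

lemma agree_trans:
  assumes "U \<in> Obj S" "agree U p q" "agree U q r" "p \<in> Sec P U" "r \<in> Sec P U"
  shows "agree U p r"
  unfolding agree_def
  by (rule locally_mono[OF assms(1) locally_conj[OF assms(1) assms(2,3)[unfolded agree_def]]])
    (use assms stable_agree in auto)

lemma agree_pull:
  assumes "agree U p q" "f \<in> into S U" "p \<in> Sec P U" "q \<in> Sec P U"
  shows "agree (Dom S f) (Res P f p) (Res P f q)"
  unfolding agree_def
  by (rule locally_mono[OF _ locally_pull[OF assms(1)[unfolded agree_def] assms(2)]])
    (use assms intoD in \<open>auto simp: res_comp intro!: stable_agree\<close>)

text \<open>The local character of agreement. It is the presheaf-level source of the saturation of
  the sections in the image of \<open>assoc_unit\<close>.\<close>

lemma agree_local:
  assumes "U \<in> Obj S" "R \<in> Cov S U" "p \<in> Sec P U" "q \<in> Sec P U"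
    and "\<And>f. f \<in> R \<Longrightarrow> f \<in> into S U \<Longrightarrow> agree (Dom S f) (Res P f p) (Res P f q)"
  shows "agree U p q"
  unfolding agree_def
proof (rule locally_trans[OF assms(1,2) stable_agree[OF assms(3,4)]])
  fix f
  assume f: "f \<in> R" "f \<in> into S U"
  show "locally (Dom S f) (\<lambda>g. Res P (Comp S f g) p = Res P (Comp S f g) q)"
    by (rule locally_mono[OF _ assms(5)[OF f, unfolded agree_def] stable_comp[OF stable_agree f(2)]])
      (use f(2) assms(3,4) intoD[OF f(2)] in \<open>auto simp: res_comp\<close>)
qed

section \<open>Sections of the associated sheaf: restriction, separation, gluing\<close>

lemma assoc_sectionsI:
  assumes "\<And>f. f \<notin> into S U \<Longrightarrow> \<sigma> f = {}"
    and "\<And>f p. f \<in> into S U \<Longrightarrow> p \<in> \<sigma> f \<Longrightarrow> p \<in> Sec P (Dom S f)"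
    and "\<And>f g p. f \<in> into S U \<Longrightarrow> g \<in> into S (Dom S f) \<Longrightarrow> p \<in> \<sigma> f \<Longrightarrow> Res P g p \<in> \<sigma> (Comp S f g)"
    and "\<And>f p q. f \<in> into S U \<Longrightarrow> p \<in> \<sigma> f \<Longrightarrow> q \<in> \<sigma> f \<Longrightarrow> agree (Dom S f) p q"
    and "\<And>f p. f \<in> into S U \<Longrightarrow> p \<in> Sec P (Dom S f) \<Longrightarrow>
           locally (Dom S f) (\<lambda>g. Res P g p \<in> \<sigma> (Comp S f g)) \<Longrightarrow> p \<in> \<sigma> f"
    and "locally U (\<lambda>f. \<sigma> f \<noteq> {})"
  shows "\<sigma> \<in> assoc_sections S P U"
  using assms unfolding assoc_sections_def locally_def agreement_cov by blast

lemma assoc_sectionsD: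
  assumes "\<sigma> \<in> assoc_sections S P U"
  shows "\<And>f. f \<notin> into S U \<Longrightarrow> \<sigma> f = {}"
    and "\<And>f p. f \<in> into S U \<Longrightarrow> p \<in> \<sigma> f \<Longrightarrow> p \<in> Sec P (Dom S f)"
    and "\<And>f g p. f \<in> into S U \<Longrightarrow> g \<in> into S (Dom S f) \<Longrightarrow> p \<in> \<sigma> f \<Longrightarrow> Res P g p \<in> \<sigma> (Comp S f g)"
    and "\<And>f p q. f \<in> into S U \<Longrightarrow> p \<in> \<sigma> f \<Longrightarrow> q \<in> \<sigma> f \<Longrightarrow> agree (Dom S f) p q"
    and "\<And>f p. f \<in> into S U \<Longrightarrow> p \<in> Sec P (Dom S f) \<Longrightarrow>
           locally (Dom S f) (\<lambda>g. Res P g p \<in> \<sigma> (Comp S f g)) \<Longrightarrow> p \<in> \<sigma> f"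
    and "locally U (\<lambda>f. \<sigma> f \<noteq> {})"
  using assms unfolding assoc_sections_def locally_def agreement_cov by blast+

lemma assoc_unit_iff:
  "q \<in> assoc_unit S P U p f \<longleftrightarrow>
     f \<in> into S U \<and> q \<in> Sec P (Dom S f) \<and> agree (Dom S f) q (Res P f p)"
  by (simp add: assoc_unit_def agreement_cov)

lemma assoc_unit_section:
  assumes "p \<in> Sec P U" "U \<in> Obj S"
  shows "assoc_unit S P U p \<in> assoc_sections S P U"
proof (rule assoc_sectionsI)
  fix f g q
  assume *: "f \<in> into S U" "g \<in> into S (Dom S f)" "q \<in> assoc_unit S P U p f"
  then show "Res P g q \<in> assoc_unit S P U p (Comp S f g)"
    using agree_pull[of "Dom S f" q "Res P f p" g] assms by (auto simp: assoc_unit_iff res_comp)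
next
  fix f q q'
  assume "f \<in> into S U" "q \<in> assoc_unit S P U p f" "q' \<in> assoc_unit S P U p f"
  then show "agree (Dom S f) q q'"
    by (meson agree_sym agree_trans assoc_unit_iff intoD(3))
next
  fix f q
  assume *: "f \<in> into S U" "q \<in> Sec P (Dom S f)"
    "locally (Dom S f) (\<lambda>g. Res P g q \<in> assoc_unit S P U p (Comp S f g))"
  \<comment> \<open>Membership in the unit section is agreement with the restriction of p, so
    saturation is the local character of agreement.\<close>
  have "agree (Dom S f) q (Res P f p)"
    by (rule agree_local[OF _ *(3)[unfolded locally_def]])
      (use * assms intoD[OF *(1)] in \<open>auto simp: assoc_unit_iff res_comp\<close>)
  with * show "q \<in> assoc_unit S P U p f"
    by (simp add: assoc_unit_iff)
next
  have "Res P f p \<in> assoc_unit S P U p f" if "f \<in> into S U" for f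
    using that assms by (simp add: assoc_unit_iff agree_refl intoD)
  then show "locally U (\<lambda>f. assoc_unit S P U p f \<noteq> {})"
    using assms by (intro locally_all) auto
qed (auto simp: assoc_unit_iff assoc_unit_def)

lemma assoc_res_apply: "f \<in> into S (Dom S h) \<Longrightarrow> assoc_res S h \<sigma> f = \<sigma> (Comp S h f)"
  by (simp add: assoc_res_def)

lemma assoc_res_section:
  assumes "\<sigma> \<in> assoc_sections S P U" "h \<in> into S U"
  shows "assoc_res S h \<sigma> \<in> assoc_sections S P (Dom S h)"
proof (rule assoc_sectionsI)
  note D = assoc_sectionsD[OF assms(1)]
  show "locally (Dom S h) (\<lambda>f. assoc_res S h \<sigma> f \<noteq> {})"
  proof (rule locally_mono[OF _ locally_pull[OF D(6) assms(2)]])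
    have "stable U (\<lambda>f. \<sigma> f \<noteq> {})"
      unfolding stable_def using D(3) by (metis all_not_in_conv)
    from stable_comp[OF this assms(2)] show "stable (Dom S h) (\<lambda>f. assoc_res S h \<sigma> f \<noteq> {})"
      by (simp add: stable_def assoc_res_apply)
  qed (use intoD[OF assms(2)] in \<open>auto simp: assoc_res_apply\<close>)
  fix f
  assume f: "f \<in> into S (Dom S h)"
  have hf: "Comp S h f \<in> into S U" "Dom S (Comp S h f) = Dom S f"
    using f assms by auto
  show "Res P g p \<in> assoc_res S h \<sigma> (Comp S f g)" if "g \<in> into S (Dom S f)" "p \<in> assoc_res S h \<sigma> f" for g p
    using that f D(3)[OF hf(1), of g p] assms hf by (simp add: assoc_res_apply comp_assoc)
  show "p \<in> assoc_res S h \<sigma> f" if p: "p \<in> Sec P (Dom S f)"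
    and loc: "locally (Dom S f) (\<lambda>g. Res P g p \<in> assoc_res S h \<sigma> (Comp S f g))" for p
  proof -
    have "{g \<in> into S (Dom S f). Res P g p \<in> assoc_res S h \<sigma> (Comp S f g)}
        = {g \<in> into S (Dom S f). Res P g p \<in> \<sigma> (Comp S (Comp S h f) g)}"
      using f assms by (auto simp: assoc_res_apply comp_assoc)
    with loc have "locally (Dom S f) (\<lambda>g. Res P g p \<in> \<sigma> (Comp S (Comp S h f) g))"
      by (simp add: locally_def)
    then have "p \<in> \<sigma> (Comp S h f)"
      using D(5)[OF hf(1)] p hf by simp
    with f show ?thesis
      by (simp add: assoc_res_apply)
  qed
  show "p \<in> Sec P (Dom S f)" if "p \<in> assoc_res S h \<sigma> f" for p
    using D(2)[OF hf(1)] that f hf(2) by (simp add: assoc_res_apply)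
  show "agree (Dom S f) p q" if "p \<in> assoc_res S h \<sigma> f" "q \<in> assoc_res S h \<sigma> f" for p q
    using D(4)[OF hf(1)] that f hf(2) by (simp add: assoc_res_apply)
qed (simp add: assoc_res_def)

lemma assoc_res_ident:
  assumes "\<sigma> \<in> assoc_sections S P U" "U \<in> Obj S"
  shows "assoc_res S (Ident S U) \<sigma> = \<sigma>"
  using assms assoc_sectionsD(1)[OF assms(1)] by (auto simp: assoc_res_def fun_eq_iff)

lemma assoc_res_comp:
  assumes "f \<in> into S U" "g \<in> into S (Dom S f)"
  shows "assoc_res S (Comp S f g) \<sigma> = assoc_res S g (assoc_res S f \<sigma>)"
  using assms by (auto simp: assoc_res_def fun_eq_iff comp_assoc)

lemma assoc_res_unit:
  assumes "p \<in> Sec P U" "f \<in> into S U"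
  shows "assoc_res S f (assoc_unit S P U p) = assoc_unit S P (Dom S f) (Res P f p)"
  using assms by (auto simp: fun_eq_iff assoc_res_def assoc_unit_def res_comp)

text \<open>One representative along f determines all further ones: any two are locally equal
  because \<sigma> is single valued, and whatever is locally equal to a representative is one
  because \<sigma> is saturated. Through this lemma an identity between sections becomes an identity
  in the presheaf.\<close>

lemma assoc_res_representative:
  assumes "\<sigma> \<in> assoc_sections S P U" "f \<in> into S U" "p \<in> \<sigma> f"
  shows "assoc_res S f \<sigma> = assoc_unit S P (Dom S f) p"
proof (rule ext)
  note D = assoc_sectionsD[OF assms(1)]
  have p: "p \<in> Sec P (Dom S f)"
    using D assms by blast
  fix g
  show "assoc_res S f \<sigma> g = assoc_unit S P (Dom S f) p g"
  proof (cases "g \<in> into S (Dom S f)")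
    case g: True
    have fg: "Comp S f g \<in> into S U" "Dom S (Comp S f g) = Dom S g"
      using g assms by auto
    have *: "Res P g p \<in> \<sigma> (Comp S f g)"
      using D(3) assms g by blast
    \<comment> \<open>The saturation half: q coincides locally with restrictions of p, which belong
      to \<sigma>.\<close>
    have "q \<in> \<sigma> (Comp S f g)" if q: "q \<in> Sec P (Dom S g)" "agree (Dom S g) q (Res P g p)" for q
    proof -
      have "locally (Dom S g) (\<lambda>h. Res P h q \<in> \<sigma> (Comp S (Comp S f g) h))"
      proof (rule locally_mono[OF _ q(2)[unfolded agree_def]])
        show "stable (Dom S g) (\<lambda>h. Res P h q \<in> \<sigma> (Comp S (Comp S f g) h))"
          using stable_mem[OF D(3) fg(1)] q fg(2) by simp
        show "Res P h q \<in> \<sigma> (Comp S (Comp S f g) h)"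
          if "h \<in> into S (Dom S g)" "Res P h q = Res P h (Res P g p)" for h
          using D(3)[OF fg(1) _ *, of h] that fg by simp
      qed (use intoD[OF g] in auto)
      then show ?thesis
        using D(5)[OF fg(1)] q fg by simp
    qed
    then show ?thesis
      using g D(2)[OF fg(1)] D(4)[OF fg(1) _ *] fg by (auto simp: assoc_res_apply assoc_unit_iff)
  qed (simp add: assoc_res_def assoc_unit_def)
qed

text \<open>A representative of one section along f restricts, on the pullback of R along f, to
  representatives of the other section, and saturation of the latter brings it back to f.\<close>

lemma assoc_separated:
  assumes \<sigma>: "\<sigma> \<in> assoc_sections S P U" and \<tau>: "\<tau> \<in> assoc_sections S P U" and U: "U \<in> Obj S"
    and R: "R \<in> Cov S U"
    and eq: "\<And>f. f \<in> R \<Longrightarrow> f \<in> into S U \<Longrightarrow> assoc_res S f \<sigma> = assoc_res S f \<tau>"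
  shows "\<sigma> = \<tau>"
proof -
  \<comment> \<open>Stated for an arbitrary pair of sections, because it is applied in both
    directions.\<close>
  have sub: "p \<in> \<tau>' f" if f: "f \<in> into S U" and p: "p \<in> \<sigma>' f"
    and \<sigma>': "\<sigma>' \<in> assoc_sections S P U" and \<tau>': "\<tau>' \<in> assoc_sections S P U"
    and eq': "\<And>f. f \<in> R \<Longrightarrow> f \<in> into S U \<Longrightarrow> assoc_res S f \<sigma>' = assoc_res S f \<tau>'" for f p \<sigma>' \<tau>'
  proof (rule assoc_sectionsD(5)[OF \<tau>' f])
    show "p \<in> Sec P (Dom S f)"
      using assoc_sectionsD(2)[OF \<sigma>' f p] .
    have st: "stable (Dom S f) (\<lambda>g. Res P g p \<in> \<tau>' (Comp S f g))"
      using assoc_sectionsD(3)[OF \<tau>'] f \<open>p \<in> Sec P (Dom S f)\<close> by (rule stable_mem)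
    show "locally (Dom S f) (\<lambda>g. Res P g p \<in> \<tau>' (Comp S f g))"
    proof (rule locally_cover[OF _ cov_pull[OF R f] st])
      fix g
      assume g: "g \<in> {g \<in> into S (Dom S f). Comp S f g \<in> R}"
      then have fg: "Comp S f g \<in> into S U" "Dom S (Comp S f g) = Dom S g"
        using f by auto
      have "Res P g p \<in> \<sigma>' (Comp S f g)"
        using g assoc_sectionsD(3)[OF \<sigma>' f _ p] by blast
      \<comment> \<open>The value of a section at an arrow is the value of its restriction along
        that arrow at the identity.\<close>
      moreover have "\<sigma>' (Comp S f g) = \<tau>' (Comp S f g)"
        using fun_cong[OF eq'[of "Comp S f g"], of "Ident S (Dom S g)"] g fg intoD[of g]
        by (auto simp: assoc_res_apply) (metis comp_ident(1))+
      ultimately show "Res P g p \<in> \<tau>' (Comp S f g)"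
        by simp
    qed (use intoD[OF f] in auto)
  qed
  show ?thesis
  proof (rule ext)
    fix f
    show "\<sigma> f = \<tau> f"
      using sub[OF _ _ \<sigma> \<tau> eq] sub[OF _ _ \<tau> \<sigma> eq[symmetric]] assoc_sectionsD(1)[OF \<sigma>] assoc_sectionsD(1)[OF \<tau>]
      by (cases "f \<in> into S U") auto
  qed
qed

text \<open>The representatives of the given local sections form a family on R that is stable under
  restriction and single valued up to local equality. The glued section is the saturation of this
  family.\<close>

lemma assoc_glue:
  assumes U: "U \<in> Obj S" and R: "R \<in> Cov S U"
    and x: "\<And>f. f \<in> R \<Longrightarrow> x f \<in> assoc_sections S P (Dom S f)"
    and compat: "\<And>f g. f \<in> R \<Longrightarrow> g \<in> into S (Dom S f) \<Longrightarrow> x (Comp S f g) = assoc_res S g (x f)"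
  shows "\<exists>\<sigma>\<in>assoc_sections S P U. \<forall>f\<in>R. assoc_res S f \<sigma> = x f"
proof -
  \<comment> \<open>The value at the identity is the set of representatives of the section x f
    itself.\<close>
  define T where "T f = x f (Ident S (Dom S f))" for f
  have Rin: "f \<in> into S U" if "f \<in> R" for f
    using cov_into[OF R U that] .
  have Rcomp: "Comp S f g \<in> R" if "f \<in> R" "g \<in> into S (Dom S f)" for f g
    using cov_comp[OF R U that] .
  have T: "T (Comp S f g) = x f g" if f: "f \<in> R" and g: "g \<in> into S (Dom S f)" for f g
    using compat[OF f g] Rin[OF f] g intoD[OF g] by (simp add: T_def assoc_res_apply)
  have Tsec: "p \<in> Sec P (Dom S f)" if "f \<in> R" "p \<in> T f" for f p
    using assoc_sectionsD(2)[OF x[OF that(1)], of "Ident S (Dom S f)" p] that intoD[OF Rin[OF that(1)]]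
    by (simp add: T_def)
  have Tres: "Res P g p \<in> T (Comp S f g)" if "f \<in> R" "g \<in> into S (Dom S f)" "p \<in> T f" for f g p
    using assoc_sectionsD(3)[OF x[OF that(1)], of "Ident S (Dom S f)" g p] that intoD[OF Rin[OF that(1)]]
    by (simp add: T_def[of f] T)
  have Tagree: "agree (Dom S f) p q" if "f \<in> R" "p \<in> T f" "q \<in> T f" for f p q
    using assoc_sectionsD(4)[OF x[OF that(1)], of "Ident S (Dom S f)" p q] that intoD[OF Rin[OF that(1)]]
    by (simp add: T_def)
  \<comment> \<open>Membership of the composite in R is part of the condition, since T carries
    information only for arrows of R, while f ranges over all arrows into U.\<close>
  define L where "L f p g \<longleftrightarrow> Comp S f g \<in> R \<and> Res P g p \<in> T (Comp S f g)" for f p g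
  have Lstable: "stable (Dom S f) (L f p)" if "f \<in> into S U" "p \<in> Sec P (Dom S f)" for f p
    unfolding stable_def
  proof (intro ballI impI)
    fix g k
    assume *: "g \<in> into S (Dom S f)" "L f p g" "k \<in> into S (Dom S g)"
    have 1: "Comp S (Comp S f g) k \<in> R"
      using * that Rcomp[of "Comp S f g" k] by (simp add: L_def)
    moreover have "Res P k (Res P g p) \<in> T (Comp S (Comp S f g) k)"
      using * that by (intro Tres[of "Comp S f g"]) (simp_all add: L_def)
    ultimately show "L f p (Comp S g k)"
      using * that by (simp add: L_def comp_assoc res_comp)
  qed
  \<comment> \<open>The saturation of T: all p that restrict into T along a covering sieve.\<close>
  define \<sigma> where "\<sigma> f = (if f \<in> into S U then {p \<in> Sec P (Dom S f). locally (Dom S f) (L f p)} else {})" for f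
  have \<sigma>I: "T f \<subseteq> \<sigma> f" if f: "f \<in> R" for f
  proof
    fix p
    assume p: "p \<in> T f"
    have "locally (Dom S f) (L f p)"
      using f p Rcomp Tres intoD[OF Rin[OF f]] by (intro locally_all) (auto simp: L_def)
    then show "p \<in> \<sigma> f"
      using Tsec[OF f p] Rin[OF f] by (simp add: \<sigma>_def)
  qed
  have \<sigma>res: "Res P g p \<in> \<sigma> (Comp S f g)" if f: "f \<in> into S U" and g: "g \<in> into S (Dom S f)" and p: "p \<in> \<sigma> f" for f g p
  proof -
    have p': "p \<in> Sec P (Dom S f)" "locally (Dom S f) (L f p)"
      using p f by (auto simp: \<sigma>_def)
    have "locally (Dom S g) (L (Comp S f g) (Res P g p))"
    proof (rule locally_mono[OF _ locally_pull[OF p'(2) g]])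
      show "stable (Dom S g) (L (Comp S f g) (Res P g p))"
        using Lstable[of "Comp S f g" "Res P g p"] f g p' by simp
    qed (use f g p' intoD[OF g] in \<open>auto simp: L_def comp_assoc res_comp\<close>)
    then show ?thesis
      using f g p' by (simp add: \<sigma>_def)
  qed
  have sec: "\<sigma> \<in> assoc_sections S P U"
  proof (rule assoc_sectionsI)
    fix f p q
    assume f: "f \<in> into S U" and pq: "p \<in> \<sigma> f" "q \<in> \<sigma> f"
    have p: "p \<in> Sec P (Dom S f)" "locally (Dom S f) (L f p)" and q: "q \<in> Sec P (Dom S f)" "locally (Dom S f) (L f q)"
      using pq f by (auto simp: \<sigma>_def)
    show "agree (Dom S f) p q"
      by (rule agree_local[OF _ locally_conj[OF _ p(2) q(2), unfolded locally_def] p(1) q(1)])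
        (use f intoD[OF f] Tagree in \<open>fastforce simp: L_def\<close>)+
  next
    fix f p
    assume f: "f \<in> into S U" and p: "p \<in> Sec P (Dom S f)"
      and loc: "locally (Dom S f) (\<lambda>g. Res P g p \<in> \<sigma> (Comp S f g))"
    have "locally (Dom S f) (L f p)"
    proof (rule locally_trans[OF _ loc[unfolded locally_def] Lstable[OF f p]])
      fix g
      assume g: "g \<in> {g \<in> into S (Dom S f). Res P g p \<in> \<sigma> (Comp S f g)}"
      have l: "locally (Dom S g) (L (Comp S f g) (Res P g p))"
        using g f by (auto simp: \<sigma>_def)
      show "locally (Dom S g) (\<lambda>k. L f p (Comp S g k))"
      proof (rule locally_mono[OF _ l])
        show "stable (Dom S g) (\<lambda>k. L f p (Comp S g k))"
          using stable_comp[OF Lstable[OF f p]] g by simp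
      qed (use f g p intoD[of g] in \<open>auto simp: L_def comp_assoc res_comp\<close>)
    qed (use intoD[OF f] in auto)
    then show "p \<in> \<sigma> f"
      using f p by (simp add: \<sigma>_def)
  next
    have st: "stable U (\<lambda>f. \<sigma> f \<noteq> {})"
      unfolding stable_def using \<sigma>res by (metis all_not_in_conv)
    show "locally U (\<lambda>f. \<sigma> f \<noteq> {})"
    proof (rule locally_trans[OF U R st])
      fix f
      assume f: "f \<in> R" "f \<in> into S U"
      show "locally (Dom S f) (\<lambda>g. \<sigma> (Comp S f g) \<noteq> {})"
      proof (rule locally_mono[OF _ assoc_sectionsD(6)[OF x[OF f(1)]]])
        show "stable (Dom S f) (\<lambda>g. \<sigma> (Comp S f g) \<noteq> {})"
          using stable_comp[OF st f(2)] .
        fix g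
        assume "g \<in> into S (Dom S f)" "x f g \<noteq> {}"
        then show "\<sigma> (Comp S f g) \<noteq> {}"
          using T[OF f(1)] \<sigma>I[OF Rcomp[OF f(1)]] by fastforce
      qed (use intoD[OF f(2)] in auto)
    qed
  qed (use \<sigma>res in \<open>auto simp: \<sigma>_def\<close>)
  \<comment> \<open>By separation it is enough to compare along arrows g at which x f has a
    representative. That element then represents both sides, so both restrict to its image.\<close>
  have "assoc_res S f \<sigma> = x f" if f: "f \<in> R" for f
  proof (rule assoc_separated)
    show "assoc_res S f \<sigma> \<in> assoc_sections S P (Dom S f)"
      using assoc_res_section[OF sec Rin[OF f]] .
    show "{g \<in> into S (Dom S f). x f g \<noteq> {}} \<in> Cov S (Dom S f)"
      using assoc_sectionsD(6)[OF x[OF f]] by (simp add: locally_def)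
    fix g
    assume g: "g \<in> {g \<in> into S (Dom S f). x f g \<noteq> {}}"
    then obtain p where p: "p \<in> x f g"
      by auto
    have "p \<in> assoc_res S f \<sigma> g"
      using p g \<sigma>I[OF Rcomp[OF f]] T[OF f] by (auto simp: assoc_res_apply)
    then show "assoc_res S g (assoc_res S f \<sigma>) = assoc_res S g (x f)"
      using assoc_res_representative[OF assoc_res_section[OF sec Rin[OF f]]] assoc_res_representative[OF x[OF f]] p g
      by simp
  qed (use x[OF f] intoD[OF Rin[OF f]] in auto)
  with sec show ?thesis
    by blast
qed

text \<open>Nonemptiness on a covering sieve, rewritten by \<open>assoc_res_representative\<close>.
  The group laws of the associated sheaf are verified on such sieves.\<close>

lemma assoc_locally_represented:
  assumes "\<sigma> \<in> assoc_sections S P U" "U \<in> Obj S"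
  shows "locally U (\<lambda>f. \<exists>p\<in>Sec P (Dom S f). assoc_res S f \<sigma> = assoc_unit S P (Dom S f) p)"
proof (rule locally_mono[OF assms(2) assoc_sectionsD(6)[OF assms(1)]])
  show "stable U (\<lambda>f. \<exists>p\<in>Sec P (Dom S f). assoc_res S f \<sigma> = assoc_unit S P (Dom S f) p)"
    unfolding stable_def using res_closed by (metis assoc_res_comp assoc_res_unit comp_into(2))
  show "\<exists>p\<in>Sec P (Dom S f). assoc_res S f \<sigma> = assoc_unit S P (Dom S f) p"
    if "f \<in> into S U" "\<sigma> f \<noteq> {}" for f
    using that assoc_res_representative[OF assms(1)] assoc_sectionsD(2)[OF assms(1)] by blast
qed

end

lemma Grp_simps [simp]:
  "carrier (Grp F U) = Sec F U" "monoid.mult (Grp F U) = Mul F U" "one (Grp F U) = Unit F U"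
  by (simp_all add: Grp_def)

lemma Grp_mk_group_presheaf [simp]:
  "Grp (mk_group_presheaf G r) U = \<lparr>carrier = carrier (G U), monoid.mult = monoid.mult (G U), one = one (G U)\<rparr>"
  "Sec (mk_group_presheaf G r) U = carrier (G U)"
  "Res (mk_group_presheaf G r) = r"
  "Mul (mk_group_presheaf G r) U = monoid.mult (G U)"
  "Unit (mk_group_presheaf G r) U = one (G U)"
  by (simp_all add: mk_group_presheaf_def Grp_def)

section \<open>Presheaves of abelian groups\<close>

locale abelian_presheaf = presheaf_on S P
  for S :: "('o, 'a) site" and P :: "('o, 'a, 'g) group_presheaf" +
  assumes comm: "U \<in> Obj S \<Longrightarrow> comm_group (Grp P U)"
    and res_hom: "f \<in> Arr S \<Longrightarrow> Res P f \<in> hom (Grp P (Cod S f)) (Grp P (Dom S f))"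
begin

lemma grp: "U \<in> Obj S \<Longrightarrow> group (Grp P U)"
  using comm comm_group.axioms(2) by blast

lemma mul_closed [simp]:
  assumes "U \<in> Obj S" "p \<in> Sec P U" "q \<in> Sec P U"
  shows "Mul P U p q \<in> Sec P U"
proof -
  interpret comm_group "Grp P U"
    by (rule comm[OF assms(1)])
  show ?thesis
    using m_closed[of p q] assms by simp
qed

lemma unit_closed [simp]: "U \<in> Obj S \<Longrightarrow> Unit P U \<in> Sec P U"
  using group.is_monoid[OF grp, THEN monoid.one_closed] by simp

lemma inv_closed [simp]: "U \<in> Obj S \<Longrightarrow> p \<in> Sec P U \<Longrightarrow> inv\<^bsub>Grp P U\<^esub> p \<in> Sec P U"
  using group.inv_closed[OF grp] by simp

lemma mul_assoc:
  assumes "U \<in> Obj S" "p \<in> Sec P U" "q \<in> Sec P U" "r \<in> Sec P U"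
  shows "Mul P U (Mul P U p q) r = Mul P U p (Mul P U q r)"
proof -
  interpret comm_group "Grp P U"
    by (rule comm[OF assms(1)])
  show ?thesis
    using m_assoc[of p q r] assms by simp
qed

lemma mul_comm:
  assumes "U \<in> Obj S" "p \<in> Sec P U" "q \<in> Sec P U"
  shows "Mul P U p q = Mul P U q p"
proof -
  interpret comm_group "Grp P U"
    by (rule comm[OF assms(1)])
  show ?thesis
    using m_comm[of p q] assms by simp
qed

lemma mul_unit [simp]:
  assumes "U \<in> Obj S" "p \<in> Sec P U"
  shows "Mul P U (Unit P U) p = p" "Mul P U p (Unit P U) = p"
proof -
  interpret comm_group "Grp P U"
    by (rule comm[OF assms(1)])
  show "Mul P U (Unit P U) p = p" "Mul P U p (Unit P U) = p"
    using l_one[of p] r_one[of p] assms by simp_all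
qed

lemma mul_inv [simp]:
  assumes "U \<in> Obj S" "p \<in> Sec P U"
  shows "Mul P U (inv\<^bsub>Grp P U\<^esub> p) p = Unit P U" "Mul P U p (inv\<^bsub>Grp P U\<^esub> p) = Unit P U"
proof -
  interpret comm_group "Grp P U"
    by (rule comm[OF assms(1)])
  show "Mul P U (inv\<^bsub>Grp P U\<^esub> p) p = Unit P U" "Mul P U p (inv\<^bsub>Grp P U\<^esub> p) = Unit P U"
    using l_inv[of p] r_inv[of p] assms by simp_all
qed

lemma mul_lcomm:
  assumes "U \<in> Obj S" "p \<in> Sec P U" "q \<in> Sec P U" "r \<in> Sec P U"
  shows "Mul P U p (Mul P U q r) = Mul P U q (Mul P U p r)"
  using assms by (simp add: mul_assoc[symmetric] mul_comm[of U p q])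

lemmas mul_ac = mul_assoc mul_comm mul_lcomm

lemma mul_idem:
  assumes "U \<in> Obj S" "p \<in> Sec P U" "p = Mul P U p p"
  shows "p = Unit P U"
  using assms by (metis mul_inv(2) mul_assoc inv_closed mul_unit(2))

lemma inv_unique:
  assumes "U \<in> Obj S" "p \<in> Sec P U" "q \<in> Sec P U" "Mul P U p q = Unit P U"
  shows "p = inv\<^bsub>Grp P U\<^esub> q"
  using group.inv_equality[OF grp, of U p q] assms by simp

lemma inv_mul:
  assumes "U \<in> Obj S" "p \<in> Sec P U" "q \<in> Sec P U"
  shows "inv\<^bsub>Grp P U\<^esub> (Mul P U p q) = Mul P U (inv\<^bsub>Grp P U\<^esub> p) (inv\<^bsub>Grp P U\<^esub> q)"
  using comm_group.inv_mult[OF comm, of U p q] assms by simp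

lemma mul_inv_cancel:
  assumes "U \<in> Obj S" "p \<in> Sec P U" "q \<in> Sec P U"
  shows "Mul P U (inv\<^bsub>Grp P U\<^esub> p) (Mul P U p q) = q" "Mul P U p (Mul P U (inv\<^bsub>Grp P U\<^esub> p) q) = q"
    "Mul P U (inv\<^bsub>Grp P U\<^esub> p) (Mul P U q p) = q" "Mul P U p (Mul P U q (inv\<^bsub>Grp P U\<^esub> p)) = q"
proof -
  show "Mul P U (inv\<^bsub>Grp P U\<^esub> p) (Mul P U p q) = q" "Mul P U p (Mul P U (inv\<^bsub>Grp P U\<^esub> p) q) = q"
    using assms by (simp_all add: mul_assoc[symmetric])
  then show "Mul P U (inv\<^bsub>Grp P U\<^esub> p) (Mul P U q p) = q" "Mul P U p (Mul P U q (inv\<^bsub>Grp P U\<^esub> p)) = q"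
    using assms by (simp_all add: mul_comm[of U q])
qed

text \<open>Complements \<open>mul_ac\<close>, which orders factors by their terms and can leave a
  foreign factor between p and its inverse.\<close>

lemma mul_inv_cancel_left:
  assumes "U \<in> Obj S" "p \<in> Sec P U" "q \<in> Sec P U" "r \<in> Sec P U"
  shows "Mul P U (inv\<^bsub>Grp P U\<^esub> p) (Mul P U q (Mul P U p r)) = Mul P U q r"
    "Mul P U p (Mul P U q (Mul P U (inv\<^bsub>Grp P U\<^esub> p) r)) = Mul P U q r"
  using assms by (simp_all add: mul_lcomm[of U q] mul_inv_cancel)

lemma mul_inv_cancel_right:
  assumes "U \<in> Obj S" "p \<in> Sec P U" "q \<in> Sec P U" "r \<in> Sec P U"
  shows "Mul P U (Mul P U p r) (inv\<^bsub>Grp P U\<^esub> (Mul P U q r)) = Mul P U p (inv\<^bsub>Grp P U\<^esub> q)"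
  using assms by (simp add: inv_mul mul_assoc mul_inv_cancel)

lemma res_group_hom:
  assumes "f \<in> into S U"
  shows "group_hom (Grp P U) (Grp P (Dom S f)) (Res P f)"
  using res_hom[of f] intoD[OF assms] grp by (auto simp: group_hom_def group_hom_axioms_def)

lemma res_mul [simp]:
  assumes "f \<in> into S U" "p \<in> Sec P U" "q \<in> Sec P U"
  shows "Res P f (Mul P U p q) = Mul P (Dom S f) (Res P f p) (Res P f q)"
  using hom_mult[OF group_hom.homh[OF res_group_hom[OF assms(1)]], of p q] assms by simp

lemma res_unit [simp]: "f \<in> into S U \<Longrightarrow> Res P f (Unit P U) = Unit P (Dom S f)"
  using group_hom.hom_one[OF res_group_hom] by simp

lemma res_inv [simp]:
  assumes "f \<in> into S U" "p \<in> Sec P U"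
  shows "Res P f (inv\<^bsub>Grp P U\<^esub> p) = inv\<^bsub>Grp P (Dom S f)\<^esub> (Res P f p)"
  using group_hom.hom_inv[OF res_group_hom[OF assms(1)], of p] assms by simp

lemma agree_mul:
  assumes U: "U \<in> Obj S" and pq: "p \<in> Sec P U" "q \<in> Sec P U" "p' \<in> Sec P U" "q' \<in> Sec P U"
    and ag: "agree U p p'" "agree U q q'"
  shows "agree U (Mul P U p q) (Mul P U p' q')"
  unfolding agree_def
  by (rule locally_mono[OF U locally_conj[OF U ag[unfolded agree_def]] stable_agree]) (use U pq in simp_all)

section \<open>The group structure of the associated sheaf\<close>

lemma assoc_eqI:
  assumes "\<sigma> \<in> assoc_sections S P U" "\<tau> \<in> assoc_sections S P U" "U \<in> Obj S"
    and "locally U Q" "\<And>f. f \<in> into S U \<Longrightarrow> Q f \<Longrightarrow> assoc_res S f \<sigma> = assoc_res S f \<tau>"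
  shows "\<sigma> = \<tau>"
  using assms(1-3) assms(4)[unfolded locally_def] by (rule assoc_separated) (use assms(5) in auto)

lemma assoc_eq_unit:
  assumes "\<sigma> \<in> assoc_sections S P U" "U \<in> Obj S" "p \<in> \<sigma> (Ident S U)"
  shows "\<sigma> = assoc_unit S P U p"
  using assoc_res_representative[OF assms(1) ident_into(1)[OF assms(2)] assms(3)] assms
  by (simp add: assoc_res_ident)

text \<open>The condition on g inside \<open>assoc_mult\<close>, turned into a predicate on arrows
  so that it can be handled by \<open>locally\<close> and \<open>stable\<close>.\<close>

definition factors where
  "factors U \<sigma> \<tau> f r g \<longleftrightarrow> (\<exists>p\<in>\<sigma> (Comp S f g). \<exists>q\<in>\<tau> (Comp S f g). Res P g r = Mul P (Dom S g) p q)"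

lemma assoc_mult_iff:
  "r \<in> assoc_mult S P U \<sigma> \<tau> f \<longleftrightarrow> f \<in> into S U \<and> r \<in> Sec P (Dom S f) \<and> locally (Dom S f) (factors U \<sigma> \<tau> f r)"
  by (simp add: assoc_mult_def locally_def factors_def)

lemma factorsI:
  assumes "\<sigma> \<in> assoc_sections S P U" "\<tau> \<in> assoc_sections S P U" "f \<in> into S U" "p \<in> \<sigma> f" "q \<in> \<tau> f" "g \<in> into S (Dom S f)"
  shows "factors U \<sigma> \<tau> f (Mul P (Dom S f) p q) g"
  using assms assoc_sectionsD(2,3)[OF assms(1)] assoc_sectionsD(2,3)[OF assms(2)] unfolding factors_def
  by (intro bexI[of _ "Res P g p"] bexI[of _ "Res P g q"]) auto

lemma stable_factors:
  assumes \<sigma>: "\<sigma> \<in> assoc_sections S P U" and \<tau>: "\<tau> \<in> assoc_sections S P U" and f: "f \<in> into S U" and r: "r \<in> Sec P (Dom S f)"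
  shows "stable (Dom S f) (factors U \<sigma> \<tau> f r)"
  unfolding stable_def
proof (intro ballI impI)
  fix g h
  assume g: "g \<in> into S (Dom S f)" and h: "h \<in> into S (Dom S g)" and "factors U \<sigma> \<tau> f r g"
  then obtain p q where pq: "p \<in> \<sigma> (Comp S f g)" "q \<in> \<tau> (Comp S f g)" "Res P g r = Mul P (Dom S g) p q"
    by (auto simp: factors_def)
  have fg: "Comp S f g \<in> into S U" "Dom S (Comp S f g) = Dom S g"
    using f g by auto
  have "p \<in> Sec P (Dom S g)" "q \<in> Sec P (Dom S g)"
    using assoc_sectionsD(2)[OF \<sigma> fg(1)] assoc_sectionsD(2)[OF \<tau> fg(1)] pq fg by auto
  moreover have "Res P h p \<in> \<sigma> (Comp S f (Comp S g h))" "Res P h q \<in> \<tau> (Comp S f (Comp S g h))"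
    using assoc_sectionsD(3)[OF \<sigma> fg(1) _ pq(1), of h] assoc_sectionsD(3)[OF \<tau> fg(1) _ pq(2), of h] f g h fg
    by (simp_all add: comp_assoc)
  ultimately show "factors U \<sigma> \<tau> f r (Comp S g h)"
    unfolding factors_def using g h r pq(3)
    by (intro bexI[of _ "Res P h p"] bexI[of _ "Res P h q"]) (simp_all add: res_comp)
qed

lemma assoc_multI:
  assumes "\<sigma> \<in> assoc_sections S P U" "\<tau> \<in> assoc_sections S P U" "f \<in> into S U" "p \<in> \<sigma> f" "q \<in> \<tau> f"
  shows "Mul P (Dom S f) p q \<in> assoc_mult S P U \<sigma> \<tau> f"
  using assms factorsI[OF assms] assoc_sectionsD(2)[OF assms(1,3)] assoc_sectionsD(2)[OF assms(2,3)] intoD[OF assms(3)]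
  by (auto simp: assoc_mult_iff intro!: locally_all)

lemma assoc_mult_section:
  assumes \<sigma>: "\<sigma> \<in> assoc_sections S P U" and \<tau>: "\<tau> \<in> assoc_sections S P U" and U: "U \<in> Obj S"
  shows "assoc_mult S P U \<sigma> \<tau> \<in> assoc_sections S P U" (is "?m \<in> _")
proof (rule assoc_sectionsI)
  \<comment> \<open>Factoring the restriction of r along h is factoring r along the composite. This
    is the translation between the sieves over the domain of f and over the domain of g.\<close>
  have shift: "factors U \<sigma> \<tau> (Comp S f g) (Res P g r) h \<longleftrightarrow> factors U \<sigma> \<tau> f r (Comp S g h)"
    if "f \<in> into S U" "g \<in> into S (Dom S f)" "h \<in> into S (Dom S g)" "r \<in> Sec P (Dom S f)" for f g h r
    using that by (simp add: factors_def comp_assoc res_comp)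
  show 3: "Res P g r \<in> ?m (Comp S f g)" if f: "f \<in> into S U" and g: "g \<in> into S (Dom S f)" and r: "r \<in> ?m f" for f g r
  proof -
    have r': "r \<in> Sec P (Dom S f)" "locally (Dom S f) (factors U \<sigma> \<tau> f r)"
      using r by (auto simp: assoc_mult_iff)
    have "locally (Dom S g) (factors U \<sigma> \<tau> (Comp S f g) (Res P g r))"
      by (rule locally_mono[OF _ locally_pull[OF r'(2) g]])
        (use f g r' intoD[OF g] stable_factors[OF \<sigma> \<tau>, of "Comp S f g" "Res P g r"] in \<open>auto simp: shift\<close>)
    then show ?thesis
      using f g r' by (simp add: assoc_mult_iff)
  qed
  show "agree (Dom S f) r r'" if f: "f \<in> into S U" and r: "r \<in> ?m f" "r' \<in> ?m f" for f r r'
  proof -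
    have *: "r \<in> Sec P (Dom S f)" "r' \<in> Sec P (Dom S f)"
      "locally (Dom S f) (factors U \<sigma> \<tau> f r)" "locally (Dom S f) (factors U \<sigma> \<tau> f r')"
      using r by (auto simp: assoc_mult_iff)
    show ?thesis
    proof (rule agree_local[OF _ locally_conj[OF _ *(3,4), unfolded locally_def] *(1,2)])
      fix g
      assume g: "g \<in> into S (Dom S f)" and "g \<in> {g \<in> into S (Dom S f). factors U \<sigma> \<tau> f r g \<and> factors U \<sigma> \<tau> f r' g}"
      then obtain p q p' q' where pq: "p \<in> \<sigma> (Comp S f g)" "q \<in> \<tau> (Comp S f g)" "Res P g r = Mul P (Dom S g) p q"
        and pq': "p' \<in> \<sigma> (Comp S f g)" "q' \<in> \<tau> (Comp S f g)" "Res P g r' = Mul P (Dom S g) p' q'"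
        by (auto simp: factors_def)
      have fg: "Comp S f g \<in> into S U" "Dom S (Comp S f g) = Dom S g"
        using f g by auto
      show "agree (Dom S g) (Res P g r) (Res P g r')"
        unfolding pq(3) pq'(3)
        using assoc_sectionsD(2,4)[OF \<sigma> fg(1)] assoc_sectionsD(2,4)[OF \<tau> fg(1)] pq(1,2) pq'(1,2) fg intoD[OF g]
        by (intro agree_mul) auto
    qed (use intoD[OF f] in auto)
  qed
  show "r \<in> ?m f" if f: "f \<in> into S U" and r: "r \<in> Sec P (Dom S f)"
    and loc: "locally (Dom S f) (\<lambda>g. Res P g r \<in> ?m (Comp S f g))" for f r
  proof -
    have "locally (Dom S f) (factors U \<sigma> \<tau> f r)"
    proof (rule locally_trans[OF _ loc[unfolded locally_def] stable_factors[OF \<sigma> \<tau> f r]])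
      fix g
      assume g: "g \<in> into S (Dom S f)" and "g \<in> {g \<in> into S (Dom S f). Res P g r \<in> ?m (Comp S f g)}"
      then have l: "locally (Dom S g) (factors U \<sigma> \<tau> (Comp S f g) (Res P g r))"
        using f g by (simp add: assoc_mult_iff)
      show "locally (Dom S g) (\<lambda>h. factors U \<sigma> \<tau> f r (Comp S g h))"
        by (rule locally_mono[OF _ l stable_comp[OF stable_factors[OF \<sigma> \<tau> f r] g]])
          (use f g r intoD[OF g] in \<open>auto simp: shift\<close>)
    qed (use intoD[OF f] in auto)
    then show ?thesis
      using f r by (simp add: assoc_mult_iff)
  qed
  have "stable U (\<lambda>f. ?m f \<noteq> {})"
    unfolding stable_def using 3 by (metis all_not_in_conv)
  \<comment> \<open>Where both factors have representatives, the product of these represents the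
    product.\<close>
  then show "locally U (\<lambda>f. ?m f \<noteq> {})"
    by (rule locally_mono[OF U locally_conj[OF U assoc_sectionsD(6)[OF \<sigma>] assoc_sectionsD(6)[OF \<tau>]]])
      (use assoc_multI[OF \<sigma> \<tau>] in blast)
qed (auto simp: assoc_mult_iff assoc_mult_def)

lemma assoc_res_mult:
  assumes "h \<in> into S U"
  shows "assoc_res S h (assoc_mult S P U \<sigma> \<tau>) = assoc_mult S P (Dom S h) (assoc_res S h \<sigma>) (assoc_res S h \<tau>)"
proof (rule ext)
  fix f
  show "assoc_res S h (assoc_mult S P U \<sigma> \<tau>) f = assoc_mult S P (Dom S h) (assoc_res S h \<sigma>) (assoc_res S h \<tau>) f"
  proof (cases "f \<in> into S (Dom S h)")
    case True
    have "factors U \<sigma> \<tau> (Comp S h f) r g \<longleftrightarrow> factors (Dom S h) (assoc_res S h \<sigma>) (assoc_res S h \<tau>) f r g"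
      if "g \<in> into S (Dom S f)" for r g
      using assms True that by (simp add: factors_def assoc_res_apply comp_assoc)
    then show ?thesis
      using assms True by (auto simp: assoc_res_apply assoc_mult_iff locally_def cong: conj_cong)
  qed (simp add: assoc_res_def assoc_mult_def)
qed

text \<open>The product of p and q represents the left-hand side at the identity, and a
  representative at the identity determines a section.\<close>

lemma assoc_mult_unit:
  assumes "p \<in> Sec P U" "q \<in> Sec P U" "U \<in> Obj S"
  shows "assoc_mult S P U (assoc_unit S P U p) (assoc_unit S P U q) = assoc_unit S P U (Mul P U p q)"
proof (rule assoc_eq_unit)
  have "p \<in> assoc_unit S P U p (Ident S U)" "q \<in> assoc_unit S P U q (Ident S U)"
    using assms by (simp_all add: assoc_unit_iff agree_refl)
  then show "Mul P U p q \<in> assoc_mult S P U (assoc_unit S P U p) (assoc_unit S P U q) (Ident S U)"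
    using assoc_multI[OF assoc_unit_section[OF assms(1,3)] assoc_unit_section[OF assms(2,3)], of "Ident S U"] assms
    by simp
qed (use assms assoc_mult_section assoc_unit_section in auto)

text \<open>Taken as a preimage under inversion and not as an image, so that each closure condition
  on \<sigma> transfers by the compatibility of inversion with restriction.\<close>

definition assoc_inv where
  "assoc_inv U \<sigma> f = (if f \<in> into S U then {p \<in> Sec P (Dom S f). inv\<^bsub>Grp P (Dom S f)\<^esub> p \<in> \<sigma> f} else {})"

lemma inv_inv [simp]: "U \<in> Obj S \<Longrightarrow> p \<in> Sec P U \<Longrightarrow> inv\<^bsub>Grp P U\<^esub> (inv\<^bsub>Grp P U\<^esub> p) = p"
  using group.inv_inv[OF grp] by simp

lemma agree_inv:
  assumes "U \<in> Obj S" "p \<in> Sec P U" "q \<in> Sec P U" "agree U (inv\<^bsub>Grp P U\<^esub> p) (inv\<^bsub>Grp P U\<^esub> q)"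
  shows "agree U p q"
  unfolding agree_def
proof (rule locally_mono[OF assms(1) assms(4)[unfolded agree_def] stable_agree])
  fix f
  assume f: "f \<in> into S U" "Res P f (inv\<^bsub>Grp P U\<^esub> p) = Res P f (inv\<^bsub>Grp P U\<^esub> q)"
  then show "Res P f p = Res P f q"
    using assms intoD[OF f(1)] by (metis res_inv inv_inv res_closed)
qed (use assms in auto)

lemma assoc_inv_section:
  assumes \<sigma>: "\<sigma> \<in> assoc_sections S P U" and U: "U \<in> Obj S"
  shows "assoc_inv U \<sigma> \<in> assoc_sections S P U"
proof (rule assoc_sectionsI)
  show 3: "Res P g p \<in> assoc_inv U \<sigma> (Comp S f g)"
    if f: "f \<in> into S U" and g: "g \<in> into S (Dom S f)" and p: "p \<in> assoc_inv U \<sigma> f" for f g p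
    using assoc_sectionsD(3)[OF \<sigma> f g, of "inv\<^bsub>Grp P (Dom S f)\<^esub> p"] f g p by (simp add: assoc_inv_def)
  show "agree (Dom S f) p q" if f: "f \<in> into S U" and p: "p \<in> assoc_inv U \<sigma> f" "q \<in> assoc_inv U \<sigma> f" for f p q
    using p f assoc_sectionsD(4)[OF \<sigma> f] intoD[OF f] by (auto simp: assoc_inv_def intro: agree_inv)
  show "p \<in> assoc_inv U \<sigma> f" if f: "f \<in> into S U" and p: "p \<in> Sec P (Dom S f)"
    and loc: "locally (Dom S f) (\<lambda>g. Res P g p \<in> assoc_inv U \<sigma> (Comp S f g))" for f p
  proof -
    note Df = intoD(3)[OF f]
    have "locally (Dom S f) (\<lambda>g. Res P g (inv\<^bsub>Grp P (Dom S f)\<^esub> p) \<in> \<sigma> (Comp S f g))"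
      by (rule locally_mono[OF Df loc stable_mem[OF assoc_sectionsD(3)[OF \<sigma>] f]])
        (use f p Df in \<open>auto simp: assoc_inv_def\<close>)
    then show ?thesis
      using assoc_sectionsD(5)[OF \<sigma> f] f p Df by (simp add: assoc_inv_def)
  qed
  have "stable U (\<lambda>f. assoc_inv U \<sigma> f \<noteq> {})"
    unfolding stable_def using 3 by (metis all_not_in_conv)
  then show "locally U (\<lambda>f. assoc_inv U \<sigma> f \<noteq> {})"
  proof (rule locally_mono[OF U assoc_sectionsD(6)[OF \<sigma>]])
    fix f
    assume f: "f \<in> into S U" "\<sigma> f \<noteq> {}"
    then obtain p where p: "p \<in> \<sigma> f"
      by auto
    then have "inv\<^bsub>Grp P (Dom S f)\<^esub> p \<in> assoc_inv U \<sigma> f"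
      using f assoc_sectionsD(2)[OF \<sigma> f(1)] intoD(3)[OF f(1)] by (simp add: assoc_inv_def)
    then show "assoc_inv U \<sigma> f \<noteq> {}"
      by auto
  qed
qed (auto simp: assoc_inv_def)

text \<open>Each law is verified on a covering sieve on which all sections in it are images of
  presheaf sections; there \<open>assoc_mult_unit\<close> turns it into the same law in the groups
  of P.\<close>

lemma assoc_comm_group:
  assumes U: "U \<in> Obj S"
  shows "comm_group (Grp (assoc_sheaf S P) U)"
proof (rule comm_groupI)
  note rep = assoc_locally_represented[OF _ U]
  note sec = assoc_mult_section[OF _ _ U] and usec = assoc_unit_section[OF unit_closed[OF U] U]
  show "one (Grp (assoc_sheaf S P) U) \<in> carrier (Grp (assoc_sheaf S P) U)"
    using usec by (simp add: assoc_sheaf_def)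
  fix \<sigma>
  assume \<sigma>: "\<sigma> \<in> carrier (Grp (assoc_sheaf S P) U)"
  then have \<sigma>: "\<sigma> \<in> assoc_sections S P U"
    by (simp add: assoc_sheaf_def)
  have "assoc_mult S P U (assoc_unit S P U (Unit P U)) \<sigma> = \<sigma>"
    by (rule assoc_eqI[OF sec[OF usec \<sigma>] \<sigma> U rep[OF \<sigma>]])
      (use U intoD in \<open>auto simp: assoc_res_mult assoc_res_unit assoc_mult_unit\<close>)
  then show "monoid.mult (Grp (assoc_sheaf S P) U) (one (Grp (assoc_sheaf S P) U)) \<sigma> = \<sigma>"
    by (simp add: assoc_sheaf_def)
  have "assoc_mult S P U (assoc_inv U \<sigma>) \<sigma> = assoc_unit S P U (Unit P U)"
  \<comment> \<open>On the sieve where \<sigma> has a representative p, the inverse section is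
    represented by the inverse of that same p.\<close>
  proof (rule assoc_eqI[OF sec[OF assoc_inv_section[OF \<sigma> U] \<sigma>] usec U assoc_sectionsD(6)[OF \<sigma>]])
    fix f
    assume f: "f \<in> into S U" "\<sigma> f \<noteq> {}"
    then obtain p where p: "p \<in> \<sigma> f"
      by auto
    have Df: "Dom S f \<in> Obj S"
      using f intoD by blast
    have p': "p \<in> Sec P (Dom S f)"
      using p assoc_sectionsD(2)[OF \<sigma> f(1)] by blast
    have "inv\<^bsub>Grp P (Dom S f)\<^esub> p \<in> assoc_inv U \<sigma> f"
      using f p p' Df by (simp add: assoc_inv_def)
    then have "assoc_res S f (assoc_inv U \<sigma>) = assoc_unit S P (Dom S f) (inv\<^bsub>Grp P (Dom S f)\<^esub> p)"
      using assoc_res_representative[OF assoc_inv_section[OF \<sigma> U] f(1)] by blast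
    then show "assoc_res S f (assoc_mult S P U (assoc_inv U \<sigma>) \<sigma>) = assoc_res S f (assoc_unit S P U (Unit P U))"
      using assoc_res_representative[OF \<sigma> f(1) p] f p' Df U
      by (simp add: assoc_res_mult assoc_res_unit assoc_mult_unit)
  qed
  then show "\<exists>\<tau>\<in>carrier (Grp (assoc_sheaf S P) U). monoid.mult (Grp (assoc_sheaf S P) U) \<tau> \<sigma> = one (Grp (assoc_sheaf S P) U)"
    using assoc_inv_section[OF \<sigma> U] by (auto simp: assoc_sheaf_def)
  fix \<tau>
  assume \<tau>: "\<tau> \<in> carrier (Grp (assoc_sheaf S P) U)"
  then have \<tau>: "\<tau> \<in> assoc_sections S P U"
    by (simp add: assoc_sheaf_def)
  show "monoid.mult (Grp (assoc_sheaf S P) U) \<sigma> \<tau> \<in> carrier (Grp (assoc_sheaf S P) U)"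
    using sec[OF \<sigma> \<tau>] by (simp add: assoc_sheaf_def)
  have "assoc_mult S P U \<sigma> \<tau> = assoc_mult S P U \<tau> \<sigma>"
    by (rule assoc_eqI[OF sec[OF \<sigma> \<tau>] sec[OF \<tau> \<sigma>] U locally_conj[OF U rep[OF \<sigma>] rep[OF \<tau>]]])
      (use intoD mul_comm in \<open>auto simp: assoc_res_mult assoc_mult_unit\<close>)
  then show "monoid.mult (Grp (assoc_sheaf S P) U) \<sigma> \<tau> = monoid.mult (Grp (assoc_sheaf S P) U) \<tau> \<sigma>"
    by (simp add: assoc_sheaf_def)
  fix \<rho>
  assume \<rho>: "\<rho> \<in> carrier (Grp (assoc_sheaf S P) U)"
  then have \<rho>: "\<rho> \<in> assoc_sections S P U"
    by (simp add: assoc_sheaf_def)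
  have "assoc_mult S P U (assoc_mult S P U \<sigma> \<tau>) \<rho> = assoc_mult S P U \<sigma> (assoc_mult S P U \<tau> \<rho>)"
    by (rule assoc_eqI[OF sec[OF sec[OF \<sigma> \<tau>] \<rho>] sec[OF \<sigma> sec[OF \<tau> \<rho>]] U locally_conj[OF U rep[OF \<sigma>] locally_conj[OF U rep[OF \<tau>] rep[OF \<rho>]]]])
      (use intoD in \<open>auto simp: assoc_res_mult assoc_mult_unit mul_assoc\<close>)
  then show "monoid.mult (Grp (assoc_sheaf S P) U) (monoid.mult (Grp (assoc_sheaf S P) U) \<sigma> \<tau>) \<rho> = monoid.mult (Grp (assoc_sheaf S P) U) \<sigma> (monoid.mult (Grp (assoc_sheaf S P) U) \<tau> \<rho>)"
    by (simp add: assoc_sheaf_def)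
qed

lemma is_presheaf_assoc: "is_presheaf S (assoc_sheaf S P)"
  using assoc_res_section assoc_res_ident assoc_res_comp arr_into
  by (auto simp: is_presheaf_def assoc_sheaf_def dest!: arr_into)

lemma is_abelian_sheaf_assoc: "is_abelian_sheaf S (assoc_sheaf S P)"
proof -
  have "is_sheaf S (assoc_sheaf S P)"
    unfolding is_sheaf_def
  proof (intro conjI ballI allI impI is_presheaf_assoc)
    fix U R x
    assume U: "U \<in> Obj S" and R: "R \<in> Cov S U" and x: "\<forall>f\<in>R. x f \<in> Sec (assoc_sheaf S P) (Dom S f)"
      and c: "\<forall>f\<in>R. \<forall>g\<in>into S (Dom S f). x (Comp S f g) = Res (assoc_sheaf S P) g (x f)"
    obtain \<sigma> where \<sigma>: "\<sigma> \<in> assoc_sections S P U" "\<forall>f\<in>R. assoc_res S f \<sigma> = x f"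
      using assoc_glue[OF U R, of x] x c by (auto simp: assoc_sheaf_def)
    show "\<exists>!s. s \<in> Sec (assoc_sheaf S P) U \<and> (\<forall>f\<in>R. Res (assoc_sheaf S P) f s = x f)"
    proof (rule ex1I[of _ \<sigma>])
      fix \<tau>
      assume "\<tau> \<in> Sec (assoc_sheaf S P) U \<and> (\<forall>f\<in>R. Res (assoc_sheaf S P) f \<tau> = x f)"
      then show "\<tau> = \<sigma>"
        using assoc_separated[OF _ \<sigma>(1) U R] \<sigma>(2) by (simp add: assoc_sheaf_def)
    qed (use \<sigma> in \<open>simp add: assoc_sheaf_def\<close>)
  qed
  moreover have "Res (assoc_sheaf S P) f \<in> hom (Grp (assoc_sheaf S P) (Cod S f)) (Grp (assoc_sheaf S P) (Dom S f))"
    if "f \<in> Arr S" for f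
    using arr_into[OF that] by (auto intro!: homI simp: assoc_sheaf_def assoc_res_section assoc_res_mult)
  ultimately show ?thesis
    using assoc_comm_group comm_group.axioms(2) by (auto simp: is_abelian_sheaf_def is_group_sheaf_def)
qed

end

lemma (in grothendieck_site) abelian_presheafI:
  assumes "is_abelian_sheaf S F"
  shows "abelian_presheaf S F"
  using assms by (intro abelian_presheaf.intro presheaf_on.intro presheaf_on_axioms.intro
      abelian_presheaf_axioms.intro grothendieck_site_axioms)
    (auto simp: is_abelian_sheaf_def is_group_sheaf_def is_sheaf_def)

section \<open>Tensor products\<close>

locale group_pair = G: comm_group G + H: comm_group H
  for G :: "('g, 'y) monoid_scheme" (structure) and H :: "('h, 'z) monoid_scheme"
begin

abbreviation F where "F \<equiv> free_Abelian_group (carrier G \<times> carrier H)"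
abbreviation K where "K \<equiv> tensor_kernel G H"

lemma comm_group_F: "comm_group F"
  by (rule abelian_free_Abelian_group)

lemma relations_closed: "tensor_relations G H \<subseteq> carrier F"
proof -
  have 1: "frag_of a - frag_of b - frag_of c \<in> carrier F"
    if "a \<in> carrier G \<times> carrier H" "b \<in> carrier G \<times> carrier H" "c \<in> carrier G \<times> carrier H" for a b c
    using that keys_diff[of "frag_of a - frag_of b" "frag_of c"] keys_diff[of "frag_of a" "frag_of b"] by auto
  show ?thesis
    unfolding tensor_relations_def by (intro subsetI; elim UnE CollectE exE conjE; simp only:; rule 1) simp_all
qed

lemma subgroup_K: "subgroup K F"
  unfolding tensor_kernel_def
  using group.generate_is_subgroup[OF group_free_Abelian_group relations_closed] .

lemma normal_K: "K \<lhd> F"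
  using comm_group.subgroup_imp_normal[OF comm_group_F subgroup_K] .

lemma comm_group_tensor: "comm_group (tensor_group G H)"
  unfolding tensor_group_def using comm_group.abelian_FactGroup[OF comm_group_F subgroup_K] .

lemma tensor_cosetI:
  assumes "x \<in> carrier F"
  shows "K #>\<^bsub>F\<^esub> x \<in> carrier (tensor_group G H)"
  using assms by (auto simp: tensor_group_def FactGroup_def RCOSETS_def)

lemma tensor_cosetE:
  assumes "X \<in> carrier (tensor_group G H)"
  obtains x where "x \<in> carrier F" "X = K #>\<^bsub>F\<^esub> x"
  using assms by (auto simp: tensor_group_def FactGroup_def RCOSETS_def)

lemma tensor_coset_mult:
  assumes "x \<in> carrier F" "y \<in> carrier F"
  shows "(K #>\<^bsub>F\<^esub> x) \<otimes>\<^bsub>tensor_group G H\<^esub> (K #>\<^bsub>F\<^esub> y) = K #>\<^bsub>F\<^esub> (x + y)"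
  using normal.rcos_sum[OF normal_K assms] by (simp add: tensor_group_def FactGroup_def)

lemma tensor_coset_eqI:
  assumes "x \<in> carrier F" "y \<in> carrier F" "x - y \<in> K"
  shows "K #>\<^bsub>F\<^esub> x = K #>\<^bsub>F\<^esub> y"
proof -
  have "x \<in> K #>\<^bsub>F\<^esub> y"
    unfolding r_coset_def using assms(3) by (auto intro!: bexI[of _ "x - y"])
  then show ?thesis
    using group.repr_independence[OF group_free_Abelian_group _ assms(2) subgroup_K] by simp
qed

lemma frag_of_F [simp]: "frag_of (x, y) \<in> carrier F \<longleftrightarrow> x \<in> carrier G \<and> y \<in> carrier H"
  by simp

lemma pure_tensor_closed:
  assumes "x \<in> carrier G" "y \<in> carrier H"
  shows "pure_tensor G H x y \<in> carrier (tensor_group G H)"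
  unfolding pure_tensor_def using assms by (intro tensor_cosetI) simp

lemma F_add: "a \<in> carrier F \<Longrightarrow> b \<in> carrier F \<Longrightarrow> a + b \<in> carrier F"
  using group.is_monoid[OF group_free_Abelian_group, THEN monoid.m_closed, of a _ b] by simp

lemma pure_tensor_left:
  assumes "x \<in> carrier G" "x' \<in> carrier G" "y \<in> carrier H"
  shows "pure_tensor G H (x \<otimes> x') y = pure_tensor G H x y \<otimes>\<^bsub>tensor_group G H\<^esub> pure_tensor G H x' y"
proof -
  have "frag_of (x \<otimes> x', y) - frag_of (x, y) - frag_of (x', y) \<in> K"
    unfolding tensor_kernel_def tensor_relations_def using assms by (intro generate.incl) blast
  then have "K #>\<^bsub>F\<^esub> frag_of (x \<otimes> x', y) = K #>\<^bsub>F\<^esub> (frag_of (x, y) + frag_of (x', y))"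
    using assms by (intro tensor_coset_eqI F_add) (simp_all only: frag_of_F G.m_closed diff_diff_eq)
  then show ?thesis
    unfolding pure_tensor_def using assms by (subst tensor_coset_mult) (simp_all only: frag_of_F)
qed

lemma pure_tensor_right:
  assumes "x \<in> carrier G" "y \<in> carrier H" "y' \<in> carrier H"
  shows "pure_tensor G H x (y \<otimes>\<^bsub>H\<^esub> y') = pure_tensor G H x y \<otimes>\<^bsub>tensor_group G H\<^esub> pure_tensor G H x y'"
proof -
  have "frag_of (x, y \<otimes>\<^bsub>H\<^esub> y') - frag_of (x, y) - frag_of (x, y') \<in> K"
    unfolding tensor_kernel_def tensor_relations_def using assms by (intro generate.incl) blast
  then have "K #>\<^bsub>F\<^esub> frag_of (x, y \<otimes>\<^bsub>H\<^esub> y') = K #>\<^bsub>F\<^esub> (frag_of (x, y) + frag_of (x, y'))"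
    using assms by (intro tensor_coset_eqI F_add) (simp_all only: frag_of_F H.m_closed diff_diff_eq)
  then show ?thesis
    unfolding pure_tensor_def using assms by (subst tensor_coset_mult) (simp_all only: frag_of_F)
qed

end

section \<open>Functoriality of the tensor product of groups\<close>

locale group_pair_hom = A: group_pair G H + B: group_pair G' H'
  for G :: "('g, 'y) monoid_scheme" and H :: "('h, 'z) monoid_scheme"
    and G' :: "('k, 'v) monoid_scheme" and H' :: "('l, 'w) monoid_scheme" +
  fixes f g
  assumes f: "f \<in> hom G G'" and g: "g \<in> hom H H'"
begin

text \<open>The lift of f \<otimes> g to the free groups, from which the map on cosets is
  induced.\<close>

definition \<phi> where "\<phi> = frag_extend (\<lambda>(x, y). frag_of (f x, g y))"

lemma \<phi>_add: "\<phi> (x + y) = \<phi> x + \<phi> y"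
  by (simp add: \<phi>_def frag_extend_add)

lemma \<phi>_diff: "\<phi> (x - y) = \<phi> x - \<phi> y"
  by (simp add: \<phi>_def frag_extend_diff)

lemma \<phi>_of: "\<phi> (frag_of (x, y)) = frag_of (f x, g y)"
  by (simp add: \<phi>_def)

lemma \<phi>_closed:
  assumes "x \<in> carrier A.F"
  shows "\<phi> x \<in> carrier B.F"
proof -
  have "Poly_Mapping.keys (\<phi> x) \<subseteq> (\<Union>z\<in>Poly_Mapping.keys x. Poly_Mapping.keys (case z of (x, y) \<Rightarrow> frag_of (f x, g y)))"
    unfolding \<phi>_def by (rule keys_frag_extend)
  also have "\<dots> \<subseteq> carrier G' \<times> carrier H'"
    using assms hom_in_carrier[OF f] hom_in_carrier[OF g] by auto
  finally show ?thesis
    by simp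
qed

lemma \<phi>_relations:
  assumes "h \<in> tensor_relations G H"
  shows "\<phi> h \<in> tensor_relations G' H'"
proof -
  consider (left) x x' y where "h = frag_of (x \<otimes>\<^bsub>G\<^esub> x', y) - frag_of (x, y) - frag_of (x', y)"
      "x \<in> carrier G" "x' \<in> carrier G" "y \<in> carrier H"
    | (right) x y y' where "h = frag_of (x, y \<otimes>\<^bsub>H\<^esub> y') - frag_of (x, y) - frag_of (x, y')"
      "x \<in> carrier G" "y \<in> carrier H" "y' \<in> carrier H"
    using assms unfolding tensor_relations_def by blast
  then show ?thesis
  proof cases
    case left
    have "\<phi> h = frag_of (f x \<otimes>\<^bsub>G'\<^esub> f x', g y) - frag_of (f x, g y) - frag_of (f x', g y)"
      using left hom_mult[OF f] by (simp add: \<phi>_diff \<phi>_of)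
    then show ?thesis
      unfolding tensor_relations_def using left hom_in_carrier[OF f] hom_in_carrier[OF g] by blast
  next
    case right
    have "\<phi> h = frag_of (f x, g y \<otimes>\<^bsub>H'\<^esub> g y') - frag_of (f x, g y) - frag_of (f x, g y')"
      using right hom_mult[OF g] by (simp add: \<phi>_diff \<phi>_of)
    then show ?thesis
      unfolding tensor_relations_def using right hom_in_carrier[OF f] hom_in_carrier[OF g] by blast
  qed
qed

text \<open>Since f and g are homomorphisms, generating relations go to generating relations; the
  induction over the generated subgroup does the rest.\<close>

lemma \<phi>_kernel:
  assumes "x \<in> A.K"
  shows "\<phi> x \<in> B.K"
  using assms unfolding tensor_kernel_def
proof (induction rule: generate.induct)
  case one
  then show ?case
    using generate.one[of B.F] by (simp add: \<phi>_def)
next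
  note * = \<phi>_relations
  case (incl h)
  then show ?case
    using * by (auto intro: generate.incl)
  case (inv h)
  \<comment> \<open>Inversion in the free abelian group is computed as negation for elements of its
    carrier, hence the appeal to \<open>relations_closed\<close>.\<close>
  have "inv\<^bsub>A.F\<^esub> h = - h"
    using inv A.relations_closed by auto
  moreover have "inv\<^bsub>B.F\<^esub> (\<phi> h) = - \<phi> h"
    using *[OF inv] B.relations_closed by auto
  ultimately show ?case
    using generate.inv[OF *[OF inv], of B.F] by (simp add: \<phi>_def frag_extend_minus)
next
  case (eng h1 h2)
  then show ?case
    using generate.eng[OF eng(3,4)] by (simp add: \<phi>_add)
qed

text \<open>The image of a coset under \<phi> may be a proper part of a coset, and
  \<open>tensor_map\<close> fills it up by adding the target kernel. As \<phi> maps kernel to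
  kernel, the sum is the single coset of \<phi> x.\<close>

lemma tensor_map_coset:
  assumes "x \<in> carrier A.F"
  shows "tensor_map G' H' f g (A.K #>\<^bsub>A.F\<^esub> x) = B.K #>\<^bsub>B.F\<^esub> \<phi> x"
proof -
  have "tensor_map G' H' f g (A.K #>\<^bsub>A.F\<^esub> x) = {k' + \<phi> (k + x) | k' k. k' \<in> B.K \<and> k \<in> A.K}"
    unfolding tensor_map_def \<phi>_def[symmetric] by (auto simp: set_mult_def r_coset_def)
  also have "\<dots> = {k' + \<phi> x | k'. k' \<in> B.K}"
  proof safe
    fix k' k
    assume k: "k' \<in> B.K" "k \<in> A.K"
    have "k' + \<phi> k \<in> B.K"
      using subgroup.m_closed[OF B.subgroup_K k(1) \<phi>_kernel[OF k(2)]] by simp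
    then show "\<exists>l. k' + \<phi> (k + x) = l + \<phi> x \<and> l \<in> B.K"
      by (auto simp: \<phi>_add add.assoc[symmetric])
  next
    fix k'
    assume "k' \<in> B.K"
    moreover have "0 \<in> A.K"
      using subgroup.one_closed[OF A.subgroup_K] by simp
    ultimately show "\<exists>l k. k' + \<phi> x = l + \<phi> (k + x) \<and> l \<in> B.K \<and> k \<in> A.K"
      by (metis add_0)
  qed
  finally show ?thesis
    by (auto simp: r_coset_def)
qed

lemma tensor_map_hom: "tensor_map G' H' f g \<in> hom (tensor_group G H) (tensor_group G' H')"
proof (rule homI)
  fix X Y
  assume "X \<in> carrier (tensor_group G H)" "Y \<in> carrier (tensor_group G H)"
  then obtain x y where x: "x \<in> carrier A.F" "X = A.K #>\<^bsub>A.F\<^esub> x" and y: "y \<in> carrier A.F" "Y = A.K #>\<^bsub>A.F\<^esub> y"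
    by (elim A.tensor_cosetE)
  show "tensor_map G' H' f g X \<in> carrier (tensor_group G' H')"
    unfolding x(2) tensor_map_coset[OF x(1)] by (rule B.tensor_cosetI[OF \<phi>_closed[OF x(1)]])
  show "tensor_map G' H' f g (X \<otimes>\<^bsub>tensor_group G H\<^esub> Y)
      = tensor_map G' H' f g X \<otimes>\<^bsub>tensor_group G' H'\<^esub> tensor_map G' H' f g Y"
    unfolding x(2) y(2)
    by (simp only: A.tensor_coset_mult[OF x(1) y(1)] tensor_map_coset[OF x(1)] tensor_map_coset[OF y(1)]
        B.tensor_coset_mult[OF \<phi>_closed[OF x(1)] \<phi>_closed[OF y(1)]]
        tensor_map_coset[OF A.F_add[OF x(1) y(1)]] \<phi>_add)
qed

lemma tensor_map_pure:
  assumes "x \<in> carrier G" "y \<in> carrier H"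
  shows "tensor_map G' H' f g (pure_tensor G H x y) = pure_tensor G' H' (f x) (g y)"
  unfolding pure_tensor_def using assms by (subst tensor_map_coset) (simp_all add: \<phi>_of)

end

lemma (in grothendieck_site) abelian_presheaf_tensor:
  assumes "abelian_presheaf S M" "abelian_presheaf S N"
  shows "abelian_presheaf S (tensor_presheaf S M N)"
proof -
  interpret M: abelian_presheaf S M by fact
  interpret N: abelian_presheaf S N by fact
  let ?T = "\<lambda>U. tensor_group (Grp M U) (Grp N U)"
  let ?r = "\<lambda>f. tensor_map (Grp M (Dom S f)) (Grp N (Dom S f)) (Res M f) (Res N f)"
  have pair: "group_pair (Grp M U) (Grp N U)" if "U \<in> Obj S" for U
    using M.comm[OF that] N.comm[OF that] by (simp add: group_pair_def)
  have ph: "group_pair_hom (Grp M U) (Grp N U) (Grp M (Dom S f)) (Grp N (Dom S f)) (Res M f) (Res N f)"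
    if "f \<in> into S U" for f U
    using that pair intoD[OF that] M.res_hom[of f] N.res_hom[of f]
    by (auto simp: group_pair_hom_def group_pair_hom_axioms_def)
  have hom: "?r f \<in> hom (?T U) (?T (Dom S f))" if "f \<in> into S U" for f U
    using group_pair_hom.tensor_map_hom[OF ph[OF that]] .
  have "is_presheaf S (tensor_presheaf S M N)"
    unfolding is_presheaf_def
  proof (intro conjI ballI)
    fix f X
    assume "f \<in> Arr S" "X \<in> Sec (tensor_presheaf S M N) (Cod S f)"
    then show "Res (tensor_presheaf S M N) f X \<in> Sec (tensor_presheaf S M N) (Dom S f)"
      using hom_in_carrier[OF hom[OF arr_into]] by (simp add: tensor_presheaf_def)
  next
    fix U X
    assume U: "U \<in> Obj S" and X: "X \<in> Sec (tensor_presheaf S M N) U"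
    interpret group_pair_hom "Grp M U" "Grp N U" "Grp M U" "Grp N U" "Res M (Ident S U)" "Res N (Ident S U)"
      using ph[of "Ident S U" U] U by simp
    obtain x where x: "x \<in> carrier A.F" "X = A.K #>\<^bsub>A.F\<^esub> x"
      using X A.tensor_cosetE[of X] by (auto simp: tensor_presheaf_def)
    \<comment> \<open>Restriction along the identity fixes the generators that occur in x, and the
      linear extension of \<open>frag_of\<close> is the identity.\<close>
    have "\<phi> x = frag_extend frag_of x"
      unfolding \<phi>_def by (rule frag_extend_eq) (use x U in auto)
    then have "\<phi> x = x"
      using frag_expansion[of x] by simp
    then show "Res (tensor_presheaf S M N) (Ident S U) X = X"
      using tensor_map_coset[OF x(1)] x U by (simp add: tensor_presheaf_def)
  next
    fix f h X
    assume f: "f \<in> Arr S" and h: "h \<in> into S (Dom S f)" and X: "X \<in> Sec (tensor_presheaf S M N) (Cod S f)"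
    let ?U = "Cod S f"
    note f = arr_into[OF f]
    interpret A: group_pair_hom "Grp M ?U" "Grp N ?U" "Grp M (Dom S f)" "Grp N (Dom S f)" "Res M f" "Res N f"
      using ph[OF f] .
    interpret B: group_pair_hom "Grp M (Dom S f)" "Grp N (Dom S f)" "Grp M (Dom S h)" "Grp N (Dom S h)" "Res M h" "Res N h"
      using ph[OF h] .
    interpret C: group_pair_hom "Grp M ?U" "Grp N ?U" "Grp M (Dom S h)" "Grp N (Dom S h)" "Res M (Comp S f h)" "Res N (Comp S f h)"
      using ph[of "Comp S f h" ?U] f h by simp
    obtain x where x: "x \<in> carrier A.A.F" "X = A.A.K #>\<^bsub>A.A.F\<^esub> x"
      using X A.A.tensor_cosetE[of X] by (auto simp: tensor_presheaf_def)
    have "Poly_Mapping.keys x \<subseteq> Sec M ?U \<times> Sec N ?U"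
      using x by simp
    \<comment> \<open>Both sides are additive in x and agree on generators by functoriality of M and
      N.\<close>
    then have "C.\<phi> x = B.\<phi> (A.\<phi> x)"
    proof (induction x rule: frag_induction)
      case (one z)
      then show ?case
        using f h by (cases z) (simp add: A.\<phi>_of B.\<phi>_of C.\<phi>_of M.res_comp N.res_comp)
    qed (simp_all add: A.\<phi>_diff B.\<phi>_diff C.\<phi>_diff, simp add: A.\<phi>_def B.\<phi>_def C.\<phi>_def)
    then show "Res (tensor_presheaf S M N) (Comp S f h) X = Res (tensor_presheaf S M N) h (Res (tensor_presheaf S M N) f X)"
      using C.tensor_map_coset[OF x(1)] A.tensor_map_coset[OF x(1)] B.tensor_map_coset[OF A.\<phi>_closed[OF x(1)]] x(2) f h
      by (simp add: tensor_presheaf_def)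
  qed
  moreover have "comm_group (Grp (tensor_presheaf S M N) U)" if "U \<in> Obj S" for U
  proof -
    have "Grp (tensor_presheaf S M N) U = ?T U"
      by (simp add: tensor_presheaf_def tensor_group_def FactGroup_def)
    then show ?thesis
      using group_pair.comm_group_tensor[OF pair[OF that]] by simp
  qed
  moreover have "Res (tensor_presheaf S M N) f \<in> hom (Grp (tensor_presheaf S M N) (Cod S f)) (Grp (tensor_presheaf S M N) (Dom S f))"
    if "f \<in> Arr S" for f
    using hom[OF arr_into[OF that]] by (simp add: tensor_presheaf_def hom_def)
  ultimately show ?thesis
    by (intro abelian_presheaf.intro presheaf_on.intro presheaf_on_axioms.intro
        abelian_presheaf_axioms.intro grothendieck_site_axioms)
qed

section \<open>The tensor sheaf and its universal bilinear map\<close>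

locale presheaf_pair = grothendieck_site S + M: abelian_presheaf S M + N: abelian_presheaf S N
  for S :: "('o, 'a) site" and M :: "('o, 'a, 'm) group_presheaf" and N :: "('o, 'a, 'n) group_presheaf"
begin

abbreviation T where "T \<equiv> tensor_sheaf S M N"

sublocale TP: abelian_presheaf S "tensor_presheaf S M N"
  by (intro abelian_presheaf_tensor M.abelian_presheaf_axioms N.abelian_presheaf_axioms)

lemma is_abelian_sheaf_tensor: "is_abelian_sheaf S T"
  unfolding tensor_sheaf_def by (rule TP.is_abelian_sheaf_assoc)

lemma pair: "U \<in> Obj S \<Longrightarrow> group_pair (Grp M U) (Grp N U)"
  using M.comm N.comm by (simp add: group_pair_def)

sublocale T: abelian_presheaf S T
  by (rule abelian_presheafI[OF is_abelian_sheaf_tensor])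

lemma pure_closed:
  assumes "U \<in> Obj S" "m \<in> Sec M U" "n \<in> Sec N U"
  shows "pure_tensor (Grp M U) (Grp N U) m n \<in> Sec (tensor_presheaf S M N) U"
  using group_pair.pure_tensor_closed[OF pair] assms by (simp add: tensor_presheaf_def)

lemma tensor_closed [simp]:
  assumes "U \<in> Obj S" "m \<in> Sec M U" "n \<in> Sec N U"
  shows "tensor S M N U m n \<in> Sec T U"
  using TP.assoc_unit_section[OF pure_closed[OF assms] assms(1)]
  by (simp add: tensor_sheaf_def assoc_sheaf_def tensor_def)

text \<open>Bilinearity holds for pure tensors in the presheaf, and the map to the associated sheaf
  is multiplicative by \<open>assoc_mult_unit\<close>.\<close>

lemma tensor_left:
  assumes "U \<in> Obj S" "m \<in> Sec M U" "m' \<in> Sec M U" "n \<in> Sec N U"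
  shows "tensor S M N U (Mul M U m m') n = Mul T U (tensor S M N U m n) (tensor S M N U m' n)"
  using group_pair.pure_tensor_left[OF pair[OF assms(1)], of m m' n] assms
    TP.assoc_mult_unit[OF pure_closed[OF assms(1,2,4)] pure_closed[OF assms(1,3,4)] assms(1)]
  by (simp add: tensor_sheaf_def assoc_sheaf_def tensor_def tensor_presheaf_def)

lemma tensor_right:
  assumes "U \<in> Obj S" "m \<in> Sec M U" "n \<in> Sec N U" "n' \<in> Sec N U"
  shows "tensor S M N U m (Mul N U n n') = Mul T U (tensor S M N U m n) (tensor S M N U m n')"
  using group_pair.pure_tensor_right[OF pair[OF assms(1)], of m n n'] assms
    TP.assoc_mult_unit[OF pure_closed[OF assms(1,2,3)] pure_closed[OF assms(1,2,4)] assms(1)]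
  by (simp add: tensor_sheaf_def assoc_sheaf_def tensor_def tensor_presheaf_def)

lemma tensor_res [simp]:
  assumes "f \<in> into S U" "m \<in> Sec M U" "n \<in> Sec N U"
  shows "Res T f (tensor S M N U m n) = tensor S M N (Dom S f) (Res M f m) (Res N f n)"
proof -
  have "group_pair_hom (Grp M U) (Grp N U) (Grp M (Dom S f)) (Grp N (Dom S f)) (Res M f) (Res N f)"
    using pair intoD[OF assms(1)] M.res_hom[of f] N.res_hom[of f]
    by (auto simp: group_pair_hom_def group_pair_hom_axioms_def)
  then have "Res (tensor_presheaf S M N) f (pure_tensor (Grp M U) (Grp N U) m n)
      = pure_tensor (Grp M (Dom S f)) (Grp N (Dom S f)) (Res M f m) (Res N f n)"
    using group_pair_hom.tensor_map_pure[of "Grp M U" "Grp N U"] assms by (simp add: tensor_presheaf_def)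
  then show ?thesis
    using TP.assoc_res_unit[OF pure_closed assms(1)] assms intoD[OF assms(1)]
    by (simp add: tensor_sheaf_def assoc_sheaf_def tensor_def)
qed

text \<open>By additivity in the left argument this value equals its own square, and in a group that
  forces it to be the unit.\<close>

lemma tensor_unit_left [simp]:
  assumes "U \<in> Obj S" "n \<in> Sec N U"
  shows "tensor S M N U (Unit M U) n = Unit T U"
  using tensor_left[of U "Unit M U" "Unit M U" n] assms T.mul_idem by simp

lemma tensor_unit_right [simp]:
  assumes "U \<in> Obj S" "m \<in> Sec M U"
  shows "tensor S M N U m (Unit N U) = Unit T U"
  using tensor_right[of U m "Unit N U" "Unit N U"] assms T.mul_idem by simp

lemma tensor_inv_left [simp]:
  assumes "U \<in> Obj S" "m \<in> Sec M U" "n \<in> Sec N U"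
  shows "tensor S M N U (inv\<^bsub>Grp M U\<^esub> m) n = inv\<^bsub>Grp T U\<^esub> (tensor S M N U m n)"
  using tensor_left[of U "inv\<^bsub>Grp M U\<^esub> m" m n] assms by (intro T.inv_unique) simp_all

lemma tensor_inv_right [simp]:
  assumes "U \<in> Obj S" "m \<in> Sec M U" "n \<in> Sec N U"
  shows "tensor S M N U m (inv\<^bsub>Grp N U\<^esub> n) = inv\<^bsub>Grp T U\<^esub> (tensor S M N U m n)"
  using tensor_right[of U m "inv\<^bsub>Grp N U\<^esub> n" n] assms by (intro T.inv_unique) simp_all

end

section \<open>The extension\<close>

locale abelian_sheaf_on = grothendieck_site S
  for S :: "('o, 'a) site" +
  fixes M :: "('o, 'a, 'm) group_presheaf"
  assumes abelian_sheaf: "is_abelian_sheaf S M"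
begin

sublocale M: abelian_presheaf S M
  by (rule abelian_presheafI[OF abelian_sheaf])

sublocale presheaf_pair S M M
  by unfold_locales

abbreviation U_M where "U_M \<equiv> U_sheaf S M"

abbreviation tens where "tens \<equiv> tensor S M M"

text \<open>With degree 0 parts equal to 1, the powers in the ring product are first powers; what
  remains is a reordering in commutative groups.\<close>

lemma trunc_mult:
  assumes "U \<in> Obj S" "m \<in> Sec M U" "m' \<in> Sec M U" "t \<in> Sec T U" "t' \<in> Sec T U"
  shows "(1, m, t) \<otimes>\<^bsub>trunc_tensor_ring S M U\<^esub> (1, m', t')
    = (1, Mul M U m m', Mul T U (Mul T U t t') (tens U m m'))"
proof -
  interpret gM: comm_group "Grp M U"
    by (rule M.comm[OF assms(1)])
  interpret gT: comm_group "Grp T U"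
    by (rule T.comm[OF assms(1)])
  show ?thesis
    using assms gM.int_pow_1[of m] gM.int_pow_1[of m'] gT.int_pow_1[of t] gT.int_pow_1[of t']
    by (simp add: trunc_tensor_ring_def Let_def M.mul_ac T.mul_ac)
qed

lemma trunc_carrier [simp]: "carrier (trunc_tensor_ring S M U) = UNIV \<times> Sec M U \<times> Sec T U"
  "one (trunc_tensor_ring S M U) = (1, Unit M U, Unit T U)"
  by (simp_all add: trunc_tensor_ring_def Let_def)

text \<open>The unit condition is satisfied by every 1 + m + t, because m + t is nilpotent in the
  truncated algebra.\<close>

lemma Sec_U_M:
  assumes U: "U \<in> Obj S"
  shows "Sec U_M U = {1} \<times> Sec M U \<times> Sec T U"
proof -
  have "(1, m, t) \<in> Units (trunc_tensor_ring S M U)" if "m \<in> Sec M U" "t \<in> Sec T U" for m t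
  proof -
    \<comment> \<open>The geometric series 1 - (m + t) + (m + t)^2, cut off above degree 2: the
      inverse of 1 + m + t is 1 - m + (m \<otimes> m - t).\<close>
    let ?y = "(1, inv\<^bsub>Grp M U\<^esub> m, Mul T U (inv\<^bsub>Grp T U\<^esub> t) (tens U m m))"
    have "?y \<otimes>\<^bsub>trunc_tensor_ring S M U\<^esub> (1, m, t) = one (trunc_tensor_ring S M U)"
      "(1, m, t) \<otimes>\<^bsub>trunc_tensor_ring S M U\<^esub> ?y = one (trunc_tensor_ring S M U)"
      using U that by (simp_all add: trunc_mult T.mul_ac T.mul_inv_cancel T.mul_inv_cancel_left)
    then show ?thesis
      unfolding Units_def using U that by (intro CollectI conjI bexI[of _ ?y]) simp_all
  qed
  moreover have "Units (trunc_tensor_ring S M U) \<subseteq> UNIV \<times> Sec M U \<times> Sec T U"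
    by (auto simp: Units_def)
  ultimately show ?thesis
    unfolding U_sheaf_def by (auto simp: kernel_def units_of_def)
qed

lemma Mul_U_M:
  assumes "U \<in> Obj S" "m \<in> Sec M U" "m' \<in> Sec M U" "t \<in> Sec T U" "t' \<in> Sec T U"
  shows "Mul U_M U (1, m, t) (1, m', t') = (1, Mul M U m m', Mul T U (Mul T U t t') (tens U m m'))"
  using trunc_mult[OF assms] by (simp add: U_sheaf_def units_of_def)

lemma Unit_U_M: "Unit U_M U = (1, Unit M U, Unit T U)"
  by (simp add: U_sheaf_def units_of_def)

lemma Res_U_M: "Res U_M f (k, m, t) = (k, Res M f m, Res T f t)"
  by (simp add: U_sheaf_def)

lemma group_U_M:
  assumes U: "U \<in> Obj S"
  shows "group (Grp U_M U)"
proof (rule groupI)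
  fix b
  assume "b \<in> carrier (Grp U_M U)"
  then obtain m t where b: "b = (1, m, t)" "m \<in> Sec M U" "t \<in> Sec T U"
    using Sec_U_M[OF U] by auto
  show "\<one>\<^bsub>Grp U_M U\<^esub> \<otimes>\<^bsub>Grp U_M U\<^esub> b = b"
    using b U by (simp add: Unit_U_M Mul_U_M)
  have "(1, inv\<^bsub>Grp M U\<^esub> m, Mul T U (inv\<^bsub>Grp T U\<^esub> t) (tens U m m)) \<otimes>\<^bsub>Grp U_M U\<^esub> b = \<one>\<^bsub>Grp U_M U\<^esub>"
    using b U by (simp add: Unit_U_M Mul_U_M T.mul_ac T.mul_inv_cancel T.mul_inv_cancel_left)
  then show "\<exists>b'\<in>carrier (Grp U_M U). b' \<otimes>\<^bsub>Grp U_M U\<^esub> b = \<one>\<^bsub>Grp U_M U\<^esub>"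
    by (rule bexI) (use b U in \<open>simp add: Sec_U_M\<close>)
qed (use U in \<open>auto simp: Sec_U_M Mul_U_M Unit_U_M M.mul_ac T.mul_ac tensor_left tensor_right\<close>)

section \<open>The sheaf property of UM\<close>

lemma sheaf_glue:
  assumes "is_sheaf S F" "U \<in> Obj S" "R \<in> Cov S U"
    and "\<And>f. f \<in> R \<Longrightarrow> x f \<in> Sec F (Dom S f)"
    and "\<And>f g. f \<in> R \<Longrightarrow> g \<in> into S (Dom S f) \<Longrightarrow> x (Comp S f g) = Res F g (x f)"
  obtains s where "s \<in> Sec F U" "\<And>f. f \<in> R \<Longrightarrow> Res F f s = x f"
  using assms unfolding is_sheaf_def by metis

text \<open>The uniqueness part of the sheaf condition, applied to the family of restrictions of s,
  which is compatible by functoriality.\<close>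

lemma sheaf_separated:
  assumes F: "is_sheaf S F" and U: "U \<in> Obj S" and R: "R \<in> Cov S U" and s: "s \<in> Sec F U" "s' \<in> Sec F U"
    and eq: "\<And>f. f \<in> R \<Longrightarrow> Res F f s = Res F f s'"
  shows "s = s'"
proof -
  interpret presheaf_on S F
    using F by unfold_locales (simp add: is_sheaf_def)
  have glue: "\<exists>!t. t \<in> Sec F U \<and> (\<forall>f\<in>R. Res F f t = x f)"
    if "\<forall>f\<in>R. x f \<in> Sec F (Dom S f)" "\<forall>f\<in>R. \<forall>g\<in>into S (Dom S f). x (Comp S f g) = Res F g (x f)" for x
    using F U R that unfolding is_sheaf_def by blast
  have "\<exists>!t. t \<in> Sec F U \<and> (\<forall>f\<in>R. Res F f t = Res F f s)"
    by (rule glue) (use s(1) cov_into[OF R U] res_closed res_comp in blast)+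
  then show ?thesis
    using s eq by (metis (no_types))
qed

lemma is_sheaf_M: "is_sheaf S M"
  using abelian_sheaf by (simp add: is_abelian_sheaf_def is_group_sheaf_def)

lemma is_sheaf_T: "is_sheaf S T"
  using is_abelian_sheaf_tensor by (simp add: is_abelian_sheaf_def is_group_sheaf_def)

lemma is_presheaf_U_M: "is_presheaf S U_M"
  unfolding is_presheaf_def
proof (intro conjI ballI)
  fix f s
  assume f: "f \<in> Arr S" and "s \<in> Sec U_M (Cod S f)"
  moreover note i = intoD[OF arr_into[OF f]]
  ultimately obtain m t where s: "s = (1, m, t)" "m \<in> Sec M (Cod S f)" "t \<in> Sec T (Cod S f)"
    by (auto simp: Sec_U_M)
  then show "Res U_M f s \<in> Sec U_M (Dom S f)"
    using i M.res_closed[OF arr_into[OF f]] T.res_closed[OF arr_into[OF f]] by (simp add: Sec_U_M Res_U_M)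
  fix g
  assume "g \<in> into S (Dom S f)"
  then show "Res U_M (Comp S f g) s = Res U_M g (Res U_M f s)"
    using s M.res_comp[OF arr_into[OF f]] T.res_comp[OF arr_into[OF f]] by (simp add: Res_U_M)
qed (auto simp: Sec_U_M Res_U_M)

text \<open>As a sheaf of sets UM is the product of M and M \<otimes> M, since the degree 0
  component is constantly 1 and restriction is componentwise. So gluing and uniqueness are
  componentwise too.\<close>

lemma is_sheaf_U_M: "is_sheaf S U_M"
  unfolding is_sheaf_def
proof (intro conjI ballI allI impI is_presheaf_U_M)
  fix U R x
  assume U: "U \<in> Obj S" and R: "R \<in> Cov S U" and x: "\<forall>f\<in>R. x f \<in> Sec U_M (Dom S f)"
    and c: "\<forall>f\<in>R. \<forall>g\<in>into S (Dom S f). x (Comp S f g) = Res U_M g (x f)"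
  let ?m = "\<lambda>f. fst (snd (x f))" and ?t = "\<lambda>f. snd (snd (x f))"
  have x': "x f = (1, ?m f, ?t f) \<and> ?m f \<in> Sec M (Dom S f) \<and> ?t f \<in> Sec T (Dom S f)" if "f \<in> R" for f
    using bspec[OF x that] intoD[OF cov_into[OF R U that]] by (simp add: Sec_U_M mem_Times_iff prod_eq_iff)
  have c': "x (Comp S f g) = (1, Res M g (?m f), Res T g (?t f))" if "f \<in> R" "g \<in> into S (Dom S f)" for f g
    using c that x'[OF that(1)] by (metis Res_U_M)
  obtain m where m: "m \<in> Sec M U" "\<And>f. f \<in> R \<Longrightarrow> Res M f m = ?m f"
    by (rule sheaf_glue[OF is_sheaf_M U R, of ?m]) (use x' c' in auto)
  obtain t where t: "t \<in> Sec T U" "\<And>f. f \<in> R \<Longrightarrow> Res T f t = ?t f"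
    by (rule sheaf_glue[OF is_sheaf_T U R, of ?t]) (use x' c' in auto)
  show "\<exists>!s. s \<in> Sec U_M U \<and> (\<forall>f\<in>R. Res U_M f s = x f)"
  proof (rule ex1I[of _ "(1, m, t)"])
    show "(1, m, t) \<in> Sec U_M U \<and> (\<forall>f\<in>R. Res U_M f (1, m, t) = x f)"
      using m t U x' by (simp add: Sec_U_M Res_U_M)
    fix s
    assume s: "s \<in> Sec U_M U \<and> (\<forall>f\<in>R. Res U_M f s = x f)"
    then obtain m' t' where s': "s = (1, m', t')" "m' \<in> Sec M U" "t' \<in> Sec T U"
      using U by (auto simp: Sec_U_M)
    have r: "Res M f m' = ?m f \<and> Res T f t' = ?t f" if "f \<in> R" for f
      using s that by (metis Res_U_M s'(1) fst_conv snd_conv)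
    have "m' = m" "t' = t"
      by (rule sheaf_separated[OF is_sheaf_M U R], use s' m r in auto)
        (rule sheaf_separated[OF is_sheaf_T U R], use s' t r in auto)
    then show "s = (1, m, t)"
      using s' by simp
  qed
qed

lemma is_group_sheaf_U_M: "is_group_sheaf S U_M"
  unfolding is_group_sheaf_def
proof (intro conjI ballI is_sheaf_U_M group_U_M)
  fix f
  assume "f \<in> Arr S"
  then have f: "f \<in> into S (Cod S f)"
    by (rule arr_into)
  show "Res U_M f \<in> hom (Grp U_M (Cod S f)) (Grp U_M (Dom S f))"
    by (rule homI) (use f intoD[OF f] in \<open>auto simp: Sec_U_M Res_U_M Mul_U_M\<close>)
qed

section \<open>The exact sequence and the obstruction of its lifts\<close>

lemma U_incl_hom: "group_sheaf_hom S T U_M (U_incl M)"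
  unfolding group_sheaf_hom_def presheaf_map_def
proof (intro conjI ballI)
  show "U_incl M (Dom S f) (Res T f t) = Res U_M f (U_incl M (Cod S f) t)" if "f \<in> Arr S" for f t
    using M.res_unit[OF arr_into[OF that]] by (simp add: U_incl_def Res_U_M)
  show "U_incl M U \<in> hom (Grp T U) (Grp U_M U)" if "U \<in> Obj S" for U
    by (rule homI) (use that in \<open>auto simp: U_incl_def Sec_U_M Mul_U_M\<close>)
qed (auto simp: U_incl_def Sec_U_M)

lemma U_proj_hom: "group_sheaf_hom S U_M M U_proj"
  unfolding group_sheaf_hom_def presheaf_map_def
proof (intro conjI ballI)
  show "U_proj (Dom S f) (Res U_M f s) = Res M f (U_proj (Cod S f) s)" for f s
    by (cases s) (simp add: U_proj_def Res_U_M)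
  show "U_proj U \<in> hom (Grp U_M U) (Grp M U)" if "U \<in> Obj S" for U
    by (rule homI) (use that in \<open>auto simp: U_proj_def Sec_U_M Mul_U_M\<close>)
qed (auto simp: U_proj_def Sec_U_M)

text \<open>Handles images whose preimages exist along every arrow, as for the inclusion and
  projection of UM and for the augmentation.\<close>

lemma in_image_sheafI:
  assumes "U \<in> Obj S" "\<And>f. f \<in> into S U \<Longrightarrow> \<exists>x\<in>Sec F (Dom S f). \<phi> (Dom S f) x = Res G f y"
  shows "in_image_sheaf S F G \<phi> U y"
  using locally_all[OF assms] by (simp add: in_image_sheaf_def locally_def)

lemma central_extension_U_M: "central_extension S T U_M M (U_incl M) U_proj"
proof -
  have "exact_at S T U_M M (U_incl M) U_proj"
    unfolding exact_at_def
  proof (intro ballI iffI)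
    fix U y
    assume U: "U \<in> Obj S" and "y \<in> Sec U_M U"
    then obtain m t where y: "y = (1, m, t)" "m \<in> Sec M U" "t \<in> Sec T U"
      by (auto simp: Sec_U_M)
    {
      assume "U_proj U y = Unit M U"
      then show "in_image_sheaf S T U_M (U_incl M) U y"
        using y U by (intro in_image_sheafI) (auto simp: U_proj_def U_incl_def Res_U_M intro: bexI[of _ "Res T f t" for f])
    next
      assume "in_image_sheaf S T U_M (U_incl M) U y"
      \<comment> \<open>On the sieve where y comes from M \<otimes> M its degree 1 part restricts to
        the unit, and M is separated.\<close>
      then have "m = Unit M U"
        unfolding in_image_sheaf_def
        by (rule sheaf_separated[OF is_sheaf_M U]) (use y U in \<open>auto simp: U_incl_def Res_U_M\<close>)
      then show "U_proj U y = Unit M U"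
        using y by (simp add: U_proj_def)
    }
  qed
  moreover have "in_image_sheaf S U_M M U_proj U y" if "U \<in> Obj S" "y \<in> Sec M U" for U y
  proof (rule in_image_sheafI[OF that(1)])
    \<comment> \<open>The set-theoretic section y \<mapsto> 1 + y provides the lift.\<close>
    show "\<exists>b\<in>Sec U_M (Dom S f). U_proj (Dom S f) b = Res M f y" if f: "f \<in> into S U" for f
      using \<open>y \<in> Sec M U\<close> f intoD[OF f]
      by (intro bexI[of _ "(1, Res M f y, Unit T (Dom S f))"]) (simp_all add: U_proj_def Sec_U_M)
  qed
  moreover have "Mul U_M U (U_incl M U t) b = Mul U_M U b (U_incl M U t)"
    if "U \<in> Obj S" "t \<in> Sec T U" "b \<in> Sec U_M U" for U t b
    using that by (auto simp: U_incl_def Sec_U_M Mul_U_M T.mul_comm)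
  ultimately show ?thesis
    unfolding central_extension_def sheaf_mono_def
    using is_abelian_sheaf_tensor is_group_sheaf_U_M abelian_sheaf U_incl_hom U_proj_hom
    by (auto simp: is_abelian_sheaf_def inj_on_def U_incl_def)
qed

lemma U_incl_inj: "U \<in> Obj S \<Longrightarrow> inj_on (U_incl M U) (Sec T U)"
  by (simp add: inj_on_def U_incl_def)

text \<open>Multiplying by 1 + x with x in M \<otimes> M merely adds x in degree 2. The product of
  the first two lifts and the third lift share their degree 1 part, so the obstruction is the
  difference of their degree 2 parts.\<close>

lemma obstruction_U_M:
  assumes U: "U \<in> Obj S" and m: "m \<in> Sec M U" "m' \<in> Sec M U" and t: "t \<in> Sec T U" "t' \<in> Sec T U" "t'' \<in> Sec T U"
  shows "obstruction_cocycle T U_M (U_incl M) U (v, w, 1, m, t) (v', w', 1, m', t') (v'', w'', 1, Mul M U m m', t'')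
    = Mul T U (tens U m m') (Mul T U (Mul T U t t') (inv\<^bsub>Grp T U\<^esub> t''))" (is "_ = ?x")
proof -
  interpret B: group "Grp U_M U"
    by (rule group_U_M[OF U])
  let ?b = "(1, m, t)" and ?b' = "(1, m', t')" and ?b'' = "(1, Mul M U m m', t'')"
  have b: "?b \<in> Sec U_M U" "?b' \<in> Sec U_M U" "?b'' \<in> Sec U_M U"
    using assms by (simp_all add: Sec_U_M)
  have x: "?x \<in> Sec T U"
    using assms by simp
  \<comment> \<open>The equation is checked without inverses in UM first; solving it for the element
    1 + x is then group theory.\<close>
  have "Mul U_M U ?b ?b' = Mul U_M U (U_incl M U ?x) ?b''"
    using assms by (simp add: U_incl_def Mul_U_M T.mul_ac T.mul_inv_cancel T.mul_inv_cancel_left)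
  moreover have "U_incl M U ?x \<in> Sec U_M U"
    using x U by (simp add: U_incl_def Sec_U_M)
  ultimately have "Mul U_M U (Mul U_M U ?b ?b') (inv\<^bsub>Grp U_M U\<^esub> ?b'') = U_incl M U ?x"
    using B.inv_solve_right'[of "U_incl M U ?x" "Mul U_M U ?b ?b'" ?b''] b B.m_closed[of ?b ?b'] by simp
  then show ?thesis
    using inv_into_f_eq[OF U_incl_inj[OF U] x] by (simp add: obstruction_cocycle_def)
qed

end

section \<open>Torsors and their cocycles\<close>

context abelian_sheaf_on
begin

text \<open>The difference of two points of a torsor. Unlike \<open>torsor_cocycle\<close> it does
  not involve a fixed trivialization, so it also compares two trivializations of one torsor.\<close>

definition quot :: "('o, 'a, 'p, 'm) torsor \<Rightarrow> 'o \<Rightarrow> 'p \<Rightarrow> 'p \<Rightarrow> 'm" where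
  "quot P U p q = (THE g. g \<in> Sec M U \<and> q = Act P U p g)"

lemma torsor_cocycle_quot: "torsor_cocycle M P s U v w = quot P U (s U v) (s U w)"
  by (simp add: torsor_cocycle_def quot_def)

context
  fixes P :: "('o, 'a, 'p, 'm) torsor"
  assumes P: "is_torsor S M P"
begin

lemma torsor_sheaf: "is_sheaf S P"
  using P by (simp only: is_torsor_def)

lemma torsor_res_closed: "f \<in> into S U \<Longrightarrow> p \<in> Sec P U \<Longrightarrow> Res P f p \<in> Sec P (Dom S f)"
  using torsor_sheaf by (auto simp: is_sheaf_def is_presheaf_def into_def)

lemma act_closed: "U \<in> Obj S \<Longrightarrow> p \<in> Sec P U \<Longrightarrow> g \<in> Sec M U \<Longrightarrow> Act P U p g \<in> Sec P U"
  using P by (simp only: is_torsor_def)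

lemma act_res:
  assumes "f \<in> into S U" "p \<in> Sec P U" "g \<in> Sec M U"
  shows "Res P f (Act P U p g) = Act P (Dom S f) (Res P f p) (Res M f g)"
proof -
  have "\<forall>f\<in>Arr S. \<forall>p\<in>Sec P (Cod S f). \<forall>g\<in>Sec M (Cod S f).
      Res P f (Act P (Cod S f) p g) = Act P (Dom S f) (Res P f p) (Res M f g)"
    using P unfolding is_torsor_def by (elim conjE)
  then show ?thesis
    using assms intoD[OF assms(1)] by auto
qed

lemma act_act:
  "U \<in> Obj S \<Longrightarrow> p \<in> Sec P U \<Longrightarrow> g \<in> Sec M U \<Longrightarrow> h \<in> Sec M U \<Longrightarrow>
     Act P U (Act P U p g) h = Act P U p (Mul M U g h)"
  using P unfolding is_torsor_def by (elim conjE) blast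

lemma quot_ex1:
  assumes "U \<in> Obj S" "p \<in> Sec P U" "q \<in> Sec P U"
  shows "\<exists>!g. g \<in> Sec M U \<and> q = Act P U p g"
proof -
  have "\<forall>U\<in>Obj S. \<forall>p\<in>Sec P U. \<forall>q\<in>Sec P U. \<exists>!g. g \<in> Sec M U \<and> q = Act P U p g"
    using P unfolding is_torsor_def by (elim conjE)
  from this[rule_format, OF assms] show ?thesis .
qed

lemma quot:
  assumes "U \<in> Obj S" "p \<in> Sec P U" "q \<in> Sec P U"
  shows "quot P U p q \<in> Sec M U" "Act P U p (quot P U p q) = q"
  using theI'[OF quot_ex1[OF assms]] by (simp_all add: quot_def)

lemma quot_act:
  assumes "U \<in> Obj S" "p \<in> Sec P U" "g \<in> Sec M U"
  shows "quot P U p (Act P U p g) = g"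
  unfolding quot_def using quot_ex1[OF assms(1,2) act_closed[OF assms]] assms(3) by (intro the1_equality) auto

lemma quot_res:
  assumes "f \<in> into S U" "p \<in> Sec P U" "q \<in> Sec P U"
  shows "Res M f (quot P U p q) = quot P (Dom S f) (Res P f p) (Res P f q)"
proof -
  note U = intoD[OF assms(1)]
  note q = quot[OF U(4) assms(2,3)]
  have "Res P f q = Act P (Dom S f) (Res P f p) (Res M f (quot P U p q))"
    using act_res[OF assms(1,2) q(1)] q(2) by simp
  then show ?thesis
    using quot_act[OF U(3) torsor_res_closed[OF assms(1,2)] M.res_closed[OF assms(1) q(1)]] by simp
qed

text \<open>Acting by the product moves p to q and then q to r. Both the 1-cocycle identity and the
  relation between cocycles of different trivializations are instances.\<close>

lemma quot_mul:
  assumes "U \<in> Obj S" "p \<in> Sec P U" "q \<in> Sec P U" "r \<in> Sec P U"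
  shows "Mul M U (quot P U p q) (quot P U q r) = quot P U p r"
proof -
  have "Act P U p (Mul M U (quot P U p q) (quot P U q r)) = Act P U (Act P U p (quot P U p q)) (quot P U q r)"
    using act_act[OF assms(1,2) quot(1)[OF assms(1-3)] quot(1)[OF assms(1,3,4)]] by simp
  then have "Act P U p (Mul M U (quot P U p q) (quot P U q r)) = r"
    using quot assms by simp
  then show ?thesis
    using quot_act[of U p "Mul M U (quot P U p q) (quot P U q r)"] quot(1) assms by simp
qed

end

section \<open>Isomorphic torsors have cohomologous cocycles\<close>

lemma quot_iso:
  assumes P: "is_torsor S M P" and Q: "is_torsor S M Q"
    and \<phi>: "presheaf_map S P Q \<phi>" "\<forall>U\<in>Obj S. \<forall>p\<in>Sec P U. \<forall>g\<in>Sec M U. \<phi> U (Act P U p g) = Act Q U (\<phi> U p) g"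
    and U: "U \<in> Obj S" and p: "p \<in> Sec P U" "q \<in> Sec P U"
  shows "quot Q U (\<phi> U p) (\<phi> U q) = quot P U p q"
proof -
  have "\<phi> U p \<in> Sec Q U"
    using \<phi>(1) U p by (simp add: presheaf_map_def)
  moreover have "\<phi> U q = Act Q U (\<phi> U p) (quot P U p q)"
    using \<phi>(2) U p quot[OF P U p] by metis
  ultimately show ?thesis
    using quot_act[OF Q U] quot(1)[OF P U p] by simp
qed

text \<open>The inverse of an isomorphism is natural and equivariant because both identities hold
  after applying the injective map \<phi>.\<close>

lemma torsor_iso_sym:
  assumes P: "is_torsor S M P" and "torsor_iso S M P Q"
  shows "torsor_iso S M Q P"
proof -
  obtain \<phi> where \<phi>: "presheaf_map S P Q \<phi>" "\<And>U. U \<in> Obj S \<Longrightarrow> bij_betw (\<phi> U) (Sec P U) (Sec Q U)"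
    "\<And>U p g. U \<in> Obj S \<Longrightarrow> p \<in> Sec P U \<Longrightarrow> g \<in> Sec M U \<Longrightarrow> \<phi> U (Act P U p g) = Act Q U (\<phi> U p) g"
    using assms unfolding torsor_iso_def by blast
  define \<psi> where "\<psi> U = inv_into (Sec P U) (\<phi> U)" for U
  have \<psi>: "\<psi> U q \<in> Sec P U" "\<phi> U (\<psi> U q) = q" if "U \<in> Obj S" "q \<in> Sec Q U" for U q
    using \<phi>(2)[OF that(1)] that(2) unfolding \<psi>_def bij_betw_def by (auto simp: inv_into_into f_inv_into_f)
  have inj: "p = p'" if "U \<in> Obj S" "p \<in> Sec P U" "p' \<in> Sec P U" "\<phi> U p = \<phi> U p'" for U p p'
    using \<phi>(2)[OF that(1)] that unfolding bij_betw_def inj_on_def by blast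
  have "presheaf_map S Q P \<psi>"
    unfolding presheaf_map_def
  proof (intro conjI ballI)
    fix f q
    assume f: "f \<in> Arr S" and q: "q \<in> Sec Q (Cod S f)"
    note i = intoD[OF arr_into[OF f]]
    have r: "Res P f (\<psi> (Cod S f) q) \<in> Sec P (Dom S f)"
      using torsor_res_closed[OF P arr_into[OF f] \<psi>(1)[OF i(4) q]] .
    have e: "\<phi> (Dom S f) (Res P f (\<psi> (Cod S f) q)) = Res Q f q"
      using \<phi>(1) f \<psi>[OF i(4) q] unfolding presheaf_map_def by metis
    have "Res Q f q \<in> Sec Q (Dom S f)"
      using \<phi>(1) r i(3) e unfolding presheaf_map_def by metis
    then show "\<psi> (Dom S f) (Res Q f q) = Res P f (\<psi> (Cod S f) q)"
      using r e \<psi> inj i(3) by metis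
  qed (use \<psi> in auto)
  moreover have "bij_betw (\<psi> U) (Sec Q U) (Sec P U)" if "U \<in> Obj S" for U
    unfolding \<psi>_def using bij_betw_inv_into[OF \<phi>(2)[OF that]] .
  moreover have "\<psi> U (Act Q U q g) = Act P U (\<psi> U q) g" if U: "U \<in> Obj S" and q: "q \<in> Sec Q U" and g: "g \<in> Sec M U" for U q g
  proof -
    have a: "Act P U (\<psi> U q) g \<in> Sec P U"
      using act_closed[OF P U \<psi>(1)[OF U q] g] .
    have e: "\<phi> U (Act P U (\<psi> U q) g) = Act Q U q g"
      using \<phi>(3)[OF U \<psi>(1)[OF U q] g] \<psi>(2)[OF U q] by simp
    have "Act Q U q g \<in> Sec Q U"
      using \<phi>(1) a U e unfolding presheaf_map_def by metis
    then show ?thesis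
      using a e \<psi> inj U by metis
  qed
  ultimately show ?thesis
    unfolding torsor_iso_def by blast
qed

lemma presheaf_map_comp:
  assumes "presheaf_map S F G \<phi>" "presheaf_map S G H \<psi>"
  shows "presheaf_map S F H (\<lambda>U s. \<psi> U (\<phi> U s))"
  unfolding presheaf_map_def
proof (intro conjI ballI)
  fix f s
  assume f: "f \<in> Arr S" "s \<in> Sec F (Cod S f)"
  then have "\<phi> (Cod S f) s \<in> Sec G (Cod S f)"
    using assms(1) intoD(4)[OF arr_into[OF f(1)]] unfolding presheaf_map_def by blast
  then show "\<psi> (Dom S f) (\<phi> (Dom S f) (Res F f s)) = Res H f (\<psi> (Cod S f) (\<phi> (Cod S f) s))"
    using assms f unfolding presheaf_map_def by simp
qed (use assms in \<open>auto simp: presheaf_map_def\<close>)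

text \<open>Composing the trivialization with the isomorphism keeps the cocycle, since an
  equivariant map preserves differences of points.\<close>

lemma trivialization_transport:
  assumes P: "is_torsor S M P" and Q: "is_torsor S M Q" and "torsor_iso S M P Q" and s: "presheaf_map S K P s"
  obtains s' where "presheaf_map S K Q s'"
    "\<And>U v w. U \<in> Obj S \<Longrightarrow> v \<in> Sec K U \<Longrightarrow> w \<in> Sec K U \<Longrightarrow> torsor_cocycle M Q s' U v w = torsor_cocycle M P s U v w"
proof -
  obtain \<phi> where \<phi>: "presheaf_map S P Q \<phi>"
    "\<forall>U\<in>Obj S. \<forall>p\<in>Sec P U. \<forall>g\<in>Sec M U. \<phi> U (Act P U p g) = Act Q U (\<phi> U p) g"
    using assms unfolding torsor_iso_def by blast
  show thesis
  proof (rule that)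
    show "presheaf_map S K Q (\<lambda>U v. \<phi> U (s U v))"
      using presheaf_map_comp[OF s \<phi>(1)] .
    fix U v w
    assume "U \<in> Obj S" "v \<in> Sec K U" "w \<in> Sec K U"
    then show "torsor_cocycle M Q (\<lambda>U v. \<phi> U (s U v)) U v w = torsor_cocycle M P s U v w"
      unfolding torsor_cocycle_quot using quot_iso[OF P Q \<phi>] s by (simp add: presheaf_map_def)
  qed
qed

text \<open>A class in the quotient is presented as the image of one representative P0, with
  isomorphisms from P0 to P and to Q. Reversing the first gives a chain from P to Q.\<close>

lemma H1_iso:
  assumes x: "x \<in> H1 S M" and P: "P \<in> x" and Q: "Q \<in> x"
  obtains P0 where "is_torsor S M P0" "is_torsor S M P" "is_torsor S M Q" "torsor_iso S M P P0" "torsor_iso S M P0 Q"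
proof -
  obtain P0 where "is_torsor S M P0" "x = {(P, Q). is_torsor S M P \<and> is_torsor S M Q \<and> torsor_iso S M P Q} `` {P0}"
    using x unfolding H1_def by (auto elim: quotientE)
  then show thesis
    using that[of P0] P Q torsor_iso_sym[of P0 P] by auto
qed

text \<open>Along the chain of isomorphisms the trivialization s becomes a trivialization s2 of Q
  with the same cocycle. The cochain h is the difference from s2 to t, and both sides of the
  identity are the difference from s2 at v to t at w.\<close>

lemma cohomologous_cocycles:
  assumes x: "x \<in> H1 S M" and P: "P \<in> x" and Q: "Q \<in> x"
    and s: "presheaf_map S K P s" and t: "presheaf_map S K Q t"
  obtains h where "presheaf_map S K M h"
    "\<And>U v w. U \<in> Obj S \<Longrightarrow> v \<in> Sec K U \<Longrightarrow> w \<in> Sec K U \<Longrightarrow>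
       Mul M U (torsor_cocycle M P s U v w) (h U w) = Mul M U (h U v) (torsor_cocycle M Q t U v w)"
proof -
  obtain P0 where P0: "is_torsor S M P0" "is_torsor S M P" "is_torsor S M Q" "torsor_iso S M P P0" "torsor_iso S M P0 Q"
    by (rule H1_iso[OF x P Q]) blast
  obtain s1 where s1: "presheaf_map S K P0 s1"
    "\<And>U v w. U \<in> Obj S \<Longrightarrow> v \<in> Sec K U \<Longrightarrow> w \<in> Sec K U \<Longrightarrow> torsor_cocycle M P0 s1 U v w = torsor_cocycle M P s U v w"
    by (rule trivialization_transport[OF P0(2,1,4) s]) blast
  obtain s2 where s2: "presheaf_map S K Q s2"
    "\<And>U v w. U \<in> Obj S \<Longrightarrow> v \<in> Sec K U \<Longrightarrow> w \<in> Sec K U \<Longrightarrow> torsor_cocycle M Q s2 U v w = torsor_cocycle M P0 s1 U v w"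
    by (rule trivialization_transport[OF P0(1,3,5) s1(1)]) blast
  have sec: "s2 U v \<in> Sec Q U" "t U v \<in> Sec Q U" if "U \<in> Obj S" "v \<in> Sec K U" for U v
    using s2(1) t that by (auto simp: presheaf_map_def)
  show thesis
  proof (rule that)
    show "presheaf_map S K M (\<lambda>U v. quot Q U (s2 U v) (t U v))"
      unfolding presheaf_map_def
    proof (intro conjI ballI)
      fix f v
      assume f: "f \<in> Arr S" and v: "v \<in> Sec K (Cod S f)"
      then show "quot Q (Dom S f) (s2 (Dom S f) (Res K f v)) (t (Dom S f) (Res K f v)) = Res M f (quot Q (Cod S f) (s2 (Cod S f) v) (t (Cod S f) v))"
        using quot_res[OF P0(3) arr_into[OF f]] sec[of "Cod S f" v] intoD[OF arr_into[OF f]] s2(1) t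
        by (simp add: presheaf_map_def)
    qed (use quot(1)[OF P0(3)] sec in auto)
    fix U v w
    assume U: "U \<in> Obj S" and v: "v \<in> Sec K U" and w: "w \<in> Sec K U"
    have "torsor_cocycle M P s U v w = quot Q U (s2 U v) (s2 U w)"
      using s1(2)[OF U v w] s2(2)[OF U v w] by (simp add: torsor_cocycle_quot)
    then show "Mul M U (torsor_cocycle M P s U v w) (quot Q U (s2 U w) (t U w)) = Mul M U (quot Q U (s2 U v) (t U v)) (torsor_cocycle M Q t U v w)"
      using U v w sec quot_mul[OF P0(3) U] by (simp add: torsor_cocycle_quot)
  qed
qed

lemma torsor_cocycle_closed:
  assumes P: "is_torsor S M P" and s: "presheaf_map S K P s" and U: "U \<in> Obj S"
    and v: "v \<in> Sec K U" "w \<in> Sec K U"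
  shows "torsor_cocycle M P s U v w \<in> Sec M U"
  using s U v quot(1)[OF P U] by (simp add: torsor_cocycle_quot presheaf_map_def)

lemma torsor_cocycle_mul:
  assumes P: "is_torsor S M P" and s: "presheaf_map S K P s" and U: "U \<in> Obj S"
    and v: "v \<in> Sec K U" "w \<in> Sec K U" "z \<in> Sec K U"
  shows "Mul M U (torsor_cocycle M P s U v w) (torsor_cocycle M P s U w z) = torsor_cocycle M P s U v z"
  using s U v quot_mul[OF P U] by (simp add: torsor_cocycle_quot presheaf_map_def)

lemma torsor_cocycle_res:
  assumes P: "is_torsor S M P" and s: "presheaf_map S K P s" and f: "f \<in> Arr S"
    and v: "v \<in> Sec K (Cod S f)" "w \<in> Sec K (Cod S f)"
  shows "torsor_cocycle M P s (Dom S f) (Res K f v) (Res K f w) = Res M f (torsor_cocycle M P s (Cod S f) v w)"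
  using s f v quot_res[OF P arr_into[OF f]] intoD(4)[OF arr_into[OF f]]
  by (simp add: torsor_cocycle_quot presheaf_map_def)

end

section \<open>Comparison of the two cocycles\<close>

locale resolved = abelian_sheaf_on S M for S :: "('o, 'a) site" and M :: "('o, 'a, 'm) group_presheaf" +
  fixes I :: "('o, 'a, 'a \<Rightarrow> (('m \<times> 'm) \<Rightarrow>\<^sub>0 int) set set, 'i) resolution"
  assumes resolution: "injective_resolution S (tensor_sheaf S M M) I"
begin

section \<open>The augmentation and the first differential of the resolution\<close>

sublocale I0: abelian_presheaf S "Term I 0"
  using resolution by (intro abelian_presheafI) (simp add: injective_resolution_def injective_sheaf_def)

sublocale I1: abelian_presheaf S "Term I 1"
  using resolution by (intro abelian_presheafI) (simp add: injective_resolution_def injective_sheaf_def)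

lemma aug_map: "presheaf_map S T (Term I 0) (Aug I)"
  using resolution by (simp add: injective_resolution_def group_sheaf_hom_def)

lemma aug_closed [simp]: "U \<in> Obj S \<Longrightarrow> t \<in> Sec T U \<Longrightarrow> Aug I U t \<in> Sec (Term I 0) U"
  using aug_map by (simp add: presheaf_map_def)

lemma aug_group_hom: "U \<in> Obj S \<Longrightarrow> group_hom (Grp T U) (Grp (Term I 0) U) (Aug I U)"
  using resolution T.grp I0.grp
  by (simp add: injective_resolution_def group_sheaf_hom_def group_hom_def group_hom_axioms_def)

lemma aug_mul [simp]:
  "U \<in> Obj S \<Longrightarrow> t \<in> Sec T U \<Longrightarrow> t' \<in> Sec T U \<Longrightarrow> Aug I U (Mul T U t t') = Mul (Term I 0) U (Aug I U t) (Aug I U t')"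
  using group_hom.hom_mult[OF aug_group_hom, of U t t'] by simp

lemma aug_inv [simp]:
  "U \<in> Obj S \<Longrightarrow> t \<in> Sec T U \<Longrightarrow> Aug I U (inv\<^bsub>Grp T U\<^esub> t) = inv\<^bsub>Grp (Term I 0) U\<^esub> (Aug I U t)"
  using group_hom.hom_inv[OF aug_group_hom, of U t] by simp

lemma diff_mul:
  assumes "U \<in> Obj S" "a \<in> Sec (Term I 0) U" "b \<in> Sec (Term I 0) U"
  shows "Diff I 0 U (Mul (Term I 0) U a b) = Mul (Term I 1) U (Diff I 0 U a) (Diff I 0 U b)"
proof -
  have "group_sheaf_hom S (Term I 0) (Term I (Suc 0)) (Diff I 0)"
    using resolution by (simp add: injective_resolution_def)
  then have "Diff I 0 U \<in> hom (Grp (Term I 0) U) (Grp (Term I 1) U)"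
    using assms(1) by (simp add: group_sheaf_hom_def)
  then show ?thesis
    using hom_mult[of _ "Grp (Term I 0) U" "Grp (Term I 1) U" a b] assms by simp
qed

lemma diff_closed:
  assumes "U \<in> Obj S" "a \<in> Sec (Term I 0) U"
  shows "Diff I 0 U a \<in> Sec (Term I 1) U"
proof -
  have "group_sheaf_hom S (Term I 0) (Term I (Suc 0)) (Diff I 0)"
    using resolution by (simp add: injective_resolution_def)
  then show ?thesis
    using assms by (simp add: group_sheaf_hom_def presheaf_map_def)
qed

lemma diff_aug:
  assumes U: "U \<in> Obj S" and t: "t \<in> Sec T U"
  shows "Diff I 0 U (Aug I U t) = Unit (Term I 1) U"
proof -
  have "in_image_sheaf S T (Term I 0) (Aug I) U (Aug I U t)"
  proof (rule in_image_sheafI[OF U])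
    fix f
    assume f: "f \<in> into S U"
    then have "Aug I (Dom S f) (Res T f t) = Res (Term I 0) f (Aug I U t)"
      using aug_map t intoD[OF f] by (auto simp: presheaf_map_def)
    then show "\<exists>r\<in>Sec T (Dom S f). Aug I (Dom S f) r = Res (Term I 0) f (Aug I U t)"
      using f t by (intro bexI[of _ "Res T f t"]) simp_all
  qed
  then show ?thesis
    using resolution U t by (simp add: injective_resolution_def exact_at_def)
qed

text \<open>The product K0 \<times> K0 in the form in which \<open>cup_product\<close> has
  it.\<close>

abbreviation pair_presheaf :: "('o, 'a, 'k) presheaf \<Rightarrow> ('o, 'a, 'k \<times> 'k) presheaf" where
  "pair_presheaf K \<equiv> \<lparr>Sec = \<lambda>U. Sec K U \<times> Sec K U, Res = \<lambda>f (v, w). (Res K f v, Res K f w)\<rparr>"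

text \<open>Every 1-cocycle has the lift \<open>1 + c\<close>, along which a splitting of the obstruction pulls back.\<close>

lemma obstruction_imp_cup:
  assumes P: "is_torsor S M P" and s: "presheaf_map S K P s"
    and obs: "cocycle_has_class S I K (lift_presheaf U_M U_proj K (torsor_cocycle M P s))
      (\<lambda>(v, w, b). v) (\<lambda>(v, w, b). w) (obstruction_cocycle T U_M (U_incl M)) \<xi>"
  shows "cocycle_has_class S I K (pair_presheaf K) fst snd
    (\<lambda>U (v0, v1) (v1', v2) _. tens U (torsor_cocycle M P s U v0 v1) (torsor_cocycle M P s U v1' v2)) \<xi>"
proof -
  let ?c = "torsor_cocycle M P s" and ?L = "lift_presheaf U_M U_proj K (torsor_cocycle M P s)"
  obtain \<zeta> \<alpha> \<beta> where \<xi>: "\<xi> \<in> carrier (cohomology S I 2)" "\<zeta> \<in> \<xi>"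
    and \<alpha>: "presheaf_map S ?L (Term I 0) \<alpha>" and \<beta>: "presheaf_map S K (Term I 1) \<beta>"
    and tri: "\<forall>U\<in>Obj S. \<forall>k01\<in>Sec ?L U. \<forall>k12\<in>Sec ?L U. \<forall>k02\<in>Sec ?L U.
        (case k01 of (v, w, b) \<Rightarrow> v) = (case k02 of (v, w, b) \<Rightarrow> v) \<longrightarrow>
        (case k01 of (v, w, b) \<Rightarrow> w) = (case k12 of (v, w, b) \<Rightarrow> v) \<longrightarrow>
        (case k12 of (v, w, b) \<Rightarrow> w) = (case k02 of (v, w, b) \<Rightarrow> w) \<longrightarrow>
        Aug I U (obstruction_cocycle T U_M (U_incl M) U k01 k12 k02) =
          \<alpha> U k01 \<otimes>\<^bsub>Grp (Term I 0) U\<^esub> \<alpha> U k12 \<otimes>\<^bsub>Grp (Term I 0) U\<^esub> inv\<^bsub>Grp (Term I 0) U\<^esub> (\<alpha> U k02)"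
    and d0: "\<forall>U\<in>Obj S. \<forall>k\<in>Sec ?L U. Diff I 0 U (\<alpha> U k) =
        \<beta> U (case k of (v, w, b) \<Rightarrow> w) \<otimes>\<^bsub>Grp (Term I 1) U\<^esub> inv\<^bsub>Grp (Term I 1) U\<^esub> (\<beta> U (case k of (v, w, b) \<Rightarrow> v))"
    and d1: "\<forall>U\<in>Obj S. \<forall>k\<in>Sec K U. Diff I 1 U (\<beta> U k) = inv\<^bsub>Grp (Term I 2) U\<^esub> (\<zeta> U (one_Z S U))"
    using obs unfolding cocycle_has_class_def by (elim conjE bexE exE) rule
  \<comment> \<open>The lift 1 + c(v, w), with trivial degree 2 part: a section of the projection
    from triples to pairs.\<close>
  define l where "l U = (\<lambda>(v, w). (v, w, (1 :: int, ?c U v w, Unit T U)))" for U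
  have l: "l U (v, w) \<in> Sec ?L U" if "U \<in> Obj S" "v \<in> Sec K U" "w \<in> Sec K U" for U v w
    using that torsor_cocycle_closed[OF P s that] by (simp add: l_def lift_presheaf_def Sec_U_M U_proj_def)
  have "presheaf_map S (pair_presheaf K) ?L l"
    unfolding presheaf_map_def
  proof (intro conjI ballI)
    fix f k
    assume f: "f \<in> Arr S" and k: "k \<in> Sec (pair_presheaf K) (Cod S f)"
    then show "l (Dom S f) (Res (pair_presheaf K) f k) = Res ?L f (l (Cod S f) k)"
      using torsor_cocycle_res[OF P s f] T.res_unit[OF arr_into[OF f]]
      by (auto simp: l_def lift_presheaf_def Res_U_M)
  qed (use l in auto)
  note \<alpha>' = presheaf_map_comp[OF this \<alpha>]
  show ?thesis
    unfolding cocycle_has_class_def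
  proof (intro conjI bexI[OF _ \<xi>(2)] exI[of _ "\<lambda>U k. \<alpha> U (l U k)"] exI[of _ \<beta>] \<xi>(1) \<alpha>' \<beta> d1 ballI impI)
    fix U k01 k12 k02
    assume U: "U \<in> Obj S" and "k01 \<in> Sec (pair_presheaf K) U" "k12 \<in> Sec (pair_presheaf K) U" "k02 \<in> Sec (pair_presheaf K) U"
      "fst k01 = fst k02" "snd k01 = fst k12" "snd k12 = snd k02"
    then obtain v0 v1 v2 where k: "k01 = (v0, v1)" "k12 = (v1, v2)" "k02 = (v0, v2)"
      and v: "v0 \<in> Sec K U" "v1 \<in> Sec K U" "v2 \<in> Sec K U"
      by auto
    \<comment> \<open>The degree 2 parts of the three lifts are trivial, so only the tensor of the
      degree 1 parts remains.\<close>
    have "obstruction_cocycle T U_M (U_incl M) U (l U k01) (l U k12) (l U k02) = tens U (?c U v0 v1) (?c U v1 v2)"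
      using obstruction_U_M[OF U torsor_cocycle_closed[OF P s U v(1,2)] torsor_cocycle_closed[OF P s U v(2,3)]
          T.unit_closed[OF U] T.unit_closed[OF U] T.unit_closed[OF U]]
        torsor_cocycle_mul[OF P s U v] torsor_cocycle_closed[OF P s U v(1,2)] torsor_cocycle_closed[OF P s U v(2,3)]
        T.mul_inv[of U "Unit T U"] U
      by (simp add: k l_def)
    then show "Aug I U ((case k01 of (v0, v1) \<Rightarrow> \<lambda>(v1', v2) _. tens U (?c U v0 v1) (?c U v1' v2)) k12 k02) =
        \<alpha> U (l U k01) \<otimes>\<^bsub>Grp (Term I 0) U\<^esub> \<alpha> U (l U k12) \<otimes>\<^bsub>Grp (Term I 0) U\<^esub> inv\<^bsub>Grp (Term I 0) U\<^esub> (\<alpha> U (l U k02))"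
      using tri[rule_format, OF U, of "l U k01" "l U k12" "l U k02"] l[OF U] v by (simp add: k l_def)
  next
    fix U k
    assume U: "U \<in> Obj S" and "k \<in> Sec (pair_presheaf K) U"
    then obtain v w where k: "k = (v, w)" "v \<in> Sec K U" "w \<in> Sec K U"
      by auto
    then show "Diff I 0 U (\<alpha> U (l U k)) = \<beta> U (snd k) \<otimes>\<^bsub>Grp (Term I 1) U\<^esub> inv\<^bsub>Grp (Term I 1) U\<^esub> (\<beta> U (fst k))"
      using d0[rule_format, OF U l[OF U k(2,3)]] by (simp add: l_def)
  qed
qed

text \<open>With \<open>n = m + \<delta>h\<close> one has \<open>m \<union> m = m \<union> n + \<delta>(m \<union> h)\<close>,
  and on lifts \<open>1 + m + t\<close> the obstruction is \<open>m \<union> m + \<delta>t\<close>.\<close>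

lemma cup_imp_obstruction:
  assumes x: "x \<in> H1 S M" and P: "P \<in> x" and Q: "Q \<in> x"
    and s: "presheaf_map S K P s" and t: "presheaf_map S K Q t"
    and cup: "cocycle_has_class S I K (pair_presheaf K) fst snd
      (\<lambda>U (v0, v1) (v1', v2) _. tens U (torsor_cocycle M P s U v0 v1) (torsor_cocycle M Q t U v1' v2)) \<xi>"
  shows "cocycle_has_class S I K (lift_presheaf U_M U_proj K (torsor_cocycle M P s))
      (\<lambda>(v, w, b). v) (\<lambda>(v, w, b). w) (obstruction_cocycle T U_M (U_incl M)) \<xi>"
proof -
  let ?c = "torsor_cocycle M P s" and ?n = "torsor_cocycle M Q t"
    and ?L = "lift_presheaf U_M U_proj K (torsor_cocycle M P s)"
  have tor: "is_torsor S M P" "is_torsor S M Q"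
    using H1_iso[OF x P Q] by auto
  obtain h where h: "presheaf_map S K M h"
    "\<And>U v w. U \<in> Obj S \<Longrightarrow> v \<in> Sec K U \<Longrightarrow> w \<in> Sec K U \<Longrightarrow> Mul M U (?c U v w) (h U w) = Mul M U (h U v) (?n U v w)"
    by (rule cohomologous_cocycles[OF x P Q s t]) blast
  have hsec: "h U v \<in> Sec M U" if "U \<in> Obj S" "v \<in> Sec K U" for U v
    using h(1) that by (simp add: presheaf_map_def)
  obtain \<zeta> \<alpha> \<beta> where \<xi>: "\<xi> \<in> carrier (cohomology S I 2)" "\<zeta> \<in> \<xi>"
    and \<alpha>: "presheaf_map S (pair_presheaf K) (Term I 0) \<alpha>" and \<beta>: "presheaf_map S K (Term I 1) \<beta>"
    and tri: "\<forall>U\<in>Obj S. \<forall>k01\<in>Sec (pair_presheaf K) U. \<forall>k12\<in>Sec (pair_presheaf K) U. \<forall>k02\<in>Sec (pair_presheaf K) U.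
        fst k01 = fst k02 \<longrightarrow> snd k01 = fst k12 \<longrightarrow> snd k12 = snd k02 \<longrightarrow>
        Aug I U ((case k01 of (v0, v1) \<Rightarrow> \<lambda>(v1', v2) _. tens U (?c U v0 v1) (?n U v1' v2)) k12 k02) =
          \<alpha> U k01 \<otimes>\<^bsub>Grp (Term I 0) U\<^esub> \<alpha> U k12 \<otimes>\<^bsub>Grp (Term I 0) U\<^esub> inv\<^bsub>Grp (Term I 0) U\<^esub> (\<alpha> U k02)"
    and d0: "\<forall>U\<in>Obj S. \<forall>k\<in>Sec (pair_presheaf K) U. Diff I 0 U (\<alpha> U k) =
        \<beta> U (snd k) \<otimes>\<^bsub>Grp (Term I 1) U\<^esub> inv\<^bsub>Grp (Term I 1) U\<^esub> (\<beta> U (fst k))"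
    and d1: "\<forall>U\<in>Obj S. \<forall>k\<in>Sec K U. Diff I 1 U (\<beta> U k) = inv\<^bsub>Grp (Term I 2) U\<^esub> (\<zeta> U (one_Z S U))"
    using cup unfolding cocycle_has_class_def by (elim conjE bexE exE) rule
  \<comment> \<open>The cochain m \<union> h, which turns m \<union> n into m \<union> m, together
    with the degree 2 part r of the lift, whose coboundary enters the obstruction.\<close>
  define e where "e U = (\<lambda>(v, w, (_ :: int, _ :: 'm, r)). Mul T U (tens U (?c U v w) (h U w)) r)" for U
  \<comment> \<open>The splitting of the cup cocycle pulled back to triples, corrected by e.\<close>
  define \<alpha>' where "\<alpha>' U k = Mul (Term I 0) U (\<alpha> U (case k of (v, w, b) \<Rightarrow> (v, w))) (Aug I U (e U k))" for U k
  have L: "\<exists>v w r. k = (v, w, 1, ?c U v w, r) \<and> v \<in> Sec K U \<and> w \<in> Sec K U \<and> ?c U v w \<in> Sec M U \<and> r \<in> Sec T U"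
    if "U \<in> Obj S" "k \<in> Sec ?L U" for U k
    using that by (auto simp: lift_presheaf_def Sec_U_M U_proj_def)
  have \<alpha>sec: "\<alpha> U (v, w) \<in> Sec (Term I 0) U" if "U \<in> Obj S" "v \<in> Sec K U" "w \<in> Sec K U" for U v w
    using \<alpha> that by (simp add: presheaf_map_def)
  have esec: "e U k \<in> Sec T U" if U: "U \<in> Obj S" and k: "k \<in> Sec ?L U" for U k
    using L[OF U k] U hsec[OF U] by (auto simp: e_def)
  have "presheaf_map S ?L (Term I 0) \<alpha>'"
    unfolding presheaf_map_def
  proof (intro conjI ballI)
    fix U k
    assume U: "U \<in> Obj S" and k: "k \<in> Sec ?L U"
    show "\<alpha>' U k \<in> Sec (Term I 0) U"
      using L[OF U k] esec[OF U k] \<alpha>sec[OF U] U by (auto simp: \<alpha>'_def)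
  next
    fix f k
    assume f: "f \<in> Arr S" and k: "k \<in> Sec ?L (Cod S f)"
    note F = arr_into[OF f] and U = intoD[OF arr_into[OF f]]
    obtain v w r where k': "k = (v, w, 1, ?c (Cod S f) v w, r)" "v \<in> Sec K (Cod S f)" "w \<in> Sec K (Cod S f)"
      "?c (Cod S f) v w \<in> Sec M (Cod S f)" "r \<in> Sec T (Cod S f)"
      using L[OF U(4) k] by blast
    have "e (Dom S f) (Res ?L f k) = Res T f (e (Cod S f) k)"
      using k' F U h(1) hsec[OF U(4)] torsor_cocycle_res[OF tor(1) s f] f
      by (simp add: e_def lift_presheaf_def Res_U_M presheaf_map_def)
    moreover have "\<alpha> (Dom S f) (Res K f v, Res K f w) = Res (Term I 0) f (\<alpha> (Cod S f) (v, w))"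
      using \<alpha> f k' by (simp add: presheaf_map_def)
    moreover have "Aug I (Dom S f) (Res T f (e (Cod S f) k)) = Res (Term I 0) f (Aug I (Cod S f) (e (Cod S f) k))"
      using aug_map f esec[OF U(4) k] by (simp add: presheaf_map_def)
    moreover have "(case Res ?L f k of (v, w, b) \<Rightarrow> (v, w)) = (Res K f v, Res K f w)"
      by (simp add: k' lift_presheaf_def)
    ultimately show "\<alpha>' (Dom S f) (Res ?L f k) = Res (Term I 0) f (\<alpha>' (Cod S f) k)"
      using F \<alpha>sec[OF U(4) k'(2,3)] esec[OF U(4) k] U k' by (simp add: \<alpha>'_def)
  qed
  note \<alpha>' = this
  show ?thesis
    unfolding cocycle_has_class_def
  proof (intro conjI bexI[OF _ \<xi>(2)] exI[of _ \<alpha>'] exI[of _ \<beta>] \<xi>(1) \<alpha>' \<beta> d1 ballI impI)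
    fix U k01 k12 k02
    assume U: "U \<in> Obj S" and k: "k01 \<in> Sec ?L U" "k12 \<in> Sec ?L U" "k02 \<in> Sec ?L U"
      and e: "(case k01 of (v, w, b) \<Rightarrow> v) = (case k02 of (v, w, b) \<Rightarrow> v)"
        "(case k01 of (v, w, b) \<Rightarrow> w) = (case k12 of (v, w, b) \<Rightarrow> v)"
        "(case k12 of (v, w, b) \<Rightarrow> w) = (case k02 of (v, w, b) \<Rightarrow> w)"
    obtain v0 v1 v2 r01 r12 r02 where k': "k01 = (v0, v1, 1, ?c U v0 v1, r01)" "k12 = (v1, v2, 1, ?c U v1 v2, r12)"
      "k02 = (v0, v2, 1, ?c U v0 v2, r02)" and v: "v0 \<in> Sec K U" "v1 \<in> Sec K U" "v2 \<in> Sec K U"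
      and r: "r01 \<in> Sec T U" "r12 \<in> Sec T U" "r02 \<in> Sec T U"
      using L[OF U k(1)] L[OF U k(2)] L[OF U k(3)] e by auto
    have c: "?c U v0 v1 \<in> Sec M U" "?c U v1 v2 \<in> Sec M U" "?c U v0 v2 = Mul M U (?c U v0 v1) (?c U v1 v2)"
      using torsor_cocycle_closed[OF tor(1) s U] torsor_cocycle_mul[OF tor(1) s U] v by simp_all
    have n: "?n U v1 v2 \<in> Sec M U"
      using torsor_cocycle_closed[OF tor(2) t U] v by blast
    note hs = hsec[OF U v(2)] hsec[OF U v(3)]
    define a b1 b2 where "a = tens U (?c U v0 v1) (?c U v1 v2)" and "b1 = tens U (?c U v0 v1) (h U v1)"
      and "b2 = tens U (?c U v0 v1) (h U v2)"
    \<comment> \<open>The term b' occurs in the correction on the edge 12 and, because m02 = m01 +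
      m12, also on the edge 02; it drops out of the coboundary.\<close>
    define n' b' where "n' = tens U (?c U v0 v1) (?n U v1 v2)" and "b' = tens U (?c U v1 v2) (h U v2)"
    have sec: "a \<in> Sec T U" "b1 \<in> Sec T U" "b2 \<in> Sec T U" "n' \<in> Sec T U" "b' \<in> Sec T U"
      using U c n hs by (simp_all add: a_def b1_def b2_def n'_def b'_def)
    \<comment> \<open>Additively, m12 + h2 = h1 + n12 is tensored on the left with m01.\<close>
    have ab: "Mul T U a b2 = Mul T U b1 n'"
      using arg_cong[OF h(2)[OF U v(2,3)], of "tens U (?c U v0 v1)"] U c n hs
      by (simp add: tensor_right a_def b1_def b2_def n'_def)
    then have a: "a = Mul T U (Mul T U b1 n') (inv\<^bsub>Grp T U\<^esub> b2)"
      using U sec by (metis T.mul_assoc T.inv_closed T.mul_inv(2) T.mul_unit(2))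
    have ob: "obstruction_cocycle T U_M (U_incl M) U k01 k12 k02 = Mul T U a (Mul T U (Mul T U r01 r12) (inv\<^bsub>Grp T U\<^esub> r02))"
      unfolding k' c(3) a_def by (rule obstruction_U_M[OF U c(1,2) r])
    have es: "e U k01 = Mul T U b1 r01" "e U k12 = Mul T U b' r12" "e U k02 = Mul T U (Mul T U b2 b') r02"
      using U c hs by (simp_all add: e_def k' b1_def b2_def b'_def tensor_left)
    have n': "Aug I U n' = Mul (Term I 0) U (Mul (Term I 0) U (\<alpha> U (v0, v1)) (\<alpha> U (v1, v2))) (inv\<^bsub>Grp (Term I 0) U\<^esub> (\<alpha> U (v0, v2)))"
      using tri[rule_format, OF U, of "(v0, v1)" "(v1, v2)" "(v0, v2)"] v by (simp add: n'_def)
    \<comment> \<open>These are the values of \<alpha>' on 01 and 12 combined, and on 02, each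
      stripped of b'. As b' is absent from the obstruction, it is split off here and cancelled at
      the end.\<close>
    define p q where "p = Mul (Term I 0) U (\<alpha>' U k01) (Mul (Term I 0) U (\<alpha> U (v1, v2)) (Aug I U r12))"
      and "q = Mul (Term I 0) U (\<alpha> U (v0, v2)) (Mul (Term I 0) U (Aug I U b2) (Aug I U r02))"
    note \<alpha>s = \<alpha>sec[OF U v(1,2)] \<alpha>sec[OF U v(2,3)] \<alpha>sec[OF U v(1,3)]
    have pq: "p \<in> Sec (Term I 0) U" "q \<in> Sec (Term I 0) U"
      unfolding p_def q_def \<alpha>'_def es using U sec r \<alpha>s by (simp_all add: k')
    have "Aug I U (obstruction_cocycle T U_M (U_incl M) U k01 k12 k02) = Mul (Term I 0) U p (inv\<^bsub>Grp (Term I 0) U\<^esub> q)"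
      unfolding ob a p_def q_def \<alpha>'_def es using U sec r \<alpha>s n' by (simp add: k' I0.inv_mul I0.mul_ac)
    moreover have "Mul (Term I 0) U (\<alpha>' U k01) (\<alpha>' U k12) = Mul (Term I 0) U p (Aug I U b')"
      "\<alpha>' U k02 = Mul (Term I 0) U q (Aug I U b')"
      unfolding p_def q_def \<alpha>'_def es using U sec r \<alpha>s by (simp_all add: k' I0.mul_ac)
    ultimately have "Aug I U (obstruction_cocycle T U_M (U_incl M) U k01 k12 k02) =
        Mul (Term I 0) U (Mul (Term I 0) U (\<alpha>' U k01) (\<alpha>' U k12)) (inv\<^bsub>Grp (Term I 0) U\<^esub> (\<alpha>' U k02))"
      using I0.mul_inv_cancel_right[OF U pq aug_closed[OF U sec(5)]] by simp
    then show "Aug I U (obstruction_cocycle T U_M (U_incl M) U k01 k12 k02) =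
        \<alpha>' U k01 \<otimes>\<^bsub>Grp (Term I 0) U\<^esub> \<alpha>' U k12 \<otimes>\<^bsub>Grp (Term I 0) U\<^esub> inv\<^bsub>Grp (Term I 0) U\<^esub> (\<alpha>' U k02)"
      by simp
  next
    fix U k
    assume U: "U \<in> Obj S" and k: "k \<in> Sec ?L U"
    obtain v w r where k': "k = (v, w, 1, ?c U v w, r)" "v \<in> Sec K U" "w \<in> Sec K U"
      using L[OF U k] by blast
    \<comment> \<open>The correction lies in the image of the augmentation, which the differential
      kills. So \<beta> still fits, and with it the class.\<close>
    have "Diff I 0 U (\<alpha>' U k) = Diff I 0 U (\<alpha> U (v, w))"
      using diff_mul[OF U \<alpha>sec[OF U k'(2,3)] aug_closed[OF U esec[OF U k]]] diff_aug[OF U esec[OF U k]]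
        diff_closed[OF U \<alpha>sec[OF U k'(2,3)]] U by (simp add: \<alpha>'_def k'(1) del: One_nat_def)
    then show "Diff I 0 U (\<alpha>' U k) = \<beta> U (case k of (v, w, b) \<Rightarrow> w) \<otimes>\<^bsub>Grp (Term I 1) U\<^esub> inv\<^bsub>Grp (Term I 1) U\<^esub> (\<beta> U (case k of (v, w, b) \<Rightarrow> v))"
      using d0[rule_format, OF U, of "(v, w)"] k' by (simp del: One_nat_def)
  qed
qed

end

theorem theorem2p5:
  fixes S :: "('o, 'a) site"
    and M :: "('o, 'a, 'm) group_presheaf"
    and I :: "('o, 'a, 'a \<Rightarrow> (('m \<times> 'm) \<Rightarrow>\<^sub>0 int) set set, 'i) resolution"
    and x :: "('o, 'a, 'p, 'm) torsor set"
  assumes "is_site S"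
    and "is_abelian_sheaf S M"
    and "injective_resolution S (tensor_sheaf S M M) I"
    and "x \<in> H1 S M"
  shows "central_extension S (tensor_sheaf S M M) (U_sheaf S M) M (U_incl M) U_proj \<and>
         connecting_map S (tensor_sheaf S M M) (U_sheaf S M) M (U_incl M) U_proj I x
         = cup_product S M M I x x"
proof -
  interpret resolved S M I
    using assms(1-3) by unfold_locales
  let ?K = "cover_presheaf S"
  have "(\<exists>P\<in>x. \<exists>\<V> s. covers_final S \<V> \<and> presheaf_map S (?K \<V>) P s \<and>
        cocycle_has_class S I (?K \<V>) (lift_presheaf U_M U_proj (?K \<V>) (torsor_cocycle M P s))
          (\<lambda>(v, w, b). v) (\<lambda>(v, w, b). w) (obstruction_cocycle T U_M (U_incl M)) \<xi>) \<longleftrightarrow>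
      (\<exists>P\<in>x. \<exists>Q\<in>x. \<exists>\<V> s t. covers_final S \<V> \<and> presheaf_map S (?K \<V>) P s \<and> presheaf_map S (?K \<V>) Q t \<and>
        cocycle_has_class S I (?K \<V>) (pair_presheaf (?K \<V>)) fst snd
          (\<lambda>U (v0, v1) (v1', v2) _. tens U (torsor_cocycle M P s U v0 v1) (torsor_cocycle M Q t U v1' v2)) \<xi>)"
    (is "?conn = ?cup") for \<xi>
  proof
    assume ?conn
    then obtain P \<V> s where P: "P \<in> x" and \<V>: "covers_final S \<V>" and s: "presheaf_map S (?K \<V>) P s"
      and ob: "cocycle_has_class S I (?K \<V>) (lift_presheaf U_M U_proj (?K \<V>) (torsor_cocycle M P s))
          (\<lambda>(v, w, b). v) (\<lambda>(v, w, b). w) (obstruction_cocycle T U_M (U_incl M)) \<xi>"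
      by blast
    have "is_torsor S M P"
      using H1_iso[OF assms(4) P P] by auto
    \<comment> \<open>For the cup product both factors are represented by the same torsor P with the
      same trivialization s.\<close>
    from P \<V> s obstruction_imp_cup[OF this s ob] show ?cup
      by blast
  next
    assume ?cup
    then obtain P Q \<V> s t where P: "P \<in> x" "Q \<in> x" and \<V>: "covers_final S \<V>"
      and s: "presheaf_map S (?K \<V>) P s" and t: "presheaf_map S (?K \<V>) Q t"
      and cup: "cocycle_has_class S I (?K \<V>) (pair_presheaf (?K \<V>)) fst snd
          (\<lambda>U (v0, v1) (v1', v2) _. tens U (torsor_cocycle M P s U v0 v1) (torsor_cocycle M Q t U v1' v2)) \<xi>"
      by blast
    from P(1) \<V> s cup_imp_obstruction[OF assms(4) P s t cup] show ?conn
      by blast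
  qed
  \<comment> \<open>The predicates under the two definite descriptions are equivalent for every
    \<xi>, so the descriptions denote the same object.\<close>
  then show ?thesis
    using central_extension_U_M unfolding connecting_map_def cup_product_def by simp
qed

end
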